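(* Let $\Gamma<H$ be a discrete subgroup, $h\in H$, and $t\ne0$. (1) We have $\dim\overline{\Gamma ha_tH}=2+\dim\overline{\Gamma hA_0}$. (2) Let $Y_{L,t}=ha_tHo$ for $L=hA_0o$. Suppose that $L$ is admissible. Then $$\tfrac12\left(3+\dim\overline{\Gamma hA_0}\right)\le\dim\overline{\Gamma Y_{L,t}}\le1+\dim\overline{\Gamma hA_0}.$$ (3) In particular, if (with $L$ admissible) $1<\dim\overline{\Gamma\backslash\Gamma hA_0}<2$, then $\dim\overline{\Gamma Y_{L,t}}\in(2,3)$.
   Context: $\dim$ is Hausdorff dimension; closures are taken in $G$, $H$, $X$ or $\Gamma\backslash H$ as appropriate, with Riemannian distances. Let $G=\mathrm{SL}_3(\mathbb{R})$, $K=\mathrm{SO}(3)$, $X=G/K$, $o=[K]$. Let $F(x,y,z)=2xz-y^2$, let $H$ be the identity component of $\{g\in G:F\circ g=F\}$, $Y=Ho$, $A_0=\{\mathrm{diag}(e^s,1,e^{-s}):s\in\mathbb{R}\}<H$, and $a_t=\mathrm{diag}(e^t,e^{-2t},e^t)$. Admissibility. Let $N_0^-$ and $N_0^+$ be the intersections with $H$ of the upper, resp. lower, triangular unipotent subgroups of $G$. A basic open subset of $H$ is $\mathcal O=h_0U^+U^-A_0$ with $h_0\in H$ and $U^\pm\subset N_0^\pm$ open neighborhoods of $e$; let $\pi_\pm:\mathcal O\to N_0^\pm$ be $\pi_\pm(h_0n^+n^-a)=n^\pm$. An $A_0$-invariant set $Z\subset H$ is admissible if the box dimension of $\pi_\pm(\overline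 Z\cap\mathcal O)$ equals its Hausdorff dimension for all sufficiently small basic open subsets $\mathcal O$. The geodesic $L=hA_0o\subset Y$ is admissible if $\Gamma hA_0$ is admissible. *)

theory Defs
  imports "HOL-Analysis.Analysis" "HOL-Algebra.Left_Coset"
begin

section \<open>Hausdorff and box dimension with respect to a distance function\<close>

definition ediam :: "('a \<Rightarrow> 'a \<Rightarrow> real) \<Rightarrow> 'a set \<Rightarrow> ennreal" where
  "ediam d U = (SUP x\<in>U. SUP y\<in>U. ennreal (d x y))"

text \<open>Covers are taken by subsets of \<open>A\<close>. Replacing \<open>U i\<close> by \<open>U i \<inter> A\<close> does not increase
  diameters, so this is no restriction, and only the values of \<open>d\<close> on \<open>A\<close> matter.\<close>

definition hausdorff_premeasure ::
    "('a \<Rightarrow> 'a \<Rightarrow> real) \<Rightarrow> real \<Rightarrow> real \<Rightarrow> 'a set \<Rightarrow> ennreal" where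
  "hausdorff_premeasure d s \<delta> A =
     (INF U \<in> {U :: nat \<Rightarrow> 'a set. (\<Union>i. U i) = A \<and> (\<forall>i. ediam d (U i) \<le> ennreal \<delta>)}.
        \<Sum>i. ennreal (enn2real (ediam d (U i)) powr s))"

definition hausdorff_measure :: "('a \<Rightarrow> 'a \<Rightarrow> real) \<Rightarrow> real \<Rightarrow> 'a set \<Rightarrow> ennreal" where
  "hausdorff_measure d s A = (SUP \<delta>\<in>{0<..}. hausdorff_premeasure d s \<delta> A)"

text \<open>Only \<open>s > 0\<close> is used, which avoids the convention for \<open>0 powr 0\<close> and does not change
  the infimum. The empty set has dimension \<open>0\<close>.\<close>

definition hausdorff_dim :: "('a \<Rightarrow> 'a \<Rightarrow> real) \<Rightarrow> 'a set \<Rightarrow> ennreal" where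
  "hausdorff_dim d A = (INF s\<in>{s. 0 < s \<and> hausdorff_measure d s A = 0}. ennreal s)"

definition finite_cover :: "('a \<Rightarrow> 'a \<Rightarrow> real) \<Rightarrow> real \<Rightarrow> 'a set \<Rightarrow> 'a set set \<Rightarrow> bool" where
  "finite_cover d \<epsilon> S C \<longleftrightarrow> finite C \<and> \<Union>C = S \<and> (\<forall>c\<in>C. ediam d c \<le> ennreal \<epsilon>)"

definition covering_number :: "('a \<Rightarrow> 'a \<Rightarrow> real) \<Rightarrow> 'a set \<Rightarrow> real \<Rightarrow> nat" where
  "covering_number d S \<epsilon> = (LEAST n. \<exists>C. finite_cover d \<epsilon> S C \<and> card C = n)"

text \<open>The box dimension exists, as a limit (lower and upper box dimensions agree), and equals
  \<open>b\<close>. Because \<open>ln 0 = 0\<close>, the empty set has box dimension \<open>0\<close>.\<close>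

definition has_box_dim :: "('a \<Rightarrow> 'a \<Rightarrow> real) \<Rightarrow> 'a set \<Rightarrow> real \<Rightarrow> bool" where
  "has_box_dim d S b \<longleftrightarrow>
     (\<forall>\<epsilon>>0. \<exists>C. finite_cover d \<epsilon> S C) \<and>
     ((\<lambda>\<epsilon>. ln (real (covering_number d S \<epsilon>)) / ln (1 / \<epsilon>)) \<longlongrightarrow> b) (at_right 0)"

section \<open>The group, its subgroups and the quotients\<close>

definition SL3 :: "(real^3^3) monoid" where
  "SL3 = \<lparr>carrier = {A. det A = 1}, mult = (**), one = mat 1\<rparr>"

definition SO3 :: "(real^3^3) set" where
  "SO3 = {A. orthogonal_matrix A \<and> det A = 1}"

definition diag3 :: "real \<Rightarrow> real \<Rightarrow> real \<Rightarrow> real^3^3" where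
  "diag3 a b c = vector [vector [a, 0, 0], vector [0, b, 0], vector [0, 0, c]]"

definition quad_form :: "real^3 \<Rightarrow> real" where
  "quad_form v = 2 * v$1 * v$3 - (v$2)\<^sup>2"

text \<open>\<open>SOF\<close> is the group \<open>H\<close>.\<close>

definition SOF :: "(real^3^3) set" where
  "SOF = connected_component_set
     {g \<in> carrier SL3. quad_form \<circ> (\<lambda>v. g *v v) = quad_form} (mat 1)"

definition A0 :: "(real^3^3) set" where
  "A0 = {diag3 (exp s) 1 (exp (- s)) | s. True}"

definition a_mat :: "real \<Rightarrow> real^3^3" where
  "a_mat t = diag3 (exp t) (exp (- 2 * t)) (exp t)"

definition N0_minus :: "(real^3^3) set" where
  "N0_minus = {n \<in> SOF. (\<forall>i. n$i$i = 1) \<and> n$2$1 = 0 \<and> n$3$1 = 0 \<and> n$3$2 = 0}"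

definition N0_plus :: "(real^3^3) set" where
  "N0_plus = {n \<in> SOF. (\<forall>i. n$i$i = 1) \<and> n$1$2 = 0 \<and> n$1$3 = 0 \<and> n$2$3 = 0}"

definition quot_topology :: "'a topology \<Rightarrow> ('a \<Rightarrow> 'b) \<Rightarrow> 'b topology" where
  "quot_topology T p =
     topology (\<lambda>U. U \<subseteq> p ` topspace T \<and> openin T {x \<in> topspace T. p x \<in> U})"

lemma openin_quot_topology:
  "openin (quot_topology T p) U \<longleftrightarrow>
     U \<subseteq> p ` topspace T \<and> openin T {x \<in> topspace T. p x \<in> U}"
proof -
  have "istopology (\<lambda>U. U \<subseteq> p ` topspace T \<and> openin T {x \<in> topspace T. p x \<in> U})"
    unfolding istopology_def
  proof (intro conjI allI impI)
    fix S U
    assume "S \<subseteq> p ` topspace T \<and> openin T {x \<in> topspace T. p x \<in> S}"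
      and "U \<subseteq> p ` topspace T \<and> openin T {x \<in> topspace T. p x \<in> U}"
    then have "openin T ({x \<in> topspace T. p x \<in> S} \<inter> {x \<in> topspace T. p x \<in> U})"
      by blast
    moreover have "{x \<in> topspace T. p x \<in> S} \<inter> {x \<in> topspace T. p x \<in> U} =
        {x \<in> topspace T. p x \<in> S \<inter> U}" by blast
    ultimately show "openin T {x \<in> topspace T. p x \<in> S \<inter> U}" by simp
  next
    fix \<K>
    assume *: "\<forall>S\<in>\<K>. S \<subseteq> p ` topspace T \<and> openin T {x \<in> topspace T. p x \<in> S}"
    then have "openin T (\<Union>S\<in>\<K>. {x \<in> topspace T. p x \<in> S})" by blast
    moreover have "(\<Union>S\<in>\<K>. {x \<in> topspace T. p x \<in> S}) =
        {x \<in> topspace T. p x \<in> \<Union>\<K>}" by blast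
    ultimately show "openin T {x \<in> topspace T. p x \<in> \<Union>\<K>}" by simp
  qed blast+
  then show ?thesis by (simp add: quot_topology_def topology_inverse')
qed

lemma quotient_map_quot_topology: "quotient_map T (quot_topology T p) p"
proof -
  have "{x \<in> topspace T. p x \<in> p ` topspace T} = topspace T" by blast
  then have "openin (quot_topology T p) (p ` topspace T)"
    by (simp add: openin_quot_topology)
  then have "topspace (quot_topology T p) = p ` topspace T"
    by (metis openin_quot_topology openin_subset openin_topspace subset_antisym)
  then show ?thesis by (auto simp: quotient_map_def openin_quot_topology)
qed

lemma group_SL3: "group SL3"
proof (rule groupI)
  fix x assume "x \<in> carrier SL3"
  then have x: "det x = 1" by (simp add: SL3_def)
  then obtain y where y: "y ** x = mat 1"
    using invertible_det_nz[of x] unfolding invertible_def by auto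
  then have "det y = 1" using x det_mul[of y x] by simp
  then show "\<exists>y\<in>carrier SL3. y \<otimes>\<^bsub>SL3\<^esub> x = \<one>\<^bsub>SL3\<^esub>"
    using y by (auto simp: SL3_def)
qed (auto simp: SL3_def det_mul matrix_mul_assoc)

abbreviation G_topology :: "(real^3^3) topology" where
  "G_topology \<equiv> top_of_set (carrier SL3)"

abbreviation H_topology :: "(real^3^3) topology" where
  "H_topology \<equiv> top_of_set SOF"

definition X_proj :: "real^3^3 \<Rightarrow> (real^3^3) set" where
  "X_proj g = g <#\<^bsub>SL3\<^esub> SO3"

definition X_topology :: "(real^3^3) set topology" where
  "X_topology = quot_topology G_topology X_proj"

definition GammaH_topology :: "(real^3^3) set \<Rightarrow> (real^3^3) set topology" where
  "GammaH_topology \<Gamma> = quot_topology H_topology (\<lambda>x. \<Gamma> #>\<^bsub>SL3\<^esub> x)"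

section \<open>Riemannian distances\<close>

text \<open>Distance of the left-invariant Riemannian metric on a connected matrix group \<open>S\<close> that
  is the Frobenius inner product on the Lie algebra. Lengths are required to exist, because
  \<^const>\<open>piecewise_C1_differentiable_on\<close> allows unbounded derivatives near break points
  and \<^const>\<open>integral\<close> is \<open>0\<close> for a function that is not integrable.\<close>

definition riem_dist :: "(real^3^3) set \<Rightarrow> real^3^3 \<Rightarrow> real^3^3 \<Rightarrow> real" where
  "riem_dist S x y = Inf {l. \<exists>p. valid_path p \<and> path_image p \<subseteq> S \<and>
     pathstart p = x \<and> pathfinish p = y \<and>
     ((\<lambda>t. norm (matrix_inv (p t) ** vector_derivative p (at t))) has_integral l) {0..1}}"

definition G_dist :: "real^3^3 \<Rightarrow> real^3^3 \<Rightarrow> real" where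
  "G_dist = riem_dist (carrier SL3)"

definition H_dist :: "real^3^3 \<Rightarrow> real^3^3 \<Rightarrow> real" where
  "H_dist = riem_dist SOF"

text \<open>The metric on \<open>G\<close> is also right \<open>K\<close>-invariant and the metric on \<open>H\<close> is left
  \<open>\<Gamma>\<close>-invariant, so \<open>G/K\<close> and \<open>\<Gamma>\H\<close> carry the Riemannian metrics that make the projections a
  Riemannian submersion and a Riemannian covering. By lifting of paths, their Riemannian
  distances are the distances between fibres. On \<open>G/K\<close> this is the \<open>G\<close>-invariant metric
  of the symmetric space.\<close>

definition quot_dist :: "('a \<Rightarrow> 'a \<Rightarrow> real) \<Rightarrow> 'a set \<Rightarrow> 'a set \<Rightarrow> real" where
  "quot_dist d P Q = Inf {d x y | x y. x \<in> P \<and> y \<in> Q}"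

definition dim_G :: "(real^3^3) set \<Rightarrow> ennreal" where
  "dim_G = hausdorff_dim G_dist"

definition dim_H :: "(real^3^3) set \<Rightarrow> ennreal" where
  "dim_H = hausdorff_dim H_dist"

definition dim_X :: "(real^3^3) set set \<Rightarrow> ennreal" where
  "dim_X = hausdorff_dim (quot_dist G_dist)"

definition dim_GammaH :: "(real^3^3) set set \<Rightarrow> ennreal" where
  "dim_GammaH = hausdorff_dim (quot_dist H_dist)"

section \<open>Admissibility\<close>

definition basic_open :: "real^3^3 \<Rightarrow> (real^3^3) set \<Rightarrow> (real^3^3) set \<Rightarrow> (real^3^3) set" where
  "basic_open h0 Up Um = {h0 ** n ** m ** a | n m a. n \<in> Up \<and> m \<in> Um \<and> a \<in> A0}"

text \<open>The factorization \<open>g = h0 n m a\<close> is unique, so these do not depend on the neighborhoods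
  defining the basic open set.\<close>

definition pi_plus :: "real^3^3 \<Rightarrow> real^3^3 \<Rightarrow> real^3^3" where
  "pi_plus h0 g = (THE n. n \<in> N0_plus \<and> (\<exists>m\<in>N0_minus. \<exists>a\<in>A0. g = h0 ** n ** m ** a))"

definition pi_minus :: "real^3^3 \<Rightarrow> real^3^3 \<Rightarrow> real^3^3" where
  "pi_minus h0 g = (THE m. m \<in> N0_minus \<and> (\<exists>n\<in>N0_plus. \<exists>a\<in>A0. g = h0 ** n ** m ** a))"

definition open_nhd_e :: "(real^3^3) set \<Rightarrow> (real^3^3) set \<Rightarrow> bool" where
  "open_nhd_e N U \<longleftrightarrow> openin (top_of_set N) U \<and> mat 1 \<in> U"

definition box_eq_hausdorff :: "(real^3^3) set \<Rightarrow> bool" where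
  "box_eq_hausdorff S \<longleftrightarrow> (\<exists>b. has_box_dim H_dist S b \<and> dim_H S = ennreal b)"

text \<open>A basic open set is \<open>A0\<close>-invariant, so its size is that of \<open>Up\<close> and \<open>Um\<close>. The
  smallness threshold may depend on the base point \<open>h0\<close>: a bound uniform in \<open>h0\<close> would not be a
  smallness condition, since moving \<open>h0\<close> by \<open>A0\<close> rescales \<open>Up\<close> and \<open>Um\<close> in opposite directions.\<close>

definition admissible :: "(real^3^3) set \<Rightarrow> bool" where
  "admissible Z \<longleftrightarrow> Z \<subseteq> SOF \<and> (\<forall>z\<in>Z. \<forall>a\<in>A0. z ** a \<in> Z) \<and>
     (\<forall>h0\<in>SOF. \<exists>Vp Vm. open_nhd_e N0_plus Vp \<and> open_nhd_e N0_minus Vm \<and>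
        (\<forall>Up Um. open_nhd_e N0_plus Up \<and> Up \<subseteq> Vp \<and> open_nhd_e N0_minus Um \<and> Um \<subseteq> Vm \<longrightarrow>
           box_eq_hausdorff
             (pi_plus h0 ` ((H_topology closure_of Z) \<inter> basic_open h0 Up Um)) \<and>
           box_eq_hausdorff
             (pi_minus h0 ` ((H_topology closure_of Z) \<inter> basic_open h0 Up Um))))"

definition Gamma_h_A0 :: "(real^3^3) set \<Rightarrow> real^3^3 \<Rightarrow> (real^3^3) set" where
  "Gamma_h_A0 \<Gamma> h = \<Gamma> <#>\<^bsub>SL3\<^esub> (h <#\<^bsub>SL3\<^esub> A0)"

text \<open>Admissibility of the geodesic \<open>L = h A0 o\<close>, which is represented by \<open>h\<close>.\<close>

definition geodesic_admissible :: "(real^3^3) set \<Rightarrow> real^3^3 \<Rightarrow> bool" where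
  "geodesic_admissible \<Gamma> h \<longleftrightarrow> admissible (Gamma_h_A0 \<Gamma> h)"

text \<open>\<open>Y_plane h t\<close> is the subset \<open>h a_t H o\<close> of \<open>G/K\<close>.\<close>

definition Y_plane :: "real^3^3 \<Rightarrow> real \<Rightarrow> (real^3^3) set set" where
  "Y_plane h t = (\<lambda>g. X_proj (h ** a_mat t ** g)) ` SOF"

definition Gamma_orbit :: "(real^3^3) set \<Rightarrow> (real^3^3) set set \<Rightarrow> (real^3^3) set set" where
  "Gamma_orbit \<Gamma> S = (\<Union>\<gamma>\<in>\<Gamma>. (\<lambda>x. \<gamma> <#\<^bsub>SL3\<^esub> x) ` S)"

end

theory Submission
  imports Defs
begin

text \<open>
  Put \<open>Z = closure (\<Gamma> h A0)\<close> and \<open>a = a_mat t\<close>; let \<open>J\<close> be the matrix of the quadratic form and let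
  \<open>N\<close> be the upper unipotent subgroup of \<open>H\<close>.
  Since \<open>a\<close> commutes with \<open>A0\<close>, and since \<open>w J w\<^sup>T\<close> bounds the \<open>N\<close>-part of \<open>z\<close> for \<open>w = z a g\<close>,
  \<open>z \<in> K N A0\<close>, \<open>g \<in> H\<close>, the set \<open>Z a H\<close> is closed: it is the closure of \<open>\<Gamma> h a H\<close>, and its image
  in \<open>G/K\<close> is the closure of \<open>\<Gamma> Y\<close>. The set \<open>Z a H\<close> is covered by two right translates of
  the products \<open>z a n m\<close> with \<open>n\<close>, \<open>m\<close> upper and lower unipotent, and its image by the points
  \<open>z a n o\<close> (Iwasawa decomposition).
  For \<open>t \<noteq> 0\<close> the maps \<open>(z, n, m) \<mapsto> z a n m\<close> and \<open>(z, n) \<mapsto> z a n o\<close> are immersions of \<open>H \<times> \<real>\<^sup>2\<close> and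
  \<open>H \<times> \<real>\<close> at suitable points, so they are bi-Lipschitz near them. As \<open>Z \<times> \<real>\<close> has dimension
  \<open>1 + dim Z\<close> for every set \<open>Z\<close>, the two closures have dimensions \<open>2 + dim Z\<close> and exactly \<open>1 + dim Z\<close>,
  and \<open>(3 + dim Z)/2 \<le> 1 + dim Z\<close> because \<open>Z\<close> contains a curve.
\<close>

section \<open>Hausdorff null sets\<close>

text \<open>Only null sets are compared. A dimension is the infimum of the exponents of vanishing
  measure; nullness survives countable unions and Lipschitz maps and, by Lindelof, may be tested on
  small neighbourhoods. So no uniform metric estimate is required, and the Riemannian distances
  enter through local comparison with the Euclidean one. Dimension is not additive for products of
  arbitrary sets. With an interval as a factor it is, since the cost of a cover can be averaged over
  the slices. The immersion estimates avoid charts. Points \<open>z\<close>, \<open>z'\<close> are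
  replaced by \<open>x = z'^{-1} z\<close> and \<open>1\<close>, and the linear part of the equation
  \<open>x^T J x = J\<close> at \<open>1\<close> is adjoined to the differential. Injectivity of the
  enlarged map on all matrices comes down to two by two systems that are regular because
  \<open>t \<noteq> 0\<close>. Distances in \<open>G/K\<close> are bounded below through the
  positive matrices \<open>g g^T\<close>. There \<open>r\<close> and \<open>x\<close> are recovered
  one after the other: an invariant trace controls \<open>r\<close>, then a commutator with a fixed
  matrix controls \<open>x\<close>.\<close>

definition hausdorff_cover ::
    "('a \<Rightarrow> 'a \<Rightarrow> real) \<Rightarrow> real \<Rightarrow> real \<Rightarrow> 'a set \<Rightarrow> (nat \<Rightarrow> 'a set) \<Rightarrow> (nat \<Rightarrow> real) \<Rightarrow> bool" where
  "hausdorff_cover d s e A U r \<longleftrightarrow> A \<subseteq> (\<Union>i. U i) \<and> (\<forall>i. 0 \<le> r i) \<and>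
     (\<forall>i. \<forall>x\<in>U i \<inter> A. \<forall>y\<in>U i \<inter> A. d x y \<le> r i) \<and> (\<Sum>i. ennreal (r i powr s)) < ennreal e"

text \<open>This is vanishing content rather than measure: no bound on the diameters is imposed. The
  \<open>r i\<close> are arbitrary real upper bounds of the diameters, so later estimates can
  rescale them without computing \<open>ediam\<close>.\<close>

definition hausdorff_null :: "('a \<Rightarrow> 'a \<Rightarrow> real) \<Rightarrow> real \<Rightarrow> 'a set \<Rightarrow> bool" where
  "hausdorff_null d s A \<longleftrightarrow> (\<forall>e>0. \<exists>U r. hausdorff_cover d s e A U r)"

lemma hausdorff_coverI:
  assumes "A \<subseteq> (\<Union>i. U i)" "\<And>i. 0 \<le> r i" "(\<Sum>i. ennreal (r i powr s)) < ennreal e"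
    "\<And>i x y. x \<in> U i \<Longrightarrow> x \<in> A \<Longrightarrow> y \<in> U i \<Longrightarrow> y \<in> A \<Longrightarrow> d x y \<le> r i"
  shows "hausdorff_cover d s e A U r"
  unfolding hausdorff_cover_def using assms by auto

lemma hausdorff_coverD:
  assumes "hausdorff_cover d s e A U r"
  shows "A \<subseteq> (\<Union>i. U i)" "0 \<le> r i" "(\<Sum>i. ennreal (r i powr s)) < ennreal e"
    "x \<in> U i \<Longrightarrow> x \<in> A \<Longrightarrow> y \<in> U i \<Longrightarrow> y \<in> A \<Longrightarrow> d x y \<le> r i"
  using assms unfolding hausdorff_cover_def by auto

lemma hausdorff_nullI: "(\<And>e. 0 < e \<Longrightarrow> \<exists>U r. hausdorff_cover d s e A U r) \<Longrightarrow> hausdorff_null d s A"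
  by (simp add: hausdorff_null_def)

lemma hausdorff_nullE:
  assumes "hausdorff_null d s A" "0 < e"
  obtains U r where "hausdorff_cover d s e A U r"
  using assms unfolding hausdorff_null_def by blast

lemma ediam_le_iff:
  "0 \<le> r \<Longrightarrow> ediam d U \<le> ennreal r \<longleftrightarrow> (\<forall>x\<in>U. \<forall>y\<in>U. d x y \<le> r)"
  by (simp add: ediam_def SUP_le_iff ennreal_le_iff)

lemma term_le_suminf_ennreal: "f i \<le> (\<Sum>i. f i :: ennreal)"
proof -
  have "sum f {i} \<le> suminf f" by (rule sum_le_suminf) (auto intro: summableI)
  then show ?thesis by simp
qed

text \<open>One term of a small sum is small, so a bound on the content is also a bound on every
  diameter. This reconciles content with measure.\<close>

lemma hausdorff_cover_radius_less:
  assumes "hausdorff_cover d s (c powr s) A U r" "0 < s" "0 \<le> c"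
  shows "r i < c"
proof -
  have "ennreal (r i powr s) \<le> (\<Sum>i. ennreal (r i powr s))" by (rule term_le_suminf_ennreal)
  also have "\<dots> < ennreal (c powr s)" by (rule hausdorff_coverD(3)[OF assms(1)])
  finally have "r i powr s < c powr s" by (simp add: ennreal_less_iff)
  then show ?thesis using assms(2,3) by (meson not_le powr_mono2 less_imp_le)
qed

lemma hausdorff_cover_mono:
  assumes "hausdorff_cover d s e A U r" "e \<le> e'" "B \<subseteq> A"
  shows "hausdorff_cover d s e' B U r"
proof (rule hausdorff_coverI)
  show "B \<subseteq> (\<Union>i. U i)" using assms(3) hausdorff_coverD(1)[OF assms(1)] by (rule subset_trans)
  show "(\<Sum>i. ennreal (r i powr s)) < ennreal e'"
    using hausdorff_coverD(3)[OF assms(1)] ennreal_leI[OF assms(2)] by (rule less_le_trans)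
  show "d x y \<le> r i" if "x \<in> U i" "x \<in> B" "y \<in> U i" "y \<in> B" for i x y
    by (rule hausdorff_coverD(4)[OF assms(1)]) (use that assms(3) in auto)
qed (rule hausdorff_coverD(2)[OF assms(1)])

lemma hausdorff_measure_eq_0_iff:
  assumes "0 < s"
  shows "hausdorff_measure d s A = 0 \<longleftrightarrow> hausdorff_null d s A"
proof
  assume "hausdorff_measure d s A = 0"
  then have "hausdorff_premeasure d s 1 A \<le> 0"
    unfolding hausdorff_measure_def by (metis SUP_upper greaterThan_iff zero_less_one)
  then have p: "hausdorff_premeasure d s 1 A = 0" by simp
  show "hausdorff_null d s A"
  proof (rule hausdorff_nullI)
    fix e :: real assume "0 < e"
    then have "hausdorff_premeasure d s 1 A < ennreal e" using p by simp
    then obtain U :: "nat \<Rightarrow> 'a set" where U: "(\<Union>i. U i) = A" "\<forall>i. ediam d (U i) \<le> ennreal 1"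
      "(\<Sum>i. ennreal (enn2real (ediam d (U i)) powr s)) < ennreal e"
      unfolding hausdorff_premeasure_def INF_less_iff by auto
    have "d x y \<le> enn2real (ediam d (U i))" if "x \<in> U i" "y \<in> U i" for i x y
    proof -
      have "ediam d (U i) < Orderings.top" using U(2) by (metis ennreal_less_top le_less_trans)
      then have "ediam d (U i) \<le> ennreal (enn2real (ediam d (U i)))" by simp
      then show ?thesis using ediam_le_iff[of "enn2real (ediam d (U i))" d "U i"] that by simp
    qed
    then have "hausdorff_cover d s e A U (\<lambda>i. enn2real (ediam d (U i)))"
      using U by (intro hausdorff_coverI) auto
    then show "\<exists>U r. hausdorff_cover d s e A U r" by blast
  qed
next
  assume n: "hausdorff_null d s A"
  have *: "hausdorff_premeasure d s \<delta> A \<le> 0 + ennreal e" if "0 < \<delta>" "0 < e" for \<delta> e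
  proof -
    \<comment> \<open>The second entry forces all radii below \<open>\<delta>\<close>, which is the
      restriction in the premeasure.\<close>
    have pos: "0 < min e (\<delta> powr s)" using that by simp
    obtain U r where c: "hausdorff_cover d s (min e (\<delta> powr s)) A U r"
      by (rule hausdorff_nullE[OF n pos])
    note U = hausdorff_coverD[OF c]
    have r: "r i < \<delta>" for i
      by (rule hausdorff_cover_radius_less[OF hausdorff_cover_mono[OF c]]) (use that assms in auto)
    have d: "ediam d (U i \<inter> A) \<le> ennreal (r i)" for i
      using U(2,4) by (simp add: ediam_le_iff)
    have "hausdorff_premeasure d s \<delta> A \<le> (\<Sum>i. ennreal (enn2real (ediam d (U i \<inter> A)) powr s))"
      unfolding hausdorff_premeasure_def
    proof (rule INF_lower)
      have "ediam d (U i \<inter> A) \<le> ennreal \<delta>" for i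
        using d[of i] r[of i] by (meson ennreal_leI less_imp_le order_trans)
      then show "(\<lambda>i. U i \<inter> A) \<in> {U :: nat \<Rightarrow> 'a set. (\<Union>i. U i) = A \<and>
          (\<forall>i. ediam d (U i) \<le> ennreal \<delta>)}" using U(1) by auto
    qed
    also have "\<dots> \<le> (\<Sum>i. ennreal (r i powr s))"
    proof (intro suminf_le summableI ennreal_leI powr_mono2)
      show "enn2real (ediam d (U i \<inter> A)) \<le> r i" for i using d U(2) by (simp add: enn2real_leI)
    qed (use assms in auto)
    also have "\<dots> \<le> ennreal e"
      by (rule less_imp_le[OF hausdorff_coverD(3)[OF hausdorff_cover_mono[OF c _ order_refl]]]) simp
    finally show ?thesis by simp
  qed
  have "hausdorff_premeasure d s \<delta> A \<le> 0" if "0 < \<delta>" for \<delta>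
    by (rule ennreal_le_epsilon) (rule *[OF that])
  then have "hausdorff_measure d s A \<le> 0"
    unfolding hausdorff_measure_def by (intro SUP_least) simp
  then show "hausdorff_measure d s A = 0" by simp
qed

lemma hausdorff_dim_eq_INF:
  "hausdorff_dim d A = (INF s\<in>{s. 0 < s \<and> hausdorff_null d s A}. ennreal s)"
  unfolding hausdorff_dim_def
  by (intro arg_cong[where f=Inf] image_cong) (auto simp: hausdorff_measure_eq_0_iff)

lemma hausdorff_cover_prod:
  fixes U :: "nat \<Rightarrow> nat \<Rightarrow> 'a set"
  assumes "A \<subseteq> (\<Union>i j. U i j)" "\<And>i j. 0 \<le> r i j" "(\<Sum>i. \<Sum>j. ennreal (r i j powr s)) < ennreal e"
    "\<And>i j x y. x \<in> U i j \<Longrightarrow> x \<in> A \<Longrightarrow> y \<in> U i j \<Longrightarrow> y \<in> A \<Longrightarrow> d x y \<le> r i j"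
  shows "\<exists>U r. hausdorff_cover d s e A U r"
proof -
  have "hausdorff_cover d s e A (\<lambda>i. case_prod U (prod_decode i)) (\<lambda>i. case_prod r (prod_decode i))"
  proof (rule hausdorff_coverI)
    show "A \<subseteq> (\<Union>i. case_prod U (prod_decode i))"
    proof
      fix x assume "x \<in> A"
      then obtain i j where "x \<in> U i j" using assms(1) by blast
      then have "x \<in> case_prod U (prod_decode (prod_encode (i, j)))" by simp
      then show "x \<in> (\<Union>i. case_prod U (prod_decode i))" by (rule UN_I[OF UNIV_I])
    qed
    have "(\<Sum>i. ennreal (case_prod r (prod_decode i) powr s)) = (\<Sum>i. \<Sum>j. ennreal (r i j powr s))"
      by (rule suminf_ennreal_2dimen[where f = "\<lambda>p. ennreal (case_prod r p powr s)"]) simp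
    with assms(3) show "(\<Sum>i. ennreal (case_prod r (prod_decode i) powr s)) < ennreal e" by (simp only:)
    fix i
    show "0 \<le> case_prod r (prod_decode i)" using assms(2) by (simp split: prod.split)
    show "d x y \<le> case_prod r (prod_decode i)"
      if "x \<in> case_prod U (prod_decode i)" "x \<in> A" "y \<in> case_prod U (prod_decode i)" "y \<in> A" for x y
      using assms(4) that by (cases "prod_decode i") simp
  qed
  then show ?thesis by blast
qed

lemma suminf_ennreal_halves:
  assumes "0 \<le> e" shows "(\<Sum>i. ennreal (e * (1/2) ^ Suc i)) = ennreal e"
proof (rule suminf_ennreal_eq)
  show "(\<lambda>i. e * (1/2) ^ Suc i) sums e"
    using sums_mult[OF power_half_series, of e] by simp
qed (use assms in auto)

text \<open>The product estimates divide by the radii. Pieces of radius 0 therefore receive radii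
  whose \<open>s\<close>-th powers form a geometric series consuming half of the budget.\<close>

lemma hausdorff_nullE_pos:
  assumes "hausdorff_null d s A" "0 < e" "0 < s"
  obtains U r where "hausdorff_cover d s e A U r" "\<And>i. 0 < r i"
proof -
  obtain U r where c: "hausdorff_cover d s (e/2) A U r"
    by (rule hausdorff_nullE[OF assms(1) half_gt_zero[OF assms(2)]])
  note U = hausdorff_coverD[OF c]
  define q where "q i = (if r i = 0 then (e/2 * (1/2) ^ Suc i) powr (1/s) else r i)" for i
  have q: "ennreal (q i powr s) \<le> ennreal (r i powr s) + ennreal (e/2 * (1/2) ^ Suc i)" for i
    using assms(2,3) by (auto simp: q_def powr_powr powr_one simp flip: ennreal_plus)
  have "(\<Sum>i. ennreal (q i powr s)) \<le> (\<Sum>i. ennreal (r i powr s) + ennreal (e/2 * (1/2) ^ Suc i))"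
    by (intro suminf_le summableI q)
  also have "\<dots> = (\<Sum>i. ennreal (r i powr s)) + (\<Sum>i. ennreal (e/2 * (1/2) ^ Suc i))"
    by (intro suminf_add[symmetric] summableI)
  also have "\<dots> = ennreal (e/2) + (\<Sum>i. ennreal (r i powr s))"
    using suminf_ennreal_halves[of "e/2"] assms(2) by (simp only: add.commute half_gt_zero less_imp_le)
  also have "\<dots> < ennreal (e/2) + ennreal (e/2)"
    using U(3) by (simp add: ennreal_add_left_cancel_less)
  also have "\<dots> = ennreal e" using assms(2) by (simp flip: ennreal_plus)
  finally have *: "(\<Sum>i. ennreal (q i powr s)) < ennreal e" .
  have rq: "r i \<le> q i" and q0: "0 < q i" for i using U(2)[of i] assms(2) by (auto simp: q_def)
  have "hausdorff_cover d s e A U q"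
    by (rule hausdorff_coverI[OF U(1) less_imp_le[OF q0] * order_trans[OF U(4) rq]])
  then show ?thesis by (rule that[OF _ q0])
qed

lemma hausdorff_null_UN:
  assumes "\<And>i::nat. hausdorff_null d s (B i)"
  shows "hausdorff_null d s (\<Union>i. B i)"
proof (rule hausdorff_nullI)
  fix e :: real assume e: "0 < e"
  \<comment> \<open>These weights add up to \<open>e/2\<close>, which leaves room for the strict
    inequality.\<close>
  define w where "w i = e/2 * (1/2) ^ Suc i" for i
  have w: "0 < w i" for i using e by (simp add: w_def)
  have "\<forall>i. \<exists>W. hausdorff_cover d s (w i) (B i) (fst W) (snd W)"
    using assms w unfolding hausdorff_null_def by (metis fst_conv snd_conv)
  then obtain W where W: "\<And>i. hausdorff_cover d s (w i) (B i) (fst (W i)) (snd (W i))" by metis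
  define V q where "V i = fst (W i)" and "q i = snd (W i)" for i
  note V = hausdorff_coverD[OF W, folded V_def q_def]
  show "\<exists>U r. hausdorff_cover d s e (\<Union>i. B i) U r"
  proof (rule hausdorff_cover_prod[where U = "\<lambda>i j. V i j \<inter> B i" and r = q])
    show "(\<Union>i. B i) \<subseteq> (\<Union>i j. V i j \<inter> B i)"
    proof
      fix x assume "x \<in> (\<Union>i. B i)"
      then obtain i where i: "x \<in> B i" by blast
      then obtain j where "x \<in> V i j" using V(1)[of i] by blast
      with i show "x \<in> (\<Union>i j. V i j \<inter> B i)" by blast
    qed
    have "(\<Sum>i. \<Sum>j. ennreal (q i j powr s)) \<le> (\<Sum>i. ennreal (w i))"
      by (intro suminf_le summableI less_imp_le V(3))
    also have "\<dots> = ennreal (e/2)"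
      unfolding w_def using e by (intro suminf_ennreal_halves) simp
    also have "\<dots> < ennreal e" using e by (simp add: ennreal_less_iff)
    finally show "(\<Sum>i. \<Sum>j. ennreal (q i j powr s)) < ennreal e" .
    show "d x y \<le> q i j" if "x \<in> V i j \<inter> B i" "y \<in> V i j \<inter> B i" for i j x y
      using that by (intro V(4)) auto
  qed (rule V(2))
qed

lemma hausdorff_null_subset:
  assumes "hausdorff_null d s A" "B \<subseteq> A"
  shows "hausdorff_null d s B"
  using assms hausdorff_cover_mono[OF _ order_refl assms(2)] unfolding hausdorff_null_def by meson

text \<open>Covers pull back along \<open>f\<close>. Bounding \<open>d'\<close> by \<open>d\<close>
  after \<open>f\<close> does the work of injectivity together with a Lipschitz inverse; the lower
  bounds of dimensions use this form.\<close>

lemma hausdorff_null_expanding: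
  assumes "hausdorff_null d s A" "f ` B \<subseteq> A" "0 \<le> C" "0 \<le> s"
    and "\<And>x y. x \<in> B \<Longrightarrow> y \<in> B \<Longrightarrow> d' x y \<le> C * d (f x) (f y)"
  shows "hausdorff_null d' s B"
proof (rule hausdorff_nullI)
  fix e :: real assume "0 < e"
  \<comment> \<open>The summand 1 keeps the division by \<open>K\<close> meaningful when
    \<open>C = 0\<close>.\<close>
  define K where "K = C powr s + 1"
  have K: "1 \<le> K" by (simp add: K_def)
  have pos: "0 < e/K" using \<open>0 < e\<close> K by simp
  obtain U r where c: "hausdorff_cover d s (e/K) A U r"
    by (rule hausdorff_nullE[OF assms(1) pos])
  note U = hausdorff_coverD[OF c]
  have "ennreal ((C * r i) powr s) \<le> ennreal K * ennreal (r i powr s)" for i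
  proof -
    have "(C * r i) powr s \<le> K * r i powr s"
      using U(2)[of i] assms(3) by (auto simp: powr_mult K_def intro!: mult_right_mono)
    then show ?thesis using K by (simp add: ennreal_mult[symmetric] ennreal_leI)
  qed
  then have "(\<Sum>i. ennreal ((C * r i) powr s)) \<le> (\<Sum>i. ennreal K * ennreal (r i powr s))"
    by (intro suminf_le summableI)
  also have "\<dots> = ennreal K * (\<Sum>i. ennreal (r i powr s))" by (rule ennreal_suminf_cmult)
  also have "\<dots> < ennreal K * ennreal (e/K)"
    using U(3) K by (intro ennreal_mult_strict_left_mono) (auto simp: ennreal_zero_less_divide)
  also have "\<dots> = ennreal e" using K \<open>0 < e\<close> by (simp add: ennreal_mult[symmetric])
  finally have *: "(\<Sum>i. ennreal ((C * r i) powr s)) < ennreal e" .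
  have "hausdorff_cover d' s e B (\<lambda>i. f -` U i) (\<lambda>i. C * r i)"
  proof (rule hausdorff_coverI[OF _ _ *])
    show "B \<subseteq> (\<Union>i. f -` U i)" using U(1) assms(2) by blast
    show "0 \<le> C * r i" for i using U(2) assms(3) by simp
    fix i x y assume xy: "x \<in> f -` U i" "x \<in> B" "y \<in> f -` U i" "y \<in> B"
    then have "d (f x) (f y) \<le> r i" using assms(2) by (intro U(4)) auto
    then show "d' x y \<le> C * r i" using assms(5)[OF xy(2,4)] mult_left_mono[OF _ assms(3)] by fastforce
  qed
  then show "\<exists>U r. hausdorff_cover d' s e B U r" by blast
qed

text \<open>A choice of preimages is a map in the opposite direction that is expanding in the sense
  of \<open>hausdorff_null_expanding\<close>.\<close>

lemma hausdorff_null_lipschitz_image: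
  assumes "hausdorff_null d s A" "0 \<le> C" "0 \<le> s"
    and "\<And>x y. x \<in> A \<Longrightarrow> y \<in> A \<Longrightarrow> d' (f x) (f y) \<le> C * d x y"
  shows "hausdorff_null d' s (f ` A)"
proof (rule hausdorff_null_expanding[OF assms(1) _ assms(2,3), of "inv_into A f"])
  show "inv_into A f ` f ` A \<subseteq> A" by (auto intro: inv_into_into)
  show "d' x y \<le> C * d (inv_into A f x) (inv_into A f y)" if "x \<in> f ` A" "y \<in> f ` A" for x y
    using assms(4)[OF inv_into_into[OF that(1)] inv_into_into[OF that(2)]] that
    by (simp add: f_inv_into_f)
qed

lemma hausdorff_null_countable_UN:
  assumes "countable I" "\<And>i. i \<in> I \<Longrightarrow> hausdorff_null d s (B i)"
  shows "hausdorff_null d s (\<Union>i\<in>I. B i)"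
proof (cases "I = {}")
  case False
  have "hausdorff_null d s (\<Union>i. B (from_nat_into I i))"
    by (intro hausdorff_null_UN assms(2) from_nat_into False)
  then show ?thesis using range_from_nat_into[OF False assms(1)]
    by (metis image_image)
qed (simp add: hausdorff_null_def hausdorff_cover_def exI[of _ "\<lambda>_. 0"])

text \<open>By Lindelof, countably many of the good neighbourhoods cover \<open>A\<close>. Hence all
  metric comparisons may have constants depending on the point.\<close>

lemma hausdorff_null_local_image:
  fixes A :: "'a::second_countable_topology set"
  assumes "\<And>x. x \<in> A \<Longrightarrow> \<exists>U. open U \<and> x \<in> U \<and> hausdorff_null d s (f ` (A \<inter> U))"
  shows "hausdorff_null d s (f ` A)"
proof -
  define F where "F = {U. open U \<and> hausdorff_null d s (f ` (A \<inter> U))}"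
  obtain F' where F': "F' \<subseteq> F" "countable F'" "\<Union>F' = \<Union>F"
    by (rule Lindelof[of F]) (auto simp: F_def)
  have "hausdorff_null d s (\<Union>U\<in>F'. f ` (A \<inter> U))"
    using F' by (intro hausdorff_null_countable_UN) (auto simp: F_def)
  moreover have "f ` A \<subseteq> (\<Union>U\<in>F'. f ` (A \<inter> U))"
  proof
    fix y assume "y \<in> f ` A"
    then obtain x where x: "x \<in> A" "y = f x" by blast
    then have "x \<in> \<Union>F" using assms[of x] by (auto simp: F_def)
    then show "y \<in> (\<Union>U\<in>F'. f ` (A \<inter> U))" using F'(3) x by blast
  qed
  ultimately show ?thesis by (rule hausdorff_null_subset)
qed

lemma hausdorff_null_locally_lipschitz_image:
  fixes A :: "'a::{second_countable_topology,metric_space} set"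
  assumes "hausdorff_null dist s A" "0 \<le> s"
    and "\<And>z. z \<in> A \<Longrightarrow> \<exists>U C. open U \<and> z \<in> U \<and> 0 \<le> C \<and>
          (\<forall>x\<in>A \<inter> U. \<forall>y\<in>A \<inter> U. d' (f x) (f y) \<le> C * dist x y)"
  shows "hausdorff_null d' s (f ` A)"
proof (rule hausdorff_null_local_image)
  fix z assume "z \<in> A"
  from assms(3)[OF this] obtain U C where U: "open U" "z \<in> U" "0 \<le> C"
    "\<And>x y. x \<in> A \<inter> U \<Longrightarrow> y \<in> A \<inter> U \<Longrightarrow> d' (f x) (f y) \<le> C * dist x y" by blast
  have "hausdorff_null d' s (f ` (A \<inter> U))"
    by (rule hausdorff_null_lipschitz_image[OF hausdorff_null_subset[OF assms(1)] U(3) assms(2)])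
      (use U(4) in auto)
  then show "\<exists>U. open U \<and> z \<in> U \<and> hausdorff_null d' s (f ` (A \<inter> U))" using U by blast
qed

text \<open>Once the content is below 1, all radii are below 1, and powers of such numbers decrease
  with the exponent.\<close>

lemma hausdorff_null_mono_exponent:
  assumes "hausdorff_null d s A" "0 < s" "s \<le> s'"
  shows "hausdorff_null d s' A"
proof (rule hausdorff_nullI)
  fix e :: real assume "0 < e"
  have pos: "0 < min e (1 powr s)" using \<open>0 < e\<close> by simp
  obtain U r where c: "hausdorff_cover d s (min e (1 powr s)) A U r"
    by (rule hausdorff_nullE[OF assms(1) pos])
  note U = hausdorff_coverD[OF c]
  have "r i < 1" for i
    by (rule hausdorff_cover_radius_less[OF hausdorff_cover_mono[OF c]]) (use assms in auto)
  then have "r i powr s' \<le> r i powr s" for i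
    using U(2)[of i] assms(3) by (intro powr_mono') (auto simp: less_imp_le)
  then have "(\<Sum>i. ennreal (r i powr s')) \<le> (\<Sum>i. ennreal (r i powr s))"
    by (intro suminf_le summableI ennreal_leI)
  also have "\<dots> < ennreal e"
    by (rule hausdorff_coverD(3)[OF hausdorff_cover_mono[OF c]]) auto
  finally have "hausdorff_cover d s' e A U r" using U by (intro hausdorff_coverI) auto
  then show "\<exists>U r. hausdorff_cover d s' e A U r" by blast
qed

section \<open>Products with an interval\<close>

lemma dist_prod_le: "dist (x, y) (x', y') \<le> dist x x' + dist y y'"
  unfolding dist_Pair_Pair by (rule sqrt_sum_squares_le_sum) auto

lemma dist_le_dist_prod: "dist x x' \<le> dist (x, y) (x', y')" "dist y y' \<le> dist (x, y) (x', y')"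
  unfolding dist_Pair_Pair by (auto simp: real_le_rsqrt)

text \<open>Over a piece of radius \<open>r\<close> the interval is cut into about
  \<open>L / r\<close> parts of length \<open>r\<close>. This costs one power of \<open>r\<close>,
  which the larger exponent pays for.\<close>

lemma hausdorff_null_Times_Icc:
  fixes A :: "'a::metric_space set" and a b :: real
  assumes "hausdorff_null dist s A" "0 < s"
  shows "hausdorff_null dist (s + 1) (A \<times> {a..b})"
proof (cases "a \<le> b")
  case False
  then show ?thesis by (simp add: hausdorff_null_def hausdorff_cover_def exI[of _ "\<lambda>_. 0"])
next
  case True
  define L where "L = b - a"
  \<comment> \<open>From \<open>(L / r + 1) * (2 * r) powr (s + 1) = 2 powr (s + 1) * (L + r) * r
    powr s\<close> with \<open>r \<le> 1\<close>.\<close>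
  define M where "M = 2 powr (s + 1) * (L + 1)"
  have L: "0 \<le> L" using True by (simp add: L_def)
  have M: "0 < M" using L by (simp add: M_def)
  show ?thesis
  proof (rule hausdorff_nullI)
    fix e :: real assume e: "0 < e"
    have e0: "0 < min (1 powr s) (e / M)" using e M by simp
    obtain U r where c: "hausdorff_cover dist s (min (1 powr s) (e / M)) A U r" and r0: "\<And>i. 0 < r i"
      by (rule hausdorff_nullE_pos[OF assms(1) e0 assms(2)]) (rule that)
    note U = hausdorff_coverD[OF c]
    have "r i < 1" for i
      by (rule hausdorff_cover_radius_less[OF hausdorff_cover_mono[OF c]]) (use assms in auto)
    then have r1: "r i \<le> 1" for i by (rule less_imp_le)
    define N where "N i = nat \<lfloor>L / r i\<rfloor> + 1" for i
    define V where "V i j = (if j < N i then U i \<times> {a + real j * r i..a + (real j + 1) * r i} else {})" for i j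
    define q where "q i j = (if j < N i then 2 * r i else 0)" for i j
    have N: "real (N i) \<le> L / r i + 1" for i
      using L r0[of i] by (simp add: N_def)
    have cover: "A \<times> {a..b} \<subseteq> (\<Union>i j. V i j)"
    proof (clarify)
      fix x y assume x: "x \<in> A" and y: "y \<in> {a..b}"
      obtain i where i: "x \<in> U i" using U(1) x by blast
      define k where "k = \<lfloor>(y - a) / r i\<rfloor>"
      have k: "real_of_int k \<le> (y - a) / r i" "(y - a) / r i < real_of_int k + 1" "0 \<le> k"
        using y r0[of i] by (auto simp: k_def)
      have "(y - a) / r i \<le> L / r i"
        using y r0[of i] by (intro divide_right_mono) (auto simp: L_def)
      then have "k \<le> \<lfloor>L / r i\<rfloor>" unfolding k_def by (rule floor_mono)
      then have "nat k < N i" using k(3) by (simp add: N_def)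
      moreover have "y \<in> {a + real (nat k) * r i..a + (real (nat k) + 1) * r i}"
        using k r0[of i] by (simp add: field_simps)
      ultimately have "(x, y) \<in> V i (nat k)" using i by (simp add: V_def)
      then show "(x, y) \<in> (\<Union>i j. V i j)" by (intro UN_I[OF UNIV_I])
    qed
    have diam: "dist p p' \<le> q i j"
      if "p \<in> V i j" "p \<in> A \<times> {a..b}" "p' \<in> V i j" "p' \<in> A \<times> {a..b}" for i j p p'
    proof -
      obtain x y x' y' where p: "p = (x, y)" "p' = (x', y')" by fastforce
      have j: "j < N i" using that(1) by (simp add: V_def split: if_splits)
      have "dist x x' \<le> r i" using that p j by (intro U(4)) (auto simp: V_def)
      moreover have "dist y y' \<le> r i"
        using that p j by (auto simp: V_def dist_real_def abs_le_iff algebra_simps)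
      ultimately show ?thesis using dist_prod_le[of x y x' y'] p j by (simp add: q_def)
    qed
    have "(\<Sum>j. ennreal (q i j powr (s + 1))) \<le> ennreal M * ennreal (r i powr s)" for i
    proof -
      have "(\<Sum>j. ennreal (q i j powr (s + 1))) = (\<Sum>j<N i. ennreal (q i j powr (s + 1)))"
        by (rule suminf_finite) (auto simp: q_def)
      also have "\<dots> = (\<Sum>j<N i. ennreal ((2 * r i) powr (s + 1)))"
        by (rule sum.cong) (auto simp: q_def)
      also have "\<dots> = ennreal (real (N i) * (2 * r i) powr (s + 1))"
        by (simp add: ennreal_mult ennreal_of_nat_eq_real_of_nat)
      also have "\<dots> \<le> ennreal (M * r i powr s)"
      proof (rule ennreal_leI)
        have "real (N i) * (2 * r i) powr (s + 1) \<le> (L / r i + 1) * (2 * r i) powr (s + 1)"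
          by (intro mult_right_mono N) simp
        also have "\<dots> = 2 powr (s + 1) * (L + r i) * r i powr s"
          using r0[of i] by (simp add: powr_mult powr_add field_simps)
        also have "\<dots> \<le> M * r i powr s"
          unfolding M_def using r1[of i] by (intro mult_right_mono mult_left_mono) auto
        finally show "real (N i) * (2 * r i) powr (s + 1) \<le> M * r i powr s" .
      qed
      finally show ?thesis using M by (simp add: ennreal_mult)
    qed
    then have "(\<Sum>i. \<Sum>j. ennreal (q i j powr (s + 1))) \<le> (\<Sum>i. ennreal M * ennreal (r i powr s))"
      by (intro suminf_le summableI)
    also have "\<dots> = ennreal M * (\<Sum>i. ennreal (r i powr s))" by (rule ennreal_suminf_cmult)
    also have "\<dots> < ennreal M * ennreal (e / M)"
      by (intro ennreal_mult_strict_left_mono hausdorff_coverD(3)[OF hausdorff_cover_mono[OF c]])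
        (use M in auto)
    also have "\<dots> = ennreal e" using M e by (simp add: ennreal_mult[symmetric])
    finally have sum: "(\<Sum>i. \<Sum>j. ennreal (q i j powr (s + 1))) < ennreal e" .
    have q0: "0 \<le> q i j" for i j using r0[of i] by (simp add: q_def)
    show "\<exists>U r. hausdorff_cover dist (s + 1) e (A \<times> {a..b}) U r"
      by (rule hausdorff_cover_prod[OF cover q0 sum diam])
  qed
qed

lemma hausdorff_null_Times_UNIV:
  fixes A :: "'a::metric_space set"
  assumes "hausdorff_null dist s A" "0 < s"
  shows "hausdorff_null dist (s + 1) (A \<times> (UNIV :: real set))"
proof -
  have "hausdorff_null dist (s + 1) (\<Union>n::nat. A \<times> {- real n..real n})"
    by (intro hausdorff_null_UN hausdorff_null_Times_Icc assms)
  moreover have "A \<times> (UNIV :: real set) \<subseteq> (\<Union>n::nat. A \<times> {- real n..real n})"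
  proof clarify
    fix x and y :: real assume "x \<in> A"
    obtain n :: nat where "\<bar>y\<bar> \<le> real n" using real_arch_simple by blast
    then have "(x, y) \<in> A \<times> {- real n..real n}" using \<open>x \<in> A\<close> by auto
    then show "(x, y) \<in> (\<Union>n::nat. A \<times> {- real n..real n})" by (rule UN_I[OF UNIV_I])
  qed
  ultimately show ?thesis by (rule hausdorff_null_subset)
qed

text \<open>Averaging a cover of \<open>A \<times> {a..b}\<close> over the second coordinate yields an economical slice.\<close>

lemma hausdorff_null_slice:
  fixes A :: "'a::metric_space set"
  assumes n: "hausdorff_null dist s (A \<times> {a..b::real})" and s: "1 \<le> s" and ab: "a < b" and e: "0 < e"
  obtains V r J where "A \<subseteq> (\<Union>i\<in>J. V i)" "\<And>i::nat. 0 < r i"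
    "(\<Sum>i. ennreal (r i powr (s - 1)) * indicator J i) < ennreal e"
    "\<And>i x y. x \<in> V i \<Longrightarrow> x \<in> A \<Longrightarrow> y \<in> V i \<Longrightarrow> y \<in> A \<Longrightarrow> dist x y \<le> r i"
proof -
  \<comment> \<open>Division by 2 offsets the length \<open>2 * r i\<close> of the shadow of a piece
    on the second axis; \<open>b - a\<close> turns an integral bound into a bound at one
    height.\<close>
  have e0: "0 < e * (b - a) / 2" and s0: "0 < s" using e ab s by auto
  obtain U r where co: "hausdorff_cover dist s (e * (b - a) / 2) (A \<times> {a..b}) U r" and r0: "\<And>i. 0 < r i"
    by (rule hausdorff_nullE_pos[OF n e0 s0]) (rule that)
  note U = hausdorff_coverD[OF co]
  \<comment> \<open>The second coordinate of any point of the piece: the interval \<open>K i\<close>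
    of radius \<open>r i\<close> around it contains all heights that the piece reaches.\<close>
  define c where "c i = snd (SOME p. p \<in> U i \<inter> (A \<times> {a..b}))" for i
  define K where "K i = {c i - r i..c i + r i}" for i
  have K: "y \<in> K i" if "(x, y) \<in> U i" "x \<in> A" "y \<in> {a..b}" for x y i
  proof -
    define p where "p = (SOME p. p \<in> U i \<inter> (A \<times> {a..b}))"
    have p: "p \<in> U i \<inter> (A \<times> {a..b})"
      unfolding p_def by (rule someI[of _ "(x, y)"]) (use that in simp)
    have "dist y (snd p) \<le> dist (x, y) (fst p, snd p)" by (rule dist_le_dist_prod)
    also have "\<dots> \<le> r i" by (rule U(4)) (use p that in auto)
    finally show ?thesis by (auto simp: K_def c_def p_def dist_real_def abs_le_iff)
  qed
  \<comment> \<open>An upper bound for the cost, at exponent \<open>s - 1\<close>, of the cover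
    induced on the slice at height \<open>y\<close>. Its integral is below
    \<open>e * (b - a)\<close>, so some height in the interval costs less than
    \<open>e\<close>.\<close>
  define G where "G y = (\<Sum>i. ennreal (r i powr (s - 1)) * indicator (K i) y)" for y
  have "(\<integral>\<^sup>+ y. G y \<partial>lborel) = (\<Sum>i. \<integral>\<^sup>+ y. ennreal (r i powr (s - 1)) * indicator (K i) y \<partial>lborel)"
    unfolding G_def by (rule nn_integral_suminf) (simp add: K_def)
  also have "\<dots> = (\<Sum>i. ennreal 2 * ennreal (r i powr s))"
  proof (intro arg_cong[where f=suminf] ext)
    fix i
    have "(\<integral>\<^sup>+ y. ennreal (r i powr (s - 1)) * indicator (K i) y \<partial>lborel)
        = ennreal (r i powr (s - 1)) * emeasure lborel (K i)"
      by (rule nn_integral_cmult_indicator) (simp add: K_def)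
    also have "\<dots> = ennreal (r i powr (s - 1) * (2 * r i))"
      using r0[of i] by (simp add: K_def ennreal_mult)
    also have "r i powr (s - 1) * (2 * r i) = 2 * r i powr s"
      using r0[of i] by (simp add: powr_diff)
    finally show "(\<integral>\<^sup>+ y. ennreal (r i powr (s - 1)) * indicator (K i) y \<partial>lborel)
        = ennreal 2 * ennreal (r i powr s)" by (simp add: ennreal_mult)
  qed
  also have "\<dots> = ennreal 2 * (\<Sum>i. ennreal (r i powr s))" by (rule ennreal_suminf_cmult)
  also have "\<dots> < ennreal 2 * ennreal (e * (b - a) / 2)"
    using U(3) by (intro ennreal_mult_strict_left_mono) auto
  also have "\<dots> = ennreal (e * (b - a))" using e ab by (simp add: ennreal_mult[symmetric] del: ennreal_numeral)
  finally have int: "(\<integral>\<^sup>+ y. G y \<partial>lborel) < ennreal (e * (b - a))" .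
  have "\<exists>y\<in>{a..b}. G y < ennreal e"
  proof (rule ccontr)
    assume "\<not> ?thesis"
    then have "ennreal e * indicator {a..b} y \<le> G y" for y
      by (cases "y \<in> {a..b}") (auto simp: not_less)
    then have "(\<integral>\<^sup>+ y. ennreal e * indicator {a..b} y \<partial>lborel) \<le> (\<integral>\<^sup>+ y. G y \<partial>lborel)"
      by (rule nn_integral_mono)
    moreover have "(\<integral>\<^sup>+ y. ennreal e * indicator {a..b} y \<partial>lborel) = ennreal e * emeasure lborel {a..b}"
      by (rule nn_integral_cmult_indicator) simp
    moreover have "\<dots> = ennreal (e * (b - a))" using e ab by (simp add: ennreal_mult)
    ultimately show False using int by (metis not_le)
  qed
  then obtain y where y: "y \<in> {a..b}" "G y < ennreal e" by blast
  show ?thesis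
  proof (rule that[of "\<lambda>i. {x \<in> A. (x, y) \<in> U i}" "{i. y \<in> K i}" r])
    show "A \<subseteq> (\<Union>i\<in>{i. y \<in> K i}. {x \<in> A. (x, y) \<in> U i})"
    proof
      fix x assume x: "x \<in> A"
      then obtain i where "(x, y) \<in> U i" using U(1) y(1) by blast
      then show "x \<in> (\<Union>i\<in>{i. y \<in> K i}. {x \<in> A. (x, y) \<in> U i})"
        using K[of x y i] x y(1) by blast
    qed
    show "0 < r i" for i by (rule r0)
    show "dist x x' \<le> r i" if "x \<in> {x \<in> A. (x, y) \<in> U i}" "x' \<in> {x \<in> A. (x, y) \<in> U i}" for i x x'
      using dist_le_dist_prod(1)[of x x' y y] U(4)[of "(x, y)" i "(x', y)"] that y(1) by simp
    have "(\<Sum>i. ennreal (r i powr (s - 1)) * indicator {i. y \<in> K i} i) = G y"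
      unfolding G_def by (intro arg_cong[where f=suminf] ext) (simp add: indicator_def)
    with y(2) show "(\<Sum>i. ennreal (r i powr (s - 1)) * indicator {i. y \<in> K i} i) < ennreal e"
      by simp
  qed
qed

text \<open>A cheap slice of a cover of the product is a cheap cover of \<open>A\<close>. At
  exponent 1 its cost counts pieces, and a nonempty \<open>A\<close> cannot be covered by fewer than
  one; this excludes \<open>s \<le> 1\<close>.\<close>

lemma hausdorff_null_Times_Icc_D:
  fixes A :: "'a::metric_space set"
  assumes n: "hausdorff_null dist s (A \<times> {a..b::real})" and s: "0 < s" and ab: "a < b" and A: "A \<noteq> {}"
  shows "1 < s" "hausdorff_null dist (s - 1) A"
proof -
  have "\<not> s \<le> 1"
  proof
    assume "s \<le> 1"
    then have n1: "hausdorff_null dist 1 (A \<times> {a..b})"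
      by (rule hausdorff_null_mono_exponent[OF n s])
    obtain V r J where V: "A \<subseteq> (\<Union>i\<in>J. V i)" "\<And>i::nat. 0 < r i"
      "(\<Sum>i. ennreal (r i powr (1 - 1)) * indicator J i) < ennreal 1"
      by (rule hausdorff_null_slice[OF n1 order_refl ab zero_less_one]) (rule that)
    obtain i where i: "i \<in> J" using V(1) A by blast
    have "ennreal (r i powr (1 - 1)) * indicator J i \<le> (\<Sum>i. ennreal (r i powr (1 - 1)) * indicator J i)"
      by (rule term_le_suminf_ennreal)
    with V(3) have "ennreal (r i powr (1 - 1)) * indicator J i < ennreal 1"
      by (rule le_less_trans[rotated])
    then show False using i V(2)[of i] by simp
  qed
  then show s1: "1 < s" by simp
  show "hausdorff_null dist (s - 1) A"
  proof (rule hausdorff_nullI)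
    fix e :: real assume "0 < e"
    obtain V r J where V: "A \<subseteq> (\<Union>i\<in>J. V i)" "\<And>i::nat. 0 < r i"
      "(\<Sum>i. ennreal (r i powr (s - 1)) * indicator J i) < ennreal e"
      "\<And>i x y. x \<in> V i \<Longrightarrow> x \<in> A \<Longrightarrow> y \<in> V i \<Longrightarrow> y \<in> A \<Longrightarrow> dist x y \<le> r i"
      by (rule hausdorff_null_slice[OF n less_imp_le[OF s1] ab \<open>0 < e\<close>]) (rule that)
    have eq: "(\<Sum>i. ennreal ((if i \<in> J then r i else 0) powr (s - 1))) =
        (\<Sum>i. ennreal (r i powr (s - 1)) * indicator J i)"
      by (intro arg_cong[where f=suminf] ext) (simp add: indicator_def)
    have "hausdorff_cover dist (s - 1) e A (\<lambda>i. if i \<in> J then V i else {}) (\<lambda>i. if i \<in> J then r i else 0)"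
    proof (rule hausdorff_coverI)
      show "A \<subseteq> (\<Union>i. if i \<in> J then V i else {})" using V(1) by fastforce
      show "0 \<le> (if i \<in> J then r i else 0)" for i using V(2)[of i] by simp
      show "(\<Sum>i. ennreal ((if i \<in> J then r i else 0) powr (s - 1))) < ennreal e"
        unfolding eq by (rule V(3))
    qed (use V(4) in \<open>auto split: if_splits\<close>)
    then show "\<exists>U r. hausdorff_cover dist (s - 1) e A U r" by blast
  qed
qed

section \<open>The orthogonal group of the form\<close>

lemma norm_matrix_sq: "(norm (A :: real^'n^'m))\<^sup>2 = (\<Sum>i\<in>UNIV. \<Sum>j\<in>UNIV. (A$i$j)\<^sup>2)"
  by (simp add: norm_vec_def L2_set_def real_sqrt_pow2 sum_nonneg)

lemma norm_matrix_mult_le: "norm ((A :: real^'n^'m) ** (B :: real^'k^'n)) \<le> norm A * norm B"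
proof (rule power2_le_imp_le)
  have "(norm (A ** B))\<^sup>2 = (\<Sum>i\<in>UNIV. \<Sum>j\<in>UNIV. (\<Sum>k\<in>UNIV. A$i$k * B$k$j)\<^sup>2)"
    by (simp add: norm_matrix_sq matrix_matrix_mult_def)
  also have "\<dots> \<le> (\<Sum>i\<in>UNIV. \<Sum>j\<in>UNIV. (\<Sum>k\<in>UNIV. (A$i$k)\<^sup>2) * (\<Sum>k\<in>UNIV. (B$k$j)\<^sup>2))"
    by (intro sum_mono Cauchy_Schwarz_ineq_sum)
  also have "\<dots> = (\<Sum>i\<in>UNIV. \<Sum>k\<in>UNIV. (A$i$k)\<^sup>2) * (\<Sum>j\<in>UNIV. \<Sum>k\<in>UNIV. (B$k$j)\<^sup>2)"
    by (simp add: sum_product)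
  also have "(\<Sum>j\<in>UNIV. \<Sum>k\<in>UNIV. (B$k$j)\<^sup>2) = (\<Sum>k\<in>UNIV. \<Sum>j\<in>UNIV. (B$k$j)\<^sup>2)"
    by (rule sum.swap)
  finally show "(norm (A ** B))\<^sup>2 \<le> (norm A * norm B)\<^sup>2"
    by (simp add: norm_matrix_sq power_mult_distrib)
qed simp

lemma norm_transpose: "norm (transpose (A :: real^'n^'m)) = norm A"
proof -
  have "(norm (transpose A))\<^sup>2 = (norm A)\<^sup>2"
    unfolding norm_matrix_sq by (subst sum.swap) (simp add: transpose_def)
  then show ?thesis by simp
qed

lemma bounded_bilinear_matrix_mult: "bounded_bilinear ((**) :: real^'n^'m \<Rightarrow> real^'k^'n \<Rightarrow> real^'k^'m)"
proof
  show "\<exists>K. \<forall>A B. norm ((A :: real^'n^'m) ** (B :: real^'k^'n)) \<le> norm A * norm B * K"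
    by (rule exI[of _ 1]) (simp add: norm_matrix_mult_le)
qed (simp_all add: vec_eq_iff matrix_matrix_mult_def sum.distrib algebra_simps sum_distrib_left)

lemmas matrix_diff_left = bounded_bilinear.diff_left[OF bounded_bilinear_matrix_mult]
lemmas matrix_diff_right = bounded_bilinear.diff_right[OF bounded_bilinear_matrix_mult]
lemmas continuous_on_matrix_mult = bounded_bilinear.continuous_on[OF bounded_bilinear_matrix_mult]
lemmas tendsto_matrix_mult = bounded_bilinear.tendsto[OF bounded_bilinear_matrix_mult]

lemma bounded_linear_transpose: "bounded_linear (transpose :: real^'n^'m \<Rightarrow> real^'m^'n)"
proof
  show "\<exists>K. \<forall>A. norm (transpose (A :: real^'n^'m)) \<le> norm A * K"
    by (rule exI[of _ 1]) (simp add: norm_transpose)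
qed (simp_all add: vec_eq_iff transpose_def)

lemma abs_entry_le_norm: "\<bar>(A :: real^'n^'m)$i$j\<bar> \<le> norm A"
  by (meson component_le_norm_cart norm_bound_component_le_cart order_trans Finite_Cartesian_Product.norm_nth_le real_norm_def)

lemma norm_le_sum_entries: "norm (A :: real^3^3) \<le> (\<Sum>i\<in>UNIV. \<Sum>j\<in>UNIV. \<bar>A$i$j\<bar>)"
proof -
  have "norm A \<le> (\<Sum>i\<in>UNIV. norm (A$i))" by (simp add: norm_vec_def L2_set_le_sum)
  also have "\<dots> \<le> (\<Sum>i\<in>UNIV. \<Sum>j\<in>UNIV. \<bar>A$i$j\<bar>)"
    by (intro sum_mono) (simp add: norm_vec_def L2_set_le_sum flip: real_norm_def)
  finally show ?thesis .
qed

section \<open>Explicit matrices of size three\<close>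

definition mat3 :: "real \<Rightarrow> real \<Rightarrow> real \<Rightarrow> real \<Rightarrow> real \<Rightarrow> real \<Rightarrow> real \<Rightarrow> real \<Rightarrow> real \<Rightarrow> real^3^3" where
  "mat3 a b c d e f g h i = vector [vector [a, b, c], vector [d, e, f], vector [g, h, i]]"

lemma mat3_nth [simp]:
  "mat3 a b c d e f g h i $1$1 = a" "mat3 a b c d e f g h i $1$2 = b" "mat3 a b c d e f g h i $1$3 = c"
  "mat3 a b c d e f g h i $2$1 = d" "mat3 a b c d e f g h i $2$2 = e" "mat3 a b c d e f g h i $2$3 = f"
  "mat3 a b c d e f g h i $3$1 = g" "mat3 a b c d e f g h i $3$2 = h" "mat3 a b c d e f g h i $3$3 = i"
  by (simp_all add: mat3_def)

lemma matrix3_eq_iff: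
  "(A :: real^3^3) = B \<longleftrightarrow> A$1$1 = B$1$1 \<and> A$1$2 = B$1$2 \<and> A$1$3 = B$1$3 \<and>
     A$2$1 = B$2$1 \<and> A$2$2 = B$2$2 \<and> A$2$3 = B$2$3 \<and> A$3$1 = B$3$1 \<and> A$3$2 = B$3$2 \<and> A$3$3 = B$3$3"
  by (auto simp: vec_eq_iff forall_3)

lemma matrix3_mult_nth: "((A :: real^3^3) ** (B :: real^3^3))$i$j = A$i$1 * B$1$j + A$i$2 * B$2$j + A$i$3 * B$3$j"
  by (simp add: matrix_matrix_mult_def sum_3)

lemma mat3_one_nth: "(mat 1 :: real^3^3)$1$1 = 1" "(mat 1 :: real^3^3)$1$2 = 0" "(mat 1 :: real^3^3)$1$3 = 0"
  "(mat 1 :: real^3^3)$2$1 = 0" "(mat 1 :: real^3^3)$2$2 = 1" "(mat 1 :: real^3^3)$2$3 = 0"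
  "(mat 1 :: real^3^3)$3$1 = 0" "(mat 1 :: real^3^3)$3$2 = 0" "(mat 1 :: real^3^3)$3$3 = 1"
  by (simp_all add: mat_def)

lemma transpose_nth: "transpose A $ i $ j = A $ j $ i"
  by (simp add: transpose_def)

lemma diag3_eq: "diag3 a b c = mat3 a 0 0 0 b 0 0 0 c"
  by (simp add: diag3_def mat3_def)

lemmas matrix3_simps = matrix3_eq_iff matrix3_mult_nth mat3_one_nth transpose_nth diag3_eq

lemma continuous_on_mat3 [continuous_intros]:
  assumes "continuous_on S a" "continuous_on S b" "continuous_on S c" "continuous_on S d" "continuous_on S e"
    "continuous_on S f" "continuous_on S g" "continuous_on S h" "continuous_on S i"
  shows "continuous_on S (\<lambda>x. mat3 (a x) (b x) (c x) (d x) (e x) (f x) (g x) (h x) (i x))"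
proof -
  have "continuous_on S (\<lambda>x. mat3 (a x) (b x) (c x) (d x) (e x) (f x) (g x) (h x) (i x) $ k $ l)" for k l
    using assms exhaust_3[of k] exhaust_3[of l] by auto
  then have "continuous_on S (\<lambda>x. \<chi> k l. mat3 (a x) (b x) (c x) (d x) (e x) (f x) (g x) (h x) (i x) $ k $ l)"
    by (intro continuous_on_vec_lambda)
  then show ?thesis by (simp only: vec_lambda_eta)
qed

text \<open>\<open>J3\<close> is the Gram matrix of \<open>quad_form\<close>. The other three are
  one-parameter subgroups preserving it: \<open>up3\<close> and \<open>lo3\<close> are the
  exponentials of \<open>r *\<^sub>R Nup\<close> and \<open>c *\<^sub>R Nlo\<close> (introduced
  below), which explains the entries \<open>r\<^sup>2/2\<close>.\<close>

definition J3 :: "real^3^3" where "J3 = mat3 0 0 1 0 (-1) 0 1 0 0"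
definition up3 :: "real \<Rightarrow> real^3^3" where "up3 r = mat3 1 r (r\<^sup>2/2) 0 1 r 0 0 1"
definition lo3 :: "real \<Rightarrow> real^3^3" where "lo3 c = mat3 1 0 0 c 1 0 (c\<^sup>2/2) c 1"
definition al3 :: "real \<Rightarrow> real^3^3" where "al3 s = diag3 (exp s) 1 (exp (- s))"

definition SOJ :: "(real^3^3) set" where
  "SOJ = {g. det g = 1 \<and> transpose g ** J3 ** g = J3}"

lemma J3_sq: "J3 ** J3 = mat 1"
  by (simp add: matrix3_simps J3_def)

lemma transpose_J3: "transpose J3 = J3"
  by (simp add: matrix3_simps J3_def)

text \<open>Both sides of \<open>g\<^sup>T J g = J\<close> are symmetric, so its six upper entries
  suffice; they are the products of the columns of \<open>g\<close> under the form.\<close>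

lemma SOJ_iff:
  "g \<in> SOJ \<longleftrightarrow> det g = 1 \<and> 2 * g$1$1 * g$3$1 = (g$2$1)\<^sup>2 \<and> 2 * g$1$2 * g$3$2 = (g$2$2)\<^sup>2 - 1 \<and>
    2 * g$1$3 * g$3$3 = (g$2$3)\<^sup>2 \<and> g$1$1 * g$3$2 + g$3$1 * g$1$2 = g$2$1 * g$2$2 \<and>
    g$1$1 * g$3$3 + g$3$1 * g$1$3 = g$2$1 * g$2$3 + 1 \<and> g$1$2 * g$3$3 + g$3$2 * g$1$3 = g$2$2 * g$2$3"
  unfolding SOJ_def mem_Collect_eq matrix3_simps J3_def mat3_nth power2_eq_square
  by (auto simp: algebra_simps)

text \<open>Polarisation: the values of the form on \<open>e\<^sub>i\<close> and
  \<open>e\<^sub>i + e\<^sub>j\<close> determine all entries of the Gram matrix.\<close>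

lemma quad_form_SOJ: "{g \<in> carrier SL3. quad_form \<circ> (\<lambda>v. g *v v) = quad_form} = SOJ"
proof -
  have "quad_form \<circ> (\<lambda>v. g *v v) = quad_form \<longleftrightarrow> g \<in> SOJ" if "det g = 1" for g :: "real^3^3"
  proof
    assume "quad_form \<circ> (\<lambda>v. g *v v) = quad_form"
    then have *: "quad_form (g *v vector [x, y, z]) = quad_form (vector [x, y, z])" for x y z
      by (metis comp_apply)
    note ** = *[unfolded quad_form_def matrix_vector_mult_def, simplified sum_3 vec_lambda_beta vector_3]
    have e: "2 * g$1$1 * g$3$1 = (g$2$1)\<^sup>2" "2 * g$1$2 * g$3$2 = (g$2$2)\<^sup>2 - 1" "2 * g$1$3 * g$3$3 = (g$2$3)\<^sup>2"
      using **[of 1 0 0] **[of 0 1 0] **[of 0 0 1] by simp_all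
    have f: "g$1$1 * g$3$2 + g$3$1 * g$1$2 = g$2$1 * g$2$2"
      using **[of 1 1 0] e by (simp add: power2_eq_square algebra_simps)
    have h: "g$1$1 * g$3$3 + g$3$1 * g$1$3 = g$2$1 * g$2$3 + 1"
      using **[of 1 0 1] e by (simp add: power2_eq_square algebra_simps)
    have k: "g$1$2 * g$3$3 + g$3$2 * g$1$3 = g$2$2 * g$2$3"
      using **[of 0 1 1] e by (simp add: power2_eq_square algebra_simps)
    show "g \<in> SOJ" using e f h k that by (simp add: SOJ_iff)
  next
    assume g: "g \<in> SOJ"
    have "quad_form (g *v v) = quad_form v" for v
      using g unfolding SOJ_iff quad_form_def matrix_vector_mult_def sum_3 vec_lambda_beta by algebra
    then show "quad_form \<circ> (\<lambda>v. g *v v) = quad_form" by (simp add: fun_eq_iff)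
  qed
  then show ?thesis by (auto simp: SL3_def SOJ_def)
qed

section \<open>Group structure of \<open>SOJ\<close> and of its identity component\<close>

lemma SOF_eq: "SOF = connected_component_set SOJ (mat 1)"
  unfolding SOF_def quad_form_SOJ ..

lemma one_SOJ: "mat 1 \<in> SOJ"
  by (simp add: SOJ_def)

lemma SOJ_mult:
  assumes "g \<in> SOJ" "h \<in> SOJ" shows "g ** h \<in> SOJ"
proof -
  have "transpose (g ** h) ** J3 ** (g ** h) = transpose h ** (transpose g ** J3 ** g) ** h"
    by (simp add: matrix_transpose_mul matrix_mul_assoc)
  then show ?thesis using assms by (simp add: SOJ_def det_mul)
qed

text \<open>The inverse on \<open>SOJ\<close>, since \<open>J\<^sup>2 = 1\<close>. Unlike
  \<open>matrix_inv\<close> it is visibly continuous, and it preserves the Frobenius norm.\<close>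

definition hinv :: "real^3^3 \<Rightarrow> real^3^3" where "hinv g = J3 ** transpose g ** J3"

lemma hinv_left: assumes "g \<in> SOJ" shows "hinv g ** g = mat 1"
proof -
  have "hinv g ** g = J3 ** (transpose g ** J3 ** g)" by (simp add: hinv_def matrix_mul_assoc)
  then show ?thesis using assms by (simp add: SOJ_def J3_sq)
qed

lemma hinv_right: assumes "g \<in> SOJ" shows "g ** hinv g = mat 1"
  using hinv_left[OF assms] matrix_left_right_inverse by blast

lemma SOJ_transpose_form: assumes "g \<in> SOJ" shows "g ** J3 ** transpose g = J3"
proof -
  have "g ** J3 ** transpose g = (g ** hinv g) ** J3"
    by (simp add: hinv_def matrix_mul_assoc) (metis J3_sq matrix_mul_assoc matrix_mul_rid)
  then show ?thesis using hinv_right[OF assms] by simp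
qed

lemma hinv_SOJ: assumes "g \<in> SOJ" shows "hinv g \<in> SOJ"
proof -
  have "det (hinv g) * det g = det (mat 1 :: real^3^3)"
    unfolding det_mul[symmetric] hinv_left[OF assms] ..
  then have "det (hinv g) = 1" using assms by (simp add: SOJ_def)
  moreover have "transpose (hinv g) ** J3 ** hinv g = J3"
  proof -
    have "transpose (hinv g) ** J3 ** hinv g = J3 ** (g ** ((J3 ** J3) ** (J3 ** transpose g))) ** J3"
      by (simp add: hinv_def matrix_transpose_mul transpose_J3 matrix_mul_assoc)
    also have "\<dots> = J3 ** (g ** J3 ** transpose g) ** J3" by (simp add: J3_sq matrix_mul_assoc)
    also have "\<dots> = J3" using SOJ_transpose_form[OF assms] by (simp add: J3_sq)
    finally show ?thesis .
  qed
  ultimately show ?thesis by (simp add: SOJ_def)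
qed

lemma up3_SOJ: "up3 r \<in> SOJ" and lo3_SOJ: "lo3 c \<in> SOJ" and al3_SOJ: "al3 s \<in> SOJ"
  by (simp_all add: SOJ_iff det_3 up3_def lo3_def al3_def diag3_eq power2_eq_square exp_add[symmetric])

lemma SOF_subset_SOJ: "SOF \<subseteq> SOJ"
  unfolding SOF_eq by (rule connected_component_subset)

lemma one_SOF: "mat 1 \<in> SOF"
  unfolding SOF_eq using one_SOJ by simp

lemma SOFI: "connected T \<Longrightarrow> T \<subseteq> SOJ \<Longrightarrow> g \<in> SOF \<Longrightarrow> g \<in> T \<Longrightarrow> h \<in> T \<Longrightarrow> h \<in> SOF"
  using connected_component_eq[of g SOJ "mat 1"] connected_component_maximal[of g T SOJ]
  unfolding SOF_eq by blast

lemma connected_SOF: "connected SOF"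
  unfolding SOF_eq by (rule connected_connected_component)

lemma SOF_mult: assumes "g \<in> SOF" "h \<in> SOF" shows "g ** h \<in> SOF"
proof (rule SOFI[of "(\<lambda>x. g ** x) ` SOF"])
  show "connected ((\<lambda>x. g ** x) ` SOF)"
    by (intro connected_continuous_image connected_SOF continuous_on_matrix_mult continuous_intros)
  show "(\<lambda>x. g ** x) ` SOF \<subseteq> SOJ" using assms SOF_subset_SOJ SOJ_mult by blast
  show "g \<in> (\<lambda>x. g ** x) ` SOF" using one_SOF by (metis imageI matrix_mul_rid)
qed (use assms in auto)

lemma hinv_SOF: assumes "g \<in> SOF" shows "hinv g \<in> SOF"
proof (rule SOFI[of "(\<lambda>x. hinv g ** x) ` SOF" "mat 1"])
  have g: "g \<in> SOJ" using assms SOF_subset_SOJ by blast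
  show "connected ((\<lambda>x. hinv g ** x) ` SOF)"
    by (intro connected_continuous_image connected_SOF continuous_on_matrix_mult continuous_intros)
  show "(\<lambda>x. hinv g ** x) ` SOF \<subseteq> SOJ" using g SOF_subset_SOJ SOJ_mult hinv_SOJ by blast
  show "hinv g \<in> (\<lambda>x. hinv g ** x) ` SOF" using one_SOF by (metis imageI matrix_mul_rid)
  show "mat 1 \<in> (\<lambda>x. hinv g ** x) ` SOF" using hinv_left[OF g] assms by (metis imageI)
qed (rule one_SOF)

lemma SOF_curve:
  assumes "continuous_on UNIV (f :: real \<Rightarrow> real^3^3)" "\<And>x. f x \<in> SOJ" "f 0 = mat 1"
  shows "f x \<in> SOF"
proof (rule SOFI[of "range f" "mat 1"])
  show "connected (range f)" using assms(1) connected_UNIV by (rule connected_continuous_image)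
qed (use assms one_SOF in \<open>auto simp: image_iff intro: exI[of _ 0]\<close>)

lemma up3_SOF: "up3 r \<in> SOF"
proof (rule SOF_curve)
  show "continuous_on UNIV up3" unfolding up3_def[abs_def] by (intro continuous_intros) auto
qed (auto simp: up3_SOJ, simp add: up3_def matrix3_simps)

lemma lo3_SOF: "lo3 r \<in> SOF"
proof (rule SOF_curve)
  show "continuous_on UNIV lo3" unfolding lo3_def[abs_def] by (intro continuous_intros) auto
qed (auto simp: lo3_SOJ, simp add: lo3_def matrix3_simps)

lemma al3_SOF: "al3 r \<in> SOF"
proof (rule SOF_curve)
  show "continuous_on UNIV al3" unfolding al3_def[abs_def] diag3_eq by (intro continuous_intros)
qed (auto simp: al3_SOJ, simp add: al3_def matrix3_simps)

lemma A0_eq: "A0 = range al3"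
  by (auto simp: A0_def al3_def)

section \<open>The open cell and a description of the identity component\<close>

lemma SOJ_chart:
  assumes g: "g \<in> SOJ" and pos: "0 < g$1$1"
  shows "g = lo3 (g$2$1 / g$1$1) ** up3 (g$1$2) ** al3 (ln (g$1$1))"
proof -
  define x where "x = g$1$1"
  define b where "b = g$2$1 / x"
  have x: "0 < x" "g$1$1 = x" using pos by (auto simp: x_def)
  have 21: "g$2$1 = b * x" using x by (simp add: b_def)
  have 31: "g$3$1 = b\<^sup>2 * x / 2"
  proof -
    have "2 * x * g$3$1 = (b * x)\<^sup>2" using g 21 x(2) by (simp add: SOJ_iff)
    then show ?thesis using x(1) by (simp add: power2_eq_square field_simps)
  qed
  define y where "y = lo3 (- b) ** g"
  have "y \<in> SOJ" unfolding y_def by (intro SOJ_mult lo3_SOJ g)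
  then have Y: "det y = 1" "2 * y$1$1 * y$3$1 = (y$2$1)\<^sup>2" "2 * y$1$2 * y$3$2 = (y$2$2)\<^sup>2 - 1"
    "2 * y$1$3 * y$3$3 = (y$2$3)\<^sup>2" "y$1$1 * y$3$2 + y$3$1 * y$1$2 = y$2$1 * y$2$2"
    "y$1$1 * y$3$3 + y$3$1 * y$1$3 = y$2$1 * y$2$3 + 1" "y$1$2 * y$3$3 + y$3$2 * y$1$3 = y$2$2 * y$2$3"
    by (simp_all add: SOJ_iff)
  have y1: "y$1$1 = x" "y$2$1 = 0" "y$3$1 = 0" "y$1$2 = g$1$2"
    unfolding y_def matrix3_mult_nth lo3_def mat3_nth x(2) 21 31
    by (auto simp: power2_eq_square algebra_simps)
  have 32: "y$3$2 = 0" using Y(5) y1 x by simp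
  have 33: "y$3$3 = 1 / x" using Y(6) y1 x by (simp add: field_simps)
  have 22: "y$2$2 = 1" using Y(1) y1 32 33 x by (simp add: det_3)
  have 23: "y$2$3 = y$1$2 / x" using Y(7) 32 33 22 by simp
  have 13: "y$1$3 = (y$1$2)\<^sup>2 / (2 * x)" using Y(4) 23 33 x by (simp add: field_simps power2_eq_square)
  have "y = up3 (g$1$2) ** al3 (ln x)"
    unfolding matrix3_simps up3_def al3_def mat3_nth
    using y1 32 33 22 23 13 x by (simp add: exp_minus field_simps)
  moreover have "g = lo3 b ** y"
    unfolding y_def matrix_mul_assoc
    by (simp add: matrix3_simps lo3_def power2_eq_square algebra_simps)
  ultimately have "g = lo3 b ** (up3 (g$1$2) ** al3 (ln x))" by (simp only:)
  then show ?thesis by (simp only: b_def x_def matrix_mul_assoc)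
qed

text \<open>The first column is a nonzero isotropic vector \<open>(x, y, z)\<close>, so
  \<open>2 x z = y\<^sup>2 \<ge> 0\<close> and \<open>x\<close>, \<open>z\<close> do not have
  opposite signs. The sign of \<open>x + z\<close> tells the two halves of the light cone
  apart.\<close>

lemma SOJ_first_column:
  assumes "g \<in> SOJ" shows "g$1$1 + g$3$1 \<noteq> 0"
proof
  assume s: "g$1$1 + g$3$1 = 0"
  then have "2 * g$1$1 * g$3$1 = - 2 * (g$1$1)\<^sup>2" by (simp add: power2_eq_square eq_neg_iff_add_eq_0[symmetric] add.commute)
  then have "(g$2$1)\<^sup>2 + 2 * (g$1$1)\<^sup>2 = 0" using assms by (simp add: SOJ_iff)
  then have "g$2$1 = 0" "g$1$1 = 0" by (simp_all add: sum_power2_eq_zero_iff add_nonneg_eq_0_iff)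
  with s assms show False by (simp add: SOJ_iff)
qed

lemma SOF_first_column:
  assumes "g \<in> SOF" shows "0 < g$1$1 + g$3$1"
proof (rule ccontr)
  assume neg: "\<not> ?thesis"
  define f where "f x = x$1$1 + x$3$1" for x :: "real^3^3"
  have "connected (f ` SOF)"
    unfolding f_def by (intro connected_continuous_image connected_SOF continuous_intros)
  moreover have "f (mat 1) \<in> f ` SOF" "f g \<in> f ` SOF" using one_SOF assms by auto
  moreover have "f g \<le> 0" "0 \<le> f (mat 1)" using neg by (auto simp: f_def mat3_one_nth)
  ultimately have "0 \<in> f ` SOF" by (metis connectedD_interval)
  then show False using SOJ_first_column SOF_subset_SOJ by (auto simp: f_def)
qed

text \<open>The cell requires a positive corner. For a first column in the positive half cone the
  corner can only fail by vanishing, and one fixed unipotent translation repairs this.\<close>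

lemma SOF_decomp:
  assumes "g \<in> SOJ" "0 < g$1$1 + g$3$1"
  obtains e b a s where "e \<in> {0, -1}" "g = up3 e ** (lo3 b ** up3 a ** al3 s)"
proof (cases "0 < g$1$1")
  case True
  have "up3 0 = mat 1" by (simp add: up3_def matrix3_simps)
  then have "g = up3 0 ** (lo3 (g$2$1 / g$1$1) ** up3 (g$1$2) ** al3 (ln (g$1$1)))"
    using SOJ_chart[OF assms(1) True] by simp
  then show ?thesis by (rule that[rotated]) simp
next
  case False
  have "2 * g$1$1 * g$3$1 = (g$2$1)\<^sup>2" using assms by (simp add: SOJ_iff)
  then have nn: "0 \<le> g$1$1 * g$3$1" using zero_le_power2[of "g$2$1"] by linarith
  have "0 < g$3$1" using False assms(2) by linarith
  then have "g$1$1 = 0" using nn False by (simp add: zero_le_mult_iff)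
  then have "g$2$1 = 0" using assms(1) by (simp add: SOJ_iff)
  \<comment> \<open>As \<open>g$1$1\<close> and \<open>g$2$1\<close> vanish, this moves
    \<open>g$3$1 / 2 > 0\<close> into the corner.\<close>
  have m: "up3 1 ** g \<in> SOJ" by (intro SOJ_mult up3_SOJ assms)
  have "0 < (up3 1 ** g)$1$1"
    using \<open>0 < g$3$1\<close> \<open>g$1$1 = 0\<close> \<open>g$2$1 = 0\<close> by (simp add: matrix3_mult_nth up3_def)
  from SOJ_chart[OF m this] obtain b a s where "up3 1 ** g = lo3 b ** up3 a ** al3 s" by blast
  moreover have "up3 (-1) ** up3 1 = mat 1" by (simp add: up3_def matrix3_simps)
  ultimately have "g = up3 (-1) ** (lo3 b ** up3 a ** al3 s)" by (metis matrix_mul_assoc matrix_mul_lid)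
  then show ?thesis by (rule that[rotated]) simp
qed

text \<open>The sign cannot change on a connected set, and conversely \<open>SOF_decomp\<close>
  writes the matrix as a product of elements of one-parameter groups.\<close>

lemma SOF_iff: "g \<in> SOF \<longleftrightarrow> g \<in> SOJ \<and> 0 < g$1$1 + g$3$1"
proof
  assume g: "g \<in> SOJ \<and> 0 < g$1$1 + g$3$1"
  then obtain e b a s where "g = up3 e ** (lo3 b ** up3 a ** al3 s)" using SOF_decomp by metis
  then show "g \<in> SOF" by (simp add: SOF_mult up3_SOF lo3_SOF al3_SOF)
qed (use SOF_first_column SOF_subset_SOJ in blast)

lemma closed_SOJ: "closed SOJ"
proof -
  have eq: "SOJ = {g. det g = 1} \<inter> {g. transpose g ** J3 ** g = J3}" by (auto simp: SOJ_def)
  have "closed {g :: real^3^3. det g = 1}"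
    unfolding det_3 by (intro closed_Collect_eq continuous_intros)
  moreover have "closed {g. transpose g ** J3 ** g = J3}"
    by (intro closed_Collect_eq continuous_on_matrix_mult continuous_intros
        bounded_linear.continuous_on[OF bounded_linear_transpose])
  ultimately show ?thesis unfolding eq by (rule closed_Int)
qed

lemma closed_SOF: "closed SOF"
  unfolding SOF_eq by (rule closed_connected_component[OF closed_SOJ])

lemma norm_J3_mult: "norm (J3 ** A) = norm A" "norm (A ** J3) = norm A"
proof -
  have "(norm (J3 ** A))\<^sup>2 = (norm A)\<^sup>2" "(norm (A ** J3))\<^sup>2 = (norm A)\<^sup>2"
    by (simp_all add: norm_matrix_sq sum_3 matrix3_mult_nth J3_def)
  then show "norm (J3 ** A) = norm A" "norm (A ** J3) = norm A" by simp_all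
qed

lemma norm_hinv: "norm (hinv g) = norm g"
  by (simp add: hinv_def norm_J3_mult norm_transpose)

text \<open>The unipotent and diagonal parts are read off \<open>h h\<^sup>T\<close>.\<close>

lemma SOF_Iwasawa:
  assumes h: "h \<in> SOF"
  obtains s r k where "h = al3 s ** up3 r ** k" "k \<in> SO3" "k \<in> SOF"
proof -
  have hJ: "h \<in> SOJ" using h SOF_subset_SOJ by blast
  define Q where "Q = h ** transpose h"
  have Q33: "0 < Q$3$3"
  proof (rule ccontr)
    assume "\<not> 0 < Q$3$3"
    then have le: "(h$3$1)\<^sup>2 + (h$3$2)\<^sup>2 + (h$3$3)\<^sup>2 \<le> 0"
      by (simp add: Q_def matrix3_mult_nth transpose_nth power2_eq_square)
    have "(h$3$1)\<^sup>2 = 0" "(h$3$2)\<^sup>2 = 0" "(h$3$3)\<^sup>2 = 0"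
      using le zero_le_power2[of "h$3$1"] zero_le_power2[of "h$3$2"] zero_le_power2[of "h$3$3"] by linarith+
    then have "h$3$1 = 0" "h$3$2 = 0" "h$3$3 = 0" by simp_all
    then show False using hJ by (simp add: SOJ_def det_3)
  qed
  \<comment> \<open>With \<open>Q = h h\<^sup>T\<close>, the parameters \<open>s\<close> and
    \<open>r\<close> are chosen so that \<open>M = k k\<^sup>T\<close> gets \<open>M$3$3 = 1\<close>
    and \<open>M$2$3 = 0\<close>.\<close>
  define s where "s = - ln (Q$3$3) / 2"
  define r where "r = Q$2$3 * exp s"
  define p where "p = al3 s ** up3 r"
  define pinv where "pinv = up3 (- r) ** al3 (- s)"
  have al: "al3 s ** al3 (- s) = mat 1" "al3 (- s) ** al3 s = mat 1"
    by (simp_all add: al3_def matrix3_simps exp_add[symmetric])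
  have up: "up3 r ** up3 (- r) = mat 1" "up3 (- r) ** up3 r = mat 1"
    by (simp_all add: up3_def matrix3_simps power2_eq_square)
  have pp: "p ** pinv = mat 1"
  proof -
    have "p ** pinv = al3 s ** (up3 r ** up3 (- r)) ** al3 (- s)"
      by (simp add: p_def pinv_def matrix_mul_assoc)
    then show ?thesis using up al by simp
  qed
  define k where "k = pinv ** h"
  have kSOF: "k \<in> SOF" unfolding k_def pinv_def by (intro SOF_mult up3_SOF al3_SOF h)
  then have kJ: "k \<in> SOJ" using SOF_subset_SOJ by blast
  have hk: "h = p ** k" using pp by (simp add: k_def matrix_mul_assoc)
  define M where "M = k ** transpose k"
  have M: "M = pinv ** Q ** transpose pinv"
    by (simp add: M_def k_def Q_def matrix_transpose_mul matrix_mul_assoc)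
  have "exp s * exp s = exp (- ln (Q$3$3))" by (simp add: s_def flip: exp_add)
  then have es: "exp s * exp s * Q$3$3 = 1" using Q33 by (simp add: exp_minus)
  have Qsym: "Q$3$2 = Q$2$3" by (simp add: Q_def matrix3_mult_nth transpose_nth algebra_simps)
  have M33: "M$3$3 = 1"
    unfolding M pinv_def matrix3_simps up3_def al3_def mat3_nth using es
    by (simp add: algebra_simps)
  have "M$2$3 = exp s * (Q$2$3 - Q$2$3 * (exp s * exp s * Q$3$3))"
    unfolding M pinv_def matrix3_simps up3_def al3_def mat3_nth r_def
    by (simp add: algebra_simps)
  then have M23: "M$2$3 = 0" using es by simp
  have Msym: "M$1$2 = M$2$1" "M$1$3 = M$3$1" "M$2$3 = M$3$2"
    by (simp_all add: M_def matrix3_mult_nth transpose_nth algebra_simps)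
  \<comment> \<open>A symmetric \<open>M\<close> in the orthogonal group of the form with third
    column \<open>e\<^sub>3\<close> up to the entry 13 is forced to be 1 by this identity and the
    determinant.\<close>
  have MJM: "M ** J3 ** M = J3"
  proof -
    have "M ** J3 ** M = k ** (transpose k ** J3 ** k) ** transpose k"
      by (simp add: M_def matrix_mul_assoc)
    then show ?thesis using kJ SOJ_transpose_form[OF kJ] by (simp add: SOJ_def)
  qed
  have detM: "det M = 1" using kJ by (simp add: M_def det_mul det_transpose SOJ_def)
  note E = MJM[unfolded matrix3_simps J3_def mat3_nth]
  have 13: "M$1$3 = 0" using E M33 M23 Msym by simp
  have 11: "M$1$1 = 1" using E M33 M23 Msym 13 by simp
  have 12: "M$1$2 = 0" using E M33 M23 Msym 13 11 by simp
  have 22: "M$2$2 = 1" using detM M33 M23 Msym 13 11 12 by (simp add: det_3)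
  have "M = mat 1" unfolding matrix3_simps using M33 M23 Msym 13 11 12 22 by simp
  then have "orthogonal_matrix k"
    by (simp add: M_def orthogonal_matrix_def matrix_left_right_inverse)
  then have "k \<in> SO3" using kJ by (simp add: SO3_def SOJ_def)
  then show ?thesis using that hk kSOF unfolding p_def by blast
qed

section \<open>Lengths of paths and local distance comparison\<close>

lemma matrix_inv_unique:
  fixes A B :: "real^'n^'n"
  assumes "A ** B = mat 1" shows "matrix_inv A = B"
proof -
  have BA: "B ** A = mat 1" using assms matrix_left_right_inverse by blast
  have "A ** matrix_inv A = mat 1 \<and> matrix_inv A ** A = mat 1"
    unfolding matrix_inv_def by (rule someI[of _ B]) (simp add: assms BA)
  then have "B ** (A ** matrix_inv A) = B" by simp
  then show ?thesis using BA by (simp add: matrix_mul_assoc)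
qed

lemma det_one_inverse:
  fixes A :: "real^'n^'n"
  assumes "det A = 1" shows "A ** matrix_inv A = mat 1" "matrix_inv A ** A = mat 1" "det (matrix_inv A) = 1"
proof -
  obtain B where B: "A ** B = mat 1" using assms invertible_det_nz[of A] unfolding invertible_def by auto
  then have eq: "matrix_inv A = B" by (rule matrix_inv_unique)
  show AB: "A ** matrix_inv A = mat 1" using B eq by simp
  then show "matrix_inv A ** A = mat 1" using matrix_left_right_inverse by blast
  have "det A * det (matrix_inv A) = 1" using AB by (metis det_mul det_I)
  then show "det (matrix_inv A) = 1" using assms by simp
qed

definition riem_len :: "(real^3^3) set \<Rightarrow> real^3^3 \<Rightarrow> real^3^3 \<Rightarrow> real \<Rightarrow> bool" where
  "riem_len S x y l \<longleftrightarrow> (\<exists>p. valid_path p \<and> path_image p \<subseteq> S \<and>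
     pathstart p = x \<and> pathfinish p = y \<and>
     ((\<lambda>t. norm (matrix_inv (p t) ** vector_derivative p (at t))) has_integral l) {0..1})"

lemma riem_dist_eq: "riem_dist S x y = Inf {l. riem_len S x y l}"
  by (simp add: riem_dist_def riem_len_def)

lemma riem_len_nonneg: "riem_len S x y l \<Longrightarrow> 0 \<le> l"
  unfolding riem_len_def by (auto elim!: has_integral_nonneg)

text \<open>A path of length \<open>l \<le> 1/2\<close> stays in the ball of radius \<open>2 |x|\<close>: its maximal norm \<open>m\<close>
  satisfies \<open>m \<le> |x| + m l\<close>, because \<open>|p'| \<le> |p| |p\<inverse> p'|\<close>.\<close>

lemma riem_len_lower:
  assumes "riem_len S x y l" "l \<le> 1/2" "\<And>g. g \<in> S \<Longrightarrow> det g = 1"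
  shows "norm (y - x) \<le> 2 * norm x * l"
proof -
  define F where "F p t = norm (matrix_inv (p t) ** vector_derivative p (at t))" for p :: "real \<Rightarrow> real^3^3" and t
  obtain p where p: "valid_path p" "path_image p \<subseteq> S" "p 0 = x" "p 1 = y" "(F p has_integral l) {0..1}"
    using assms(1) unfolding riem_len_def F_def pathstart_def pathfinish_def by blast
  have cont: "continuous_on {0..1} p" using p(1) by (simp add: valid_path_def piecewise_C1_differentiable_on_def)
  obtain K D where K: "finite K" "\<And>t. t \<in> {0..1} - K \<Longrightarrow> (p has_vector_derivative D t) (at t)"
    using p(1) unfolding valid_path_def piecewise_C1_differentiable_on_def C1_differentiable_on_def by blast
  have "compact ((\<lambda>t. norm (p t)) ` {0..1})"
    by (intro compact_continuous_image continuous_on_norm cont compact_Icc)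
  then obtain t0 where t0: "t0 \<in> {0..1}" "\<And>t. t \<in> {0..1} \<Longrightarrow> norm (p t) \<le> norm (p t0)"
    using compact_attains_sup[of "(\<lambda>t. norm (p t)) ` {0..1}"] by fastforce
  define m where "m = norm (p t0)"
  have m0: "0 \<le> m" by (simp add: m_def)
  \<comment> \<open>With the value 0 at break points the pointwise bound by \<open>m * F p t\<close>
    holds everywhere, whatever \<open>vector_derivative\<close> returns there.\<close>
  define D' where "D' t = (if t \<in> K then 0 else D t)" for t
  have F0: "0 \<le> F p t" for t by (simp add: F_def)
  have D': "norm (D' t) \<le> m * F p t" if "t \<in> {0..1}" for t
  proof (cases "t \<in> K")
    case False
    have "p t \<in> S" using p(2) that by (auto simp: path_image_def)
    then have d: "det (p t) = 1" by (rule assms(3))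
    have "vector_derivative p (at t) = D t"
      using K(2)[of t] that False by (intro vector_derivative_at) auto
    then have "D t = p t ** (matrix_inv (p t) ** vector_derivative p (at t))"
      using det_one_inverse(1)[OF d] by (simp add: matrix_mul_assoc)
    then have "norm (D t) \<le> norm (p t) * F p t"
      unfolding F_def by (metis norm_matrix_mult_le)
    also have "\<dots> \<le> m * F p t" unfolding m_def by (intro mult_right_mono t0(2) that F0)
    finally show ?thesis using False by (simp add: D'_def)
  qed (simp add: D'_def m0 F0)
  have bound: "norm (p t - p 0) \<le> m * l" if t: "t \<in> {0..1}" for t
  proof -
    have ftc: "(D' has_integral (p t - p 0)) {0..t}"
    proof (rule fundamental_theorem_of_calculus_interior_strong[OF K(1)])
      show "(p has_vector_derivative D' u) (at u)" if "u \<in> {0<..<t} - K" for u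
        using K(2)[of u] that t by (auto simp: D'_def)
      show "continuous_on {0..t} p" by (rule continuous_on_subset[OF cont]) (use t in auto)
    qed (use t in auto)
    have int01: "F p integrable_on {0..1}" using p(5) by blast
    have int: "F p integrable_on {0..t}"
      by (rule integrable_on_subinterval[OF int01]) (use t in auto)
    have "norm (integral {0..t} D') \<le> integral {0..t} (\<lambda>u. m * F p u)"
    proof (rule integral_norm_bound_integral)
      show "D' integrable_on {0..t}" using ftc by blast
      show "(\<lambda>u. m * F p u) integrable_on {0..t}"
        using integrable_cmul[OF int, of m] by (simp only: real_scaleR_def)
      show "norm (D' u) \<le> m * F p u" if "u \<in> {0..t}" for u
        using that t by (intro D') auto
    qed
    also have "\<dots> = m * integral {0..t} (F p)" by simp
    also have "\<dots> \<le> m * integral {0..1} (F p)"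
      by (intro mult_left_mono integral_subset_le int int01 m0) (use t F0 in auto)
    also have "integral {0..1} (F p) = l" using p(5) by (rule integral_unique)
    finally show ?thesis using ftc by (simp add: integral_unique)
  qed
  have "m \<le> norm x + norm (p t0 - p 0)" using p(3) norm_triangle_sub[of "p t0" x] by (simp add: m_def)
  also have "\<dots> \<le> norm x + m * l" using bound[OF t0(1)] by simp
  also have "m * l \<le> m * (1/2)" by (intro mult_left_mono assms m0)
  finally have m: "m \<le> 2 * norm x" by simp
  have l0: "0 \<le> l" by (rule riem_len_nonneg[OF assms(1)])
  have "norm (y - x) \<le> m * l" using bound[of 1] p(3,4) by simp
  also have "\<dots> \<le> 2 * norm x * l" by (intro mult_right_mono m l0)
  finally show ?thesis .
qed

lemma riem_dist_le: "riem_len S x y l \<Longrightarrow> riem_dist S x y \<le> l"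
  unfolding riem_dist_eq by (rule cInf_lower) (auto intro!: bdd_belowI[of _ 0] riem_len_nonneg)

text \<open>Paths of length at most 1/2 are covered by \<open>riem_len_lower\<close>; for longer
  ones \<open>norm (x - y) \<le> 2 * R \<le> 4 * R * l\<close> is trivial. The given path makes the
  infimum one over a nonempty set.\<close>

lemma norm_le_riem_dist:
  assumes "\<And>g. g \<in> S \<Longrightarrow> det g = 1" "riem_len S x y l0" "norm x \<le> R" "norm y \<le> R" "0 < R"
  shows "norm (x - y) \<le> 4 * R * riem_dist S x y"
proof -
  have "norm (x - y) / (4 * R) \<le> riem_dist S x y"
    unfolding riem_dist_eq
  proof (rule cInf_greatest)
    fix l assume "l \<in> {l. riem_len S x y l}"
    then have l: "riem_len S x y l" by simp
    have "norm (x - y) \<le> 4 * R * l"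
    proof (cases "l \<le> 1/2")
      case True
      have "norm (x - y) \<le> 2 * norm x * l"
        using riem_len_lower[OF l True assms(1)] by (simp add: norm_minus_commute)
      also have "\<dots> \<le> (4 * R) * l"
        using assms(3,5) by (intro mult_right_mono riem_len_nonneg[OF l]) auto
      finally show ?thesis .
    next
      case False
      have "norm (x - y) \<le> R + R" using norm_triangle_ineq4[of x y] assms(3,4) by linarith
      also have "\<dots> \<le> 4 * R * l" using False assms(5) by (simp add: field_simps)
      finally show ?thesis .
    qed
    then show "norm (x - y) / (4 * R) \<le> l" using assms(5) by (simp add: field_simps)
  qed (use assms(2) in auto)
  then show ?thesis using assms(5) by (simp add: field_simps)
qed

lemma riem_dist_nonneg: "riem_len S x y l0 \<Longrightarrow> 0 \<le> riem_dist S x y"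
  unfolding riem_dist_eq by (rule cInf_greatest) (auto intro: riem_len_nonneg)

text \<open>Left invariance: \<open>(g p)\<inverse> (g p)' = p\<inverse> p'\<close>.\<close>

lemma riem_len_translate:
  assumes "riem_len S x y l" "g \<in> S" and mult: "\<And>a b. a \<in> S \<Longrightarrow> b \<in> S \<Longrightarrow> a ** b \<in> S"
    and det: "\<And>a. a \<in> S \<Longrightarrow> det a = 1"
  shows "riem_len S (g ** x) (g ** y) l"
proof -
  obtain p where p: "valid_path p" "path_image p \<subseteq> S" "p 0 = x" "p 1 = y"
    "((\<lambda>t. norm (matrix_inv (p t) ** vector_derivative p (at t))) has_integral l) {0..1}"
    using assms(1) unfolding riem_len_def pathstart_def pathfinish_def by blast
  obtain K D where K: "finite K" "\<And>t. t \<in> {0..1} - K \<Longrightarrow> (p has_vector_derivative D t) (at t)"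
    "continuous_on ({0..1} - K) D" and cont: "continuous_on {0..1} p"
    using p(1) unfolding valid_path_def piecewise_C1_differentiable_on_def C1_differentiable_on_def by blast
  define q where "q t = g ** p t" for t
  have vd: "(q has_vector_derivative g ** D t) (at t)" if "t \<in> {0..1} - K" for t
    unfolding q_def
    using bounded_bilinear.has_vector_derivative[OF bounded_bilinear_matrix_mult
        has_vector_derivative_const[of g] K(2)[OF that]] by simp
  have "valid_path q"
    unfolding valid_path_def piecewise_C1_differentiable_on_def C1_differentiable_on_def
  proof (intro conjI exI[of _ K] exI[of _ "\<lambda>t. g ** D t"] K(1) ballI)
    show "continuous_on {0..1} q" unfolding q_def
      by (intro continuous_on_matrix_mult continuous_on_const cont)
    show "continuous_on ({0..1} - K) (\<lambda>t. g ** D t)"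
      by (intro continuous_on_matrix_mult continuous_on_const K(3))
  qed (rule vd)
  moreover have "path_image q \<subseteq> S" using p(2) mult assms(2) by (auto simp: path_image_def q_def)
  \<comment> \<open>The derivatives are known off the break points only; a finite set does not
    affect the integral.\<close>
  moreover have "((\<lambda>t. norm (matrix_inv (q t) ** vector_derivative q (at t))) has_integral l) {0..1}"
  proof (rule has_integral_spike_finite[OF K(1) _ p(5)])
    fix t assume t: "t \<in> {0..1} - K"
    have pS: "p t \<in> S" using p(2) t by (auto simp: path_image_def)
    have inv: "matrix_inv (q t) = matrix_inv (p t) ** matrix_inv g"
    proof (rule matrix_inv_unique)
      have "q t ** (matrix_inv (p t) ** matrix_inv g) = g ** (p t ** matrix_inv (p t)) ** matrix_inv g"
        by (simp add: q_def matrix_mul_assoc)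
      then show "q t ** (matrix_inv (p t) ** matrix_inv g) = mat 1"
        using det_one_inverse(1)[OF det[OF pS]] det_one_inverse(1)[OF det[OF assms(2)]]
        by simp
    qed
    have "matrix_inv (q t) ** vector_derivative q (at t) = matrix_inv (p t) ** (matrix_inv g ** g) ** D t"
      unfolding inv vector_derivative_at[OF vd[OF t]] by (simp add: matrix_mul_assoc)
    also have "\<dots> = matrix_inv (p t) ** vector_derivative p (at t)"
      using det_one_inverse(2)[OF det[OF assms(2)]] vector_derivative_at[OF K(2)[OF t]]
      by simp
    finally show "norm (matrix_inv (q t) ** vector_derivative q (at t)) =
        norm (matrix_inv (p t) ** vector_derivative p (at t))" by simp
  qed
  ultimately show ?thesis
    unfolding riem_len_def pathstart_def pathfinish_def
    by (intro exI[of _ q] conjI) (auto simp: q_def p(3,4))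
qed

lemma riem_dist_translate:
  assumes "g \<in> S" "k \<in> S" "k ** g = mat 1" and mult: "\<And>a b. a \<in> S \<Longrightarrow> b \<in> S \<Longrightarrow> a ** b \<in> S"
    and det: "\<And>a. a \<in> S \<Longrightarrow> det a = 1"
  shows "riem_dist S (g ** x) (g ** y) = riem_dist S x y"
proof -
  have "riem_len S (g ** x) (g ** y) l \<longleftrightarrow> riem_len S x y l" for l
  proof
    assume "riem_len S (g ** x) (g ** y) l"
    from riem_len_translate[OF this assms(2) mult det]
    have "riem_len S ((k ** g) ** x) ((k ** g) ** y) l" by (simp add: matrix_mul_assoc)
    then show "riem_len S x y l" using assms(3) by simp
  qed (rule riem_len_translate[OF _ assms(1) mult det])
  then show ?thesis by (simp add: riem_dist_eq)
qed

text \<open>\<open>M\<close> bounds the curve and its inverse and \<open>N\<close> its velocity, so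
  the length is at most \<open>M * N\<close>. The inverse \<open>v\<close> is carried along to avoid
  proving continuity of \<open>matrix_inv\<close>, and curves live on the whole line to avoid
  one-sided derivatives. By the product rule the class is closed under multiplication.\<close>

definition C1_curve :: "(real^3^3) set \<Rightarrow> real \<Rightarrow> real \<Rightarrow> real^3^3 \<Rightarrow> real^3^3 \<Rightarrow> bool" where
  "C1_curve S M N x y \<longleftrightarrow> (\<exists>u u' v. u 0 = x \<and> u 1 = y \<and>
     (\<forall>t::real. (u has_vector_derivative u' t) (at t)) \<and> continuous_on UNIV u' \<and>
     continuous_on UNIV v \<and> (\<forall>t. u t ** v t = mat 1) \<and>
     (\<forall>t\<in>{0..1}. u t \<in> S \<and> norm (u t) \<le> M \<and> norm (v t) \<le> M \<and> norm (u' t) \<le> N))"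

lemma C1_curve_riem_len:
  assumes "C1_curve S M N x y"
  obtains l where "riem_len S x y l" "l \<le> M * N"
proof -
  obtain u u' v where u: "u 0 = x" "u 1 = y" "\<And>t::real. (u has_vector_derivative u' t) (at t)"
    "continuous_on UNIV u'" "continuous_on UNIV v" "\<And>t. u t ** v t = mat 1"
    "\<And>t. t \<in> {0..1} \<Longrightarrow> u t \<in> S \<and> norm (u t) \<le> M \<and> norm (v t) \<le> M \<and> norm (u' t) \<le> N"
    using assms unfolding C1_curve_def by blast
  define f where "f t = norm (v t ** u' t)" for t
  have cf: "continuous_on {0..1} f" unfolding f_def
    by (intro continuous_on_norm continuous_on_matrix_mult continuous_on_subset[OF u(4)]
        continuous_on_subset[OF u(5)]) auto
  have M0: "0 \<le> M" by (rule order_trans[OF norm_ge_zero[of "u 0"]]) (use u(7)[of 0] in simp)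
  have "norm (integral {0..1} f) \<le> M * N * (1 - 0)"
  proof (rule integral_bound)
    fix t :: real assume t: "t \<in> {0..1}"
    have "f t \<le> norm (v t) * norm (u' t)" by (simp add: f_def norm_matrix_mult_le)
    also have "\<dots> \<le> M * N" using u(7)[OF t] M0 by (intro mult_mono) auto
    finally show "norm (f t) \<le> M * N" by (simp add: f_def)
  qed (use cf in auto)
  then have le: "integral {0..1} f \<le> M * N" by simp
  have "continuous_on {0..1} u"
    using u(3) by (meson continuous_at_imp_continuous_on has_vector_derivative_continuous)
  then have "valid_path u"
    unfolding valid_path_def piecewise_C1_differentiable_on_def C1_differentiable_on_def
    using u(3,4) by (intro conjI exI[of _ "{}"] exI[of _ u']) (auto intro: continuous_on_subset)
  moreover have "path_image u \<subseteq> S" using u(7) by (auto simp: path_image_def)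
  moreover have "(\<lambda>t. norm (matrix_inv (u t) ** vector_derivative u (at t))) = f"
    using matrix_inv_unique[OF u(6)] vector_derivative_at[OF u(3)] by (simp add: f_def fun_eq_iff)
  moreover have "(f has_integral integral {0..1} f) {0..1}"
    using cf by (intro integrable_integral integrable_continuous_real)
  ultimately have "riem_len S x y (integral {0..1} f)"
    unfolding riem_len_def pathstart_def pathfinish_def using u(1,2) by (intro exI[of _ u]) simp
  with le show ?thesis using that by blast
qed

lemma C1_curve_mult:
  assumes "C1_curve S M1 N1 x1 y1" "C1_curve S M2 N2 x2 y2"
    and mult: "\<And>a b. a \<in> S \<Longrightarrow> b \<in> S \<Longrightarrow> a ** b \<in> S"
  shows "C1_curve S (M1 * M2) (M1 * N2 + N1 * M2) (x1 ** x2) (y1 ** y2)"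
proof -
  obtain u u' v where u: "u 0 = x1" "u 1 = y1" "\<And>t::real. (u has_vector_derivative u' t) (at t)"
    "continuous_on UNIV u'" "continuous_on UNIV v" "\<And>t. u t ** v t = mat 1"
    "\<And>t. t \<in> {0..1} \<Longrightarrow> u t \<in> S \<and> norm (u t) \<le> M1 \<and> norm (v t) \<le> M1 \<and> norm (u' t) \<le> N1"
    using assms(1) unfolding C1_curve_def by blast
  obtain w w' z where w: "w 0 = x2" "w 1 = y2" "\<And>t::real. (w has_vector_derivative w' t) (at t)"
    "continuous_on UNIV w'" "continuous_on UNIV z" "\<And>t. w t ** z t = mat 1"
    "\<And>t. t \<in> {0..1} \<Longrightarrow> w t \<in> S \<and> norm (w t) \<le> M2 \<and> norm (z t) \<le> M2 \<and> norm (w' t) \<le> N2"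
    using assms(2) unfolding C1_curve_def by blast
  have cu: "continuous_on UNIV u" "continuous_on UNIV w"
    using u(3) w(3) by (meson continuous_at_imp_continuous_on has_vector_derivative_continuous)+
  have pos: "0 \<le> M1" "0 \<le> M2" "0 \<le> N1" "0 \<le> N2"
    using u(7)[of 0] w(7)[of 0] order_trans[OF norm_ge_zero[of "u 0"], of M1]
      order_trans[OF norm_ge_zero[of "w 0"], of M2] order_trans[OF norm_ge_zero[of "u' 0"], of N1]
      order_trans[OF norm_ge_zero[of "w' 0"], of N2] by simp_all
  show ?thesis unfolding C1_curve_def
  proof (rule exI[of _ "\<lambda>t. u t ** w t"], rule exI[of _ "\<lambda>t. u t ** w' t + u' t ** w t"],
      rule exI[of _ "\<lambda>t. z t ** v t"], intro conjI allI ballI)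
    show "((\<lambda>t. u t ** w t) has_vector_derivative u t ** w' t + u' t ** w t) (at t)" for t
      by (rule bounded_bilinear.has_vector_derivative[OF bounded_bilinear_matrix_mult u(3) w(3)])
    show "continuous_on UNIV (\<lambda>t. u t ** w' t + u' t ** w t)"
      by (intro continuous_on_add continuous_on_matrix_mult cu u w)
    show "continuous_on UNIV (\<lambda>t. z t ** v t)" by (intro continuous_on_matrix_mult u w)
    show "u t ** w t ** (z t ** v t) = mat 1" for t
    proof -
      have "u t ** w t ** (z t ** v t) = u t ** (w t ** z t) ** v t" by (simp add: matrix_mul_assoc)
      then show ?thesis using u(6)[of t] w(6)[of t] by simp
    qed
    fix t :: real assume t: "t \<in> {0..1}"
    note U = u(7)[OF t] and W = w(7)[OF t]
    show "u t ** w t \<in> S" using U W mult by blast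
    show "norm (u t ** w t) \<le> M1 * M2"
      using U W by (intro order_trans[OF norm_matrix_mult_le] mult_mono pos) auto
    have "norm (z t ** v t) \<le> M2 * M1"
      using U W by (intro order_trans[OF norm_matrix_mult_le] mult_mono pos) auto
    then show "norm (z t ** v t) \<le> M1 * M2" by (simp add: mult.commute)
    show "norm (u t ** w' t + u' t ** w t) \<le> M1 * N2 + N1 * M2"
      using U W by (intro norm_triangle_le add_mono order_trans[OF norm_matrix_mult_le] mult_mono pos) auto
  qed (simp_all add: u w)
qed

lemma C1_curve_const:
  assumes "x \<in> S" "x ** v = mat 1" "norm x \<le> M" "norm v \<le> M"
  shows "C1_curve S M 0 x x"
  unfolding C1_curve_def
  by (rule exI[of _ "\<lambda>_. x"], rule exI[of _ "\<lambda>_. 0"], rule exI[of _ "\<lambda>_. v"]) (use assms in auto)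

lemma C1_curve_mono:
  assumes "C1_curve S M N x y" "M \<le> M'" "N \<le> N'" "S \<subseteq> S'"
  shows "C1_curve S' M' N' x y"
proof -
  obtain u u' v where u: "u 0 = x" "u 1 = y" "\<And>t::real. (u has_vector_derivative u' t) (at t)"
    "continuous_on UNIV u'" "continuous_on UNIV v" "\<And>t. u t ** v t = mat 1"
    "\<And>t. t \<in> {0..1} \<Longrightarrow> u t \<in> S \<and> norm (u t) \<le> M \<and> norm (v t) \<le> M \<and> norm (u' t) \<le> N"
    using assms(1) unfolding C1_curve_def by blast
  show ?thesis unfolding C1_curve_def
  proof (rule exI[of _ u], rule exI[of _ u'], rule exI[of _ v], intro conjI allI ballI)
    fix t :: real assume t: "t \<in> {0..1}"
    show "u t \<in> S'" "norm (u t) \<le> M'" "norm (v t) \<le> M'" "norm (u' t) \<le> N'"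
      using u(7)[OF t] assms(2-4) by auto
  qed (simp_all add: u)
qed

section \<open>Curves inside the one-parameter subgroups\<close>

lemma has_vector_derivative_up3:
  "(up3 has_vector_derivative mat3 0 1 r 0 0 1 0 0 0) (at r)"
proof -
  have eq: "up3 = (\<lambda>r. mat 1 + r *\<^sub>R mat3 0 1 0 0 0 1 0 0 0 + (r\<^sup>2/2) *\<^sub>R mat3 0 0 1 0 0 0 0 0 0)"
    by (simp add: fun_eq_iff up3_def matrix3_simps)
  have "((\<lambda>r. mat 1 + r *\<^sub>R mat3 0 1 0 0 0 1 0 0 0 + (r\<^sup>2/2) *\<^sub>R mat3 0 0 1 0 0 0 0 0 0)
      has_vector_derivative (mat3 0 1 0 0 0 1 0 0 0 + r *\<^sub>R mat3 0 0 1 0 0 0 0 0 0)) (at r)"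
    unfolding has_vector_derivative_def
    by (auto intro!: derivative_eq_intros simp: scaleR_add_right algebra_simps)
  then show ?thesis unfolding eq
    by (rule back_subst[where P="\<lambda>d. (_ has_vector_derivative d) _"]) (simp add: matrix3_simps)
qed

lemma has_vector_derivative_lo3:
  "(lo3 has_vector_derivative mat3 0 0 0 1 0 0 r 1 0) (at r)"
proof -
  have eq: "lo3 = (\<lambda>r. mat 1 + r *\<^sub>R mat3 0 0 0 1 0 0 0 1 0 + (r\<^sup>2/2) *\<^sub>R mat3 0 0 0 0 0 0 1 0 0)"
    by (simp add: fun_eq_iff lo3_def matrix3_simps)
  have "((\<lambda>r. mat 1 + r *\<^sub>R mat3 0 0 0 1 0 0 0 1 0 + (r\<^sup>2/2) *\<^sub>R mat3 0 0 0 0 0 0 1 0 0)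
      has_vector_derivative (mat3 0 0 0 1 0 0 0 1 0 + r *\<^sub>R mat3 0 0 0 0 0 0 1 0 0)) (at r)"
    unfolding has_vector_derivative_def
    by (auto intro!: derivative_eq_intros simp: scaleR_add_right algebra_simps)
  then show ?thesis unfolding eq
    by (rule back_subst[where P="\<lambda>d. (_ has_vector_derivative d) _"]) (simp add: matrix3_simps)
qed

lemma has_vector_derivative_al3:
  "(al3 has_vector_derivative diag3 (exp s) 0 (- exp (- s))) (at s)"
proof -
  have eq: "al3 = (\<lambda>s. diag3 0 1 0 + exp s *\<^sub>R diag3 1 0 0 + exp (- s) *\<^sub>R diag3 0 0 1)"
    by (simp add: fun_eq_iff al3_def matrix3_simps)
  have "((\<lambda>s. diag3 0 1 0 + exp s *\<^sub>R diag3 1 0 0 + exp (- s) *\<^sub>R diag3 0 0 1)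
      has_vector_derivative (exp s *\<^sub>R diag3 1 0 0 + (- exp (- s)) *\<^sub>R diag3 0 0 1)) (at s)"
    unfolding has_vector_derivative_def
    by (auto intro!: derivative_eq_intros simp: scaleR_add_right algebra_simps)
  then show ?thesis unfolding eq
    by (rule back_subst[where P="\<lambda>d. (_ has_vector_derivative d) _"]) (simp add: matrix3_simps)
qed

lemma C1_curve_one_parameter:
  fixes f f' :: "real \<Rightarrow> real^3^3"
  assumes d: "\<And>s. (f has_vector_derivative f' s) (at s)" and c: "continuous_on UNIV f'"
    and inv: "\<And>s. f s ** f (- s) = mat 1" and S: "\<And>s. f s \<in> S"
    and M: "\<And>s. \<bar>s\<bar> \<le> R \<Longrightarrow> norm (f s) \<le> M" "\<And>s. \<bar>s\<bar> \<le> R \<Longrightarrow> norm (f' s) \<le> M"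
    and r: "\<bar>r\<bar> \<le> R" "\<bar>r'\<bar> \<le> R"
  shows "C1_curve S M (M * \<bar>r - r'\<bar>) (f r') (f r)"
proof -
  define g where "g t = r' + t * (r - r')" for t
  have g: "\<bar>g t\<bar> \<le> R" if "t \<in> {0..1}" for t
  proof -
    have "g t = (1 - t) * r' + t * r" by (simp add: g_def algebra_simps)
    also have "\<bar>\<dots>\<bar> \<le> (1 - t) * \<bar>r'\<bar> + t * \<bar>r\<bar>"
      using that by (intro order_trans[OF abs_triangle_ineq]) (simp add: abs_mult)
    also have "\<dots> \<le> (1 - t) * R + t * R" using that r by (intro add_mono mult_left_mono) auto
    finally show ?thesis by (simp add: algebra_simps)
  qed
  have cf: "continuous_on UNIV f"
    using d by (meson continuous_at_imp_continuous_on has_vector_derivative_continuous)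
  have cg: "continuous_on UNIV g" unfolding g_def by (intro continuous_intros)
  have dg: "(g has_vector_derivative (r - r')) (at t)" for t
    unfolding g_def has_real_derivative_iff_has_vector_derivative[symmetric]
    by (auto intro!: derivative_eq_intros)
  show ?thesis unfolding C1_curve_def
  proof (rule exI[of _ "\<lambda>t. f (g t)"], rule exI[of _ "\<lambda>t. (r - r') *\<^sub>R f' (g t)"],
      rule exI[of _ "\<lambda>t. f (- g t)"], intro conjI allI ballI)
    show "((\<lambda>t. f (g t)) has_vector_derivative (r - r') *\<^sub>R f' (g t)) (at t)" for t
      using vector_diff_chain_at[OF dg d] by (simp add: o_def)
    show "f (g t) ** f (- g t) = mat 1" for t by (rule inv)
    show "continuous_on UNIV (\<lambda>t. (r - r') *\<^sub>R f' (g t))"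
      by (intro continuous_on_scaleR continuous_on_const continuous_on_compose2[OF c cg]) auto
    show "continuous_on UNIV (\<lambda>t. f (- g t))"
      by (intro continuous_on_compose2[OF cf] continuous_on_minus cg) auto
    fix t :: real assume t: "t \<in> {0..1}"
    show "norm (f (g t)) \<le> M" by (rule M(1)[OF g[OF t]])
    show "norm (f (- g t)) \<le> M" by (rule M(1)) (simp add: g[OF t])
    show "norm ((r - r') *\<^sub>R f' (g t)) \<le> M * \<bar>r - r'\<bar>"
      using mult_left_mono[OF M(2)[OF g[OF t]], of "\<bar>r - r'\<bar>"] by (simp add: mult.commute)
  qed (simp_all add: S g_def)
qed

lemma exp_ge_quadratic: "0 \<le> x \<Longrightarrow> 1 + x + x\<^sup>2 / 2 \<le> exp (x::real)"
  using exp_lower_Taylor_quadratic by blast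

lemma norm_le_9:
  "norm (mat3 a b c d e f g h i) \<le> \<bar>a\<bar> + \<bar>b\<bar> + \<bar>c\<bar> + \<bar>d\<bar> + \<bar>e\<bar> + \<bar>f\<bar> + \<bar>g\<bar> + \<bar>h\<bar> + \<bar>i\<bar>"
  by (rule order_trans[OF norm_le_sum_entries]) (simp add: sum_3)

text \<open>The norm is at most the sum of the absolute entries, and
  \<open>1 + R + R\<^sup>2/2 \<le> exp R\<close>; the constant 3 is chosen to serve all six
  matrices.\<close>

lemma one_parameter_bounds:
  assumes "\<bar>s\<bar> \<le> R"
  shows "norm (up3 s) \<le> 3 * exp R" "norm (mat3 0 1 s 0 0 1 0 0 0) \<le> 3 * exp R"
    "norm (lo3 s) \<le> 3 * exp R" "norm (mat3 0 0 0 1 0 0 s 1 0) \<le> 3 * exp R"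
    "norm (al3 s) \<le> 3 * exp R" "norm (diag3 (exp s) 0 (- exp (- s))) \<le> 3 * exp R"
proof -
  have R: "0 \<le> R" using assms by linarith
  have e: "1 + R + R\<^sup>2/2 \<le> exp R" by (rule exp_ge_quadratic[OF R])
  have s2: "s\<^sup>2 \<le> R\<^sup>2" using assms by (metis abs_le_square_iff abs_of_nonneg R)
  have se: "exp s \<le> exp R" "exp (- s) \<le> exp R" "1 \<le> exp R" using assms R by auto
  have R2: "0 \<le> R\<^sup>2" "0 \<le> s\<^sup>2" by simp_all
  have up: "3 + (2 * \<bar>s\<bar> + s\<^sup>2 / 2) \<le> 3 * exp R" "2 + \<bar>s\<bar> \<le> 3 * exp R"
    using assms e s2 R R2 by linarith+
  have al: "exp s + 1 + exp (- s) \<le> 3 * exp R" "exp s + exp (- s) \<le> 3 * exp R"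
    using se by linarith+
  show "norm (up3 s) \<le> 3 * exp R"
    unfolding up3_def by (rule order_trans[OF norm_le_9]) (use up in simp)
  show "norm (mat3 0 1 s 0 0 1 0 0 0) \<le> 3 * exp R"
    by (rule order_trans[OF norm_le_9]) (use up in simp)
  show "norm (lo3 s) \<le> 3 * exp R"
    unfolding lo3_def by (rule order_trans[OF norm_le_9]) (use up in simp)
  show "norm (mat3 0 0 0 1 0 0 s 1 0) \<le> 3 * exp R"
    by (rule order_trans[OF norm_le_9]) (use up in simp)
  show "norm (al3 s) \<le> 3 * exp R"
    unfolding al3_def diag3_eq by (rule order_trans[OF norm_le_9]) (use al in simp)
  show "norm (diag3 (exp s) 0 (- exp (- s))) \<le> 3 * exp R"
    unfolding diag3_eq by (rule order_trans[OF norm_le_9]) (use al in simp)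
qed

lemma one_parameter_inverse:
  "up3 s ** up3 (- s) = mat 1" "lo3 s ** lo3 (- s) = mat 1" "al3 s ** al3 (- s) = mat 1"
  by (simp_all add: up3_def lo3_def al3_def matrix3_simps power2_eq_square exp_add[symmetric])

lemma one_parameter_curves:
  assumes "\<bar>r\<bar> \<le> R" "\<bar>r'\<bar> \<le> R"
  shows "C1_curve SOF (3 * exp R) (3 * exp R * \<bar>r - r'\<bar>) (up3 r') (up3 r)"
    "C1_curve SOF (3 * exp R) (3 * exp R * \<bar>r - r'\<bar>) (lo3 r') (lo3 r)"
    "C1_curve SOF (3 * exp R) (3 * exp R * \<bar>r - r'\<bar>) (al3 r') (al3 r)"
proof -
  show "C1_curve SOF (3 * exp R) (3 * exp R * \<bar>r - r'\<bar>) (up3 r') (up3 r)"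
    by (rule C1_curve_one_parameter[OF has_vector_derivative_up3 _ one_parameter_inverse(1) up3_SOF
          one_parameter_bounds(1,2) assms]) (intro continuous_intros)
  show "C1_curve SOF (3 * exp R) (3 * exp R * \<bar>r - r'\<bar>) (lo3 r') (lo3 r)"
    by (rule C1_curve_one_parameter[OF has_vector_derivative_lo3 _ one_parameter_inverse(2) lo3_SOF
          one_parameter_bounds(3,4) assms]) (intro continuous_intros)
  show "C1_curve SOF (3 * exp R) (3 * exp R * \<bar>r - r'\<bar>) (al3 r') (al3 r)"
    by (rule C1_curve_one_parameter[OF has_vector_derivative_al3 _ one_parameter_inverse(3) al3_SOF
          one_parameter_bounds(5,6) assms]) (auto simp: diag3_eq intro!: continuous_intros)
qed

text \<open>This set serves to show that any two points of the group are joined by some path with a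
  length. Without that, \<open>riem_dist\<close> would be the unspecified infimum of the empty
  set.\<close>

definition C1_reachable :: "(real^3^3) set \<Rightarrow> (real^3^3) set" where
  "C1_reachable S = {g. \<exists>M N. C1_curve S M N (mat 1) g}"

lemma C1_reachable_mult:
  assumes "g \<in> C1_reachable S" "h \<in> C1_reachable S" "\<And>a b. a \<in> S \<Longrightarrow> b \<in> S \<Longrightarrow> a ** b \<in> S"
  shows "g ** h \<in> C1_reachable S"
proof -
  obtain M1 N1 M2 N2 where "C1_curve S M1 N1 (mat 1) g" "C1_curve S M2 N2 (mat 1) h"
    using assms(1,2) unfolding C1_reachable_def by blast
  from C1_curve_mult[OF this assms(3)] show ?thesis
    unfolding C1_reachable_def by (auto simp: matrix_mul_lid)
qed

lemma SOF_reachable: assumes "g \<in> SOF" shows "g \<in> C1_reachable SOF"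
proof -
  obtain e b a s where g: "g = up3 e ** (lo3 b ** up3 a ** al3 s)"
    using assms SOF_decomp unfolding SOF_iff by metis
  have 0: "up3 0 = mat 1" "lo3 0 = mat 1" "al3 0 = mat 1"
    by (simp_all add: up3_def lo3_def al3_def matrix3_simps)
  have r: "up3 r \<in> C1_reachable SOF" "lo3 r \<in> C1_reachable SOF" "al3 r \<in> C1_reachable SOF" for r
    using one_parameter_curves[of r "\<bar>r\<bar>" 0] unfolding C1_reachable_def 0 by auto
  show ?thesis unfolding g by (intro C1_reachable_mult r SOF_mult)
qed

lemma riem_len_exists:
  assumes "h \<in> C1_reachable S" "x \<in> S"
    and mult: "\<And>a b. a \<in> S \<Longrightarrow> b \<in> S \<Longrightarrow> a ** b \<in> S" and det: "\<And>a. a \<in> S \<Longrightarrow> det a = 1"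
  shows "\<exists>l. riem_len S x (x ** h) l"
proof -
  obtain M N where "C1_curve S M N (mat 1) h" using assms(1) unfolding C1_reachable_def by blast
  then obtain l where "riem_len S (mat 1) h l" by (rule C1_curve_riem_len)
  from riem_len_translate[OF this assms(2) mult det] show ?thesis by (auto simp: matrix_mul_rid)
qed

section \<open>Transvections and connectedness of \<open>SL3\<close> by paths\<close>

definition elm :: "3 \<Rightarrow> 3 \<Rightarrow> real \<Rightarrow> real^3^3" where
  "elm i j c = mat 1 + c *\<^sub>R (\<chi> k l. if k = i \<and> l = j then 1 else 0)"

lemma elm_mult_nth: "(elm i j c ** g)$k$l = g$k$l + (if k = i then c * g$j$l else 0)"
proof -
  define E :: "real^3^3" where "E = (\<chi> k l. if k = i \<and> l = j then 1 else 0)"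
  have "elm i j c ** g = g + c *\<^sub>R (E ** g)"
    unfolding elm_def E_def[symmetric]
    by (simp add: bounded_bilinear.add_left[OF bounded_bilinear_matrix_mult]
        bounded_bilinear.scaleR_left[OF bounded_bilinear_matrix_mult])
  moreover have "(E ** g)$k$l = (if k = i then g$j$l else 0)"
  proof (cases "k = i")
    case True
    have "(E ** g)$k$l = (\<Sum>m\<in>UNIV. (if m = j then 1 else 0) * g$m$l)"
      by (simp add: matrix_matrix_mult_def E_def True)
    also have "\<dots> = (\<Sum>m\<in>UNIV. if m = j then g$m$l else 0)" by (rule sum.cong) auto
    finally show ?thesis using True by simp
  qed (simp add: matrix_matrix_mult_def E_def)
  ultimately show ?thesis by simp
qed

lemma elm_inverse: "i \<noteq> j \<Longrightarrow> elm i j c ** elm i j (- c) = mat 1"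
  unfolding vec_eq_iff elm_mult_nth by (auto simp: elm_def mat_def)

lemma det_elm: "i \<noteq> j \<Longrightarrow> det (elm i j c) = 1"
  using exhaust_3[of i] exhaust_3[of j] by (auto simp: det_3 elm_def mat3_one_nth)

lemma carrier_SL3 [simp]: "carrier SL3 = {A. det A = 1}"
  by (simp add: SL3_def)

lemma elm_reachable:
  assumes "i \<noteq> j" shows "elm i j c \<in> C1_reachable {A. det A = 1}"
proof -
  define E :: "real^3^3" where "E = (\<chi> k l. if k = i \<and> l = j then 1 else 0)"
  have "C1_curve {A. det A = 1} (norm (mat 1 :: real^3^3) + (\<bar>c\<bar> + 1) * norm E)
     ((norm (mat 1 :: real^3^3) + (\<bar>c\<bar> + 1) * norm E) * \<bar>c - 0\<bar>) (elm i j 0) (elm i j c)"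
  proof (rule C1_curve_one_parameter[where R = "\<bar>c\<bar>" and f' = "\<lambda>_. E"])
    show "(elm i j has_vector_derivative E) (at s)" for s
    proof -
      have eq: "elm i j = (\<lambda>c. mat 1 + c *\<^sub>R E)" by (simp add: fun_eq_iff elm_def E_def)
      show ?thesis unfolding eq has_vector_derivative_def by (auto intro!: derivative_eq_intros)
    qed
    show "elm i j s ** elm i j (- s) = mat 1" for s by (rule elm_inverse[OF assms])
    show "elm i j s \<in> {A. det A = 1}" for s using det_elm[OF assms] by simp
    fix s :: real assume s: "\<bar>s\<bar> \<le> \<bar>c\<bar>"
    have "norm (elm i j s) \<le> norm (mat 1 :: real^3^3) + \<bar>s\<bar> * norm E"
      unfolding elm_def E_def[symmetric] by (rule order_trans[OF norm_triangle_ineq]) simp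
    also have "\<dots> \<le> norm (mat 1 :: real^3^3) + (\<bar>c\<bar> + 1) * norm E"
      using s by (intro add_left_mono mult_right_mono) auto
    finally show "norm (elm i j s) \<le> norm (mat 1 :: real^3^3) + (\<bar>c\<bar> + 1) * norm E" .
    show "norm E \<le> norm (mat 1 :: real^3^3) + (\<bar>c\<bar> + 1) * norm E"
      by (simp add: algebra_simps)
  qed auto
  moreover have "elm i j 0 = mat 1" by (simp add: elm_def)
  ultimately show ?thesis unfolding C1_reachable_def by auto
qed

lemma SL3_reachable_step:
  assumes "i \<noteq> j" "elm i j c ** g \<in> C1_reachable {A. det A = 1}"
  shows "g \<in> C1_reachable {A. det A = 1}"
proof -
  have "elm i j (- c) ** (elm i j c ** g) \<in> C1_reachable {A. det A = 1}"
    by (intro C1_reachable_mult elm_reachable assms) (auto simp: det_mul)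
  moreover have "elm i j (- c) ** elm i j c = mat 1" using elm_inverse[OF assms(1), of "- c"] by simp
  ultimately show ?thesis by (simp add: matrix_mul_assoc)
qed

lemma SL3_reachable_one: "mat 1 \<in> C1_reachable {A :: real^3^3. det A = 1}"
  using elm_reachable[of 1 2 0] by (simp add: elm_def)

lemma det_elm_mult: "i \<noteq> j \<Longrightarrow> det (elm i j c ** g) = det g"
  by (simp add: det_mul det_elm)

text \<open>Gaussian elimination, column by column.\<close>

lemma SL3_reachable_lower_corner:
  assumes "det g = 1" "g$1$1 = 1" "g$2$1 = 0" "g$3$1 = 0" "g$2$2 = 1"
  shows "g \<in> C1_reachable {A. det A = 1}"
proof (rule SL3_reachable_step[of 3 2 "- g$3$2"])
  define a where "a = elm 3 2 (- g$3$2) ** g"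
  have a: "a$1$1 = 1" "a$2$1 = 0" "a$3$1 = 0" "a$2$2 = 1" "a$3$2 = 0" "det a = 1"
    using assms by (simp_all add: a_def elm_mult_nth det_elm_mult)
  then have a33: "a$3$3 = 1" by (simp add: det_3)
  have "elm 1 3 (- a$1$3) ** (elm 1 2 (- a$1$2) ** (elm 2 3 (- a$2$3) ** a)) = mat 1"
    unfolding matrix3_eq_iff elm_mult_nth mat3_one_nth using a a33 by simp
  then have b: "elm 1 3 (- a$1$3) ** (elm 1 2 (- a$1$2) ** (elm 2 3 (- a$2$3) ** a))
      \<in> C1_reachable {A. det A = 1}" by (simp only: SL3_reachable_one)
  show "elm 3 2 (- g$3$2) ** g \<in> C1_reachable {A. det A = 1}"
    unfolding a_def[symmetric]
    by (rule SL3_reachable_step[OF _ SL3_reachable_step[OF _ SL3_reachable_step[OF _ b]]]) simp_all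
qed simp

text \<open>Transvections cannot rescale a pivot. A nonzero entry below it is used to turn it into
  1; if that entry vanishes, the pivot is nonzero by the determinant and its row is first added to
  the lower one. \<open>SL3_reachable\<close> repeats this in the first column.\<close>

lemma SL3_reachable_first_column:
  assumes "det g = 1" "g$1$1 = 1" "g$2$1 = 0" "g$3$1 = 0"
  shows "g \<in> C1_reachable {A. det A = 1}"
proof -
  have *: "g \<in> C1_reachable {A. det A = 1}"
    if "det g = 1" "g$1$1 = 1" "g$2$1 = 0" "g$3$1 = 0" "g$3$2 \<noteq> 0" for g
    by (rule SL3_reachable_step[of 2 3 "(1 - g$2$2) / g$3$2"], simp, rule SL3_reachable_lower_corner)
      (use that in \<open>simp_all add: elm_mult_nth det_elm_mult\<close>)
  show ?thesis
  proof (cases "g$3$2 = 0")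
    case True
    then have "g$2$2 \<noteq> 0" using assms by (auto simp: det_3)
    show ?thesis
      by (rule SL3_reachable_step[of 3 2 1], simp, rule *)
        (use True assms \<open>g$2$2 \<noteq> 0\<close> in \<open>simp_all add: elm_mult_nth det_elm_mult\<close>)
  qed (rule *[OF assms])
qed

lemma SL3_reachable:
  assumes "det g = 1" shows "g \<in> C1_reachable {A. det A = 1}"
proof -
  have A: "g \<in> C1_reachable {A. det A = 1}" if "det g = 1" "g$1$1 = 1" for g
    by (rule SL3_reachable_step[of 2 1 "- g$2$1"], simp, rule SL3_reachable_step[of 3 1 "- g$3$1"], simp,
        rule SL3_reachable_first_column)
      (use that in \<open>simp_all add: elm_mult_nth det_elm_mult\<close>)
  have B: "g \<in> C1_reachable {A. det A = 1}" if "det g = 1" "g$2$1 \<noteq> 0" for g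
    by (rule SL3_reachable_step[of 1 2 "(1 - g$1$1) / g$2$1"], simp, rule A)
      (use that in \<open>simp_all add: elm_mult_nth det_elm_mult\<close>)
  have C: "g \<in> C1_reachable {A. det A = 1}" if "det g = 1" "g$3$1 \<noteq> 0" for g
    by (rule SL3_reachable_step[of 1 3 "(1 - g$1$1) / g$3$1"], simp, rule A)
      (use that in \<open>simp_all add: elm_mult_nth det_elm_mult\<close>)
  show ?thesis
  proof (cases "g$2$1 = 0 \<and> g$3$1 = 0")
    case True
    then have "g$1$1 \<noteq> 0" using assms by (auto simp: det_3)
    show ?thesis
      by (rule SL3_reachable_step[of 2 1 1], simp, rule B)
        (use True assms \<open>g$1$1 \<noteq> 0\<close> in \<open>simp_all add: elm_mult_nth det_elm_mult\<close>)
  qed (use B[OF assms] C[OF assms] in blast)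
qed

lemma SOF_det: "g \<in> SOF \<Longrightarrow> det g = 1"
  using SOF_subset_SOJ by (auto simp: SOJ_def)

lemma H_riem_len_exists: assumes "x \<in> SOF" "y \<in> SOF" shows "\<exists>l. riem_len SOF x y l"
proof -
  have J: "x \<in> SOJ" using assms SOF_subset_SOJ by blast
  have "\<exists>l. riem_len SOF x (x ** (hinv x ** y)) l"
    by (rule riem_len_exists) (auto intro: SOF_reachable SOF_mult hinv_SOF SOF_det assms)
  then show ?thesis using hinv_right[OF J] by (simp add: matrix_mul_assoc)
qed

lemma G_riem_len_exists: assumes "det x = 1" "det y = 1" shows "\<exists>l. riem_len {A. det A = 1} x y l"
proof -
  have "\<exists>l. riem_len {A. det A = 1} x (x ** (matrix_inv x ** y)) l"
    by (rule riem_len_exists)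
      (auto intro!: SL3_reachable simp: det_mul det_one_inverse(3) assms)
  then show ?thesis using det_one_inverse(1)[OF assms(1)] by (simp add: matrix_mul_assoc)
qed

section \<open>Comparison of Riemannian and Euclidean distances\<close>

lemma dist_le_H_dist:
  assumes "x \<in> SOF" "y \<in> SOF" "norm x \<le> R" "norm y \<le> R" "0 < R"
  shows "dist x y \<le> 4 * R * H_dist x y"
proof -
  obtain l where "riem_len SOF x y l" using H_riem_len_exists assms by blast
  then show ?thesis unfolding H_dist_def dist_norm
    by (rule norm_le_riem_dist[rotated]) (use assms SOF_det in auto)
qed

lemma dist_le_G_dist:
  assumes "det x = 1" "det y = 1" "norm x \<le> R" "norm y \<le> R" "0 < R"
  shows "dist x y \<le> 4 * R * G_dist x y"
proof -
  obtain l where "riem_len {A. det A = 1} x y l" using G_riem_len_exists assms by blast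
  then show ?thesis unfolding G_dist_def dist_norm carrier_SL3
    by (rule norm_le_riem_dist[rotated]) (use assms in auto)
qed

lemma H_dist_nonneg: "x \<in> SOF \<Longrightarrow> y \<in> SOF \<Longrightarrow> 0 \<le> H_dist x y"
  unfolding H_dist_def using H_riem_len_exists riem_dist_nonneg by blast

lemma G_dist_nonneg: "det x = 1 \<Longrightarrow> det y = 1 \<Longrightarrow> 0 \<le> G_dist x y"
  unfolding G_dist_def carrier_SL3 using G_riem_len_exists riem_dist_nonneg by blast

lemma H_dist_le: "C1_curve SOF M N x y \<Longrightarrow> H_dist x y \<le> M * N"
  unfolding H_dist_def by (metis C1_curve_riem_len riem_dist_le order_trans)

lemma G_dist_le: "C1_curve {A. det A = 1} M N x y \<Longrightarrow> G_dist x y \<le> M * N"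
  unfolding G_dist_def carrier_SL3 by (metis C1_curve_riem_len riem_dist_le order_trans)

lemma abs_ln_le:
  fixes u :: real
  assumes "1/2 \<le> u" shows "\<bar>ln u\<bar> \<le> 2 * \<bar>u - 1\<bar>"
proof -
  have u: "0 < u" using assms by simp
  have 1: "ln u \<le> u - 1" using u by (rule ln_le_minus_one)
  have "ln (1 / u) \<le> 1 / u - 1" using u by (intro ln_le_minus_one) simp
  then have "- ln u \<le> (1 - u) / u" using u by (simp add: ln_div diff_divide_distrib)
  also have "\<dots> \<le> \<bar>u - 1\<bar> / u" using u by (intro divide_right_mono) auto
  also have "\<dots> \<le> \<bar>u - 1\<bar> / (1/2)" using assms by (intro divide_left_mono) auto
  finally have "- ln u \<le> 2 * \<bar>u - 1\<bar>" by simp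
  moreover have "ln u \<le> 2 * \<bar>u - 1\<bar>"
  proof -
    have "ln u \<le> \<bar>u - 1\<bar>" using 1 abs_ge_self by (rule order_trans)
    also have "\<dots> \<le> 2 * \<bar>u - 1\<bar>" by simp
    finally show ?thesis .
  qed
  ultimately show ?thesis by (simp add: abs_le_iff)
qed

text \<open>In the open cell the three coordinates of \<open>x\<close> are at most 2, 1 and 2 times
  \<open>norm (x - mat 1)\<close>, hence the 5; each of the three factors contributes
  \<open>3 * exp 1\<close>.\<close>

lemma C1_curve_near_one:
  assumes x: "x \<in> SOJ" "norm (x - mat 1) \<le> 1/2"
  shows "C1_curve SOF ((3 * exp 1) ^ 3) ((3 * exp 1) ^ 3 * (5 * norm (x - mat 1))) (mat 1) x"
proof -
  define \<xi> where "\<xi> = x - mat 1"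
  define M where "M = 3 * exp (1::real)"
  have en: "\<bar>\<xi>$i$j\<bar> \<le> norm \<xi>" for i j by (rule abs_entry_le_norm)
  have x11: "\<bar>x$1$1 - 1\<bar> \<le> norm \<xi>" and x12: "\<bar>x$1$2\<bar> \<le> norm \<xi>" and x21: "\<bar>x$2$1\<bar> \<le> norm \<xi>"
    using en[of 1 1] en[of 1 2] en[of 2 1] by (simp_all add: \<xi>_def mat3_one_nth)
  have half: "1/2 \<le> x$1$1" using x11 x(2) by (simp add: \<xi>_def)
  define b a s where "b = x$2$1 / x$1$1" and "a = x$1$2" and "s = ln (x$1$1)"
  have eq: "x = lo3 b ** up3 a ** al3 s"
    unfolding b_def a_def s_def by (rule SOJ_chart[OF x(1)]) (use half in simp)
  have b: "\<bar>b\<bar> \<le> 2 * norm \<xi>"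
  proof -
    have "\<bar>b\<bar> \<le> \<bar>x$2$1\<bar> / (1/2)" unfolding b_def abs_divide
      using half by (intro divide_left_mono) auto
    then show ?thesis using x21 by simp
  qed
  have a: "\<bar>a\<bar> \<le> norm \<xi>" using x12 by (simp add: a_def)
  have s: "\<bar>s\<bar> \<le> 2 * norm \<xi>" using abs_ln_le[OF half] x11 by (simp add: s_def)
  have le1: "\<bar>b\<bar> \<le> 1" "\<bar>a\<bar> \<le> 1" "\<bar>s\<bar> \<le> 1" using a b s x(2) by (simp_all add: \<xi>_def)
  have 0: "up3 0 = mat 1" "lo3 0 = mat 1" "al3 0 = mat 1"
    by (simp_all add: up3_def lo3_def al3_def matrix3_simps)
  note c = one_parameter_curves[of _ 1 0, unfolded 0, folded M_def, simplified]
  have "C1_curve SOF (M * M * M) (M * M * (M * \<bar>s\<bar>) + (M * (M * \<bar>a\<bar>) + M * \<bar>b\<bar> * M) * M)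
     (mat 1 ** mat 1 ** mat 1) (lo3 b ** up3 a ** al3 s)"
    by (intro C1_curve_mult c le1 SOF_mult)
  then have "C1_curve SOF (M * M * M) (M * M * (M * \<bar>s\<bar>) + (M * (M * \<bar>a\<bar>) + M * \<bar>b\<bar> * M) * M) (mat 1) x"
    unfolding eq[symmetric] by simp
  then show ?thesis
  proof (rule C1_curve_mono)
    have "M * M * (M * \<bar>s\<bar>) + (M * (M * \<bar>a\<bar>) + M * \<bar>b\<bar> * M) * M = M ^ 3 * (\<bar>s\<bar> + \<bar>a\<bar> + \<bar>b\<bar>)"
      by (simp add: power3_eq_cube algebra_simps)
    also have "\<dots> \<le> M ^ 3 * (5 * norm \<xi>)"
      using a b s by (intro mult_left_mono) (auto simp: M_def)
    finally show "M * M * (M * \<bar>s\<bar>) + (M * (M * \<bar>a\<bar>) + M * \<bar>b\<bar> * M) * M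
        \<le> (3 * exp 1) ^ 3 * (5 * norm (x - mat 1))" by (simp add: M_def \<xi>_def)
  qed (auto simp: M_def power3_eq_cube)
qed

lemma norm_hinv_mult_diff:
  assumes "z' \<in> SOJ" shows "norm (hinv z' ** z - mat 1) \<le> norm z' * norm (z - z')"
proof -
  have "hinv z' ** z - mat 1 = hinv z' ** (z - z')"
    using hinv_left[OF assms] by (simp add: matrix_diff_right)
  then show ?thesis using norm_matrix_mult_le[of "hinv z'" "z - z'"] by (simp add: norm_hinv)
qed

text \<open>A curve from 1 to \<open>hinv z' ** z\<close>, multiplied on the left by
  \<open>z'\<close>, runs from \<open>z'\<close> to \<open>z\<close>. This yields the upper bounds
  of Riemannian by Euclidean distances.\<close>

lemma C1_curve_local:
  assumes "z0 \<in> SOF"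
  shows "\<exists>U C. open U \<and> z0 \<in> U \<and> 0 \<le> C \<and>
    (\<forall>z\<in>SOF \<inter> U. \<forall>z'\<in>SOF \<inter> U. C1_curve SOF C (C * dist z z') z' z)"
proof -
  define R where "R = norm z0 + 1"
  \<comment> \<open>Makes \<open>norm (hinv z' ** z - mat 1) \<le> R * (2 * \<delta>) \<le>
    1/2\<close>, the range of \<open>C1_curve_near_one\<close>.\<close>
  define \<delta> where "\<delta> = min 1 (1 / (4 * R))"
  define K where "K = (3 * exp (1::real)) ^ 3"
  have R: "1 \<le> R" by (simp add: R_def)
  have d: "0 < \<delta>" "\<delta> \<le> 1" "R * (2 * \<delta>) \<le> 1/2" using R by (auto simp: \<delta>_def min_def field_simps)
  have K: "0 \<le> K" by (simp add: K_def)
  have "C1_curve SOF (5 * R * R * K) (5 * R * R * K * dist z z') z' z"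
    if z: "z \<in> SOF" "z \<in> ball z0 \<delta>" and z': "z' \<in> SOF" "z' \<in> ball z0 \<delta>" for z z'
  proof -
    have J: "z \<in> SOJ" "z' \<in> SOJ" using z z' SOF_subset_SOJ by auto
    have nz: "norm z' \<le> R" using z' d norm_triangle_ineq2[of z' z0]
      by (simp add: R_def dist_norm norm_minus_commute)
    have dd: "norm (z - z') \<le> 2 * \<delta>" using z(2) z'(2) dist_triangle_half_r[of z0 z "2*\<delta>" z'] by (simp add: dist_norm)
    define x where "x = hinv z' ** z"
    have xJ: "x \<in> SOJ" unfolding x_def by (intro SOJ_mult hinv_SOJ J)
    have "norm (x - mat 1) \<le> norm z' * norm (z - z')" unfolding x_def by (rule norm_hinv_mult_diff[OF J(2)])
    also have "\<dots> \<le> R * norm (z - z')" by (intro mult_right_mono nz) simp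
    finally have x1: "norm (x - mat 1) \<le> R * norm (z - z')" .
    also have "\<dots> \<le> R * (2 * \<delta>)" using R by (intro mult_left_mono dd) simp
    finally have x2: "norm (x - mat 1) \<le> 1/2" using d by linarith
    have c: "C1_curve SOF R 0 z' z'"
      by (rule C1_curve_const[OF z'(1) hinv_right[OF J(2)] nz]) (simp add: norm_hinv nz)
    have "C1_curve SOF (R * K) (R * (K * (5 * norm (x - mat 1))) + 0 * K) (z' ** mat 1) (z' ** x)"
      unfolding K_def by (intro C1_curve_mult[OF c] C1_curve_near_one xJ x2 SOF_mult)
    moreover have "z' ** x = z"
      using hinv_right[OF J(2)] by (simp add: x_def matrix_mul_assoc)
    ultimately have "C1_curve SOF (R * K) (R * (K * (5 * norm (x - mat 1))) + 0 * K) z' z"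
      by simp
    then show ?thesis
    proof (rule C1_curve_mono)
      show "R * K \<le> 5 * R * R * K" using R K by (intro mult_right_mono) auto
      have "R * (K * (5 * norm (x - mat 1))) \<le> R * (K * (5 * (R * norm (z - z'))))"
        using R K x1 by (intro mult_left_mono) auto
      then show "R * (K * (5 * norm (x - mat 1))) + 0 * K \<le> 5 * R * R * K * dist z z'"
        by (simp add: dist_norm algebra_simps)
    qed simp
  qed
  then show ?thesis using d R K
    by (intro exI[of _ "ball z0 \<delta>"] exI[of _ "5 * R * R * K"]) auto
qed

text \<open>The two distances are comparable only on bounded, respectively small, sets, with
  constants growing with the norm. Since nullness is local, this suffices.\<close>

lemma hausdorff_null_H_dist_iff:
  assumes A: "A \<subseteq> SOF" and s: "0 < s"
  shows "hausdorff_null H_dist s A \<longleftrightarrow> hausdorff_null dist s A"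
proof
  assume n: "hausdorff_null H_dist s A"
  have "hausdorff_null dist s ((\<lambda>x. x) ` A)"
  proof (rule hausdorff_null_local_image)
    fix z assume "z \<in> A"
    have "hausdorff_null dist s ((\<lambda>x. x) ` (A \<inter> ball z 1))"
    proof (rule hausdorff_null_lipschitz_image[OF hausdorff_null_subset[OF n], where C = "4 * (norm z + 1)"])
      fix x y assume xy: "x \<in> A \<inter> ball z 1" "y \<in> A \<inter> ball z 1"
      have "norm x \<le> norm z + 1" "norm y \<le> norm z + 1"
        using xy norm_triangle_ineq2[of x z] norm_triangle_ineq2[of y z]
        by (auto simp: dist_norm norm_minus_commute)
      then show "dist x y \<le> 4 * (norm z + 1) * H_dist x y"
        using xy A by (intro dist_le_H_dist) (auto simp: add_nonneg_pos)
    qed (use s in auto)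
    then show "\<exists>U. open U \<and> z \<in> U \<and> hausdorff_null dist s ((\<lambda>x. x) ` (A \<inter> U))"
      by (intro exI[of _ "ball z 1"]) simp
  qed
  then show "hausdorff_null dist s A" by simp
next
  assume n: "hausdorff_null dist s A"
  have "hausdorff_null H_dist s ((\<lambda>x. x) ` A)"
  proof (rule hausdorff_null_locally_lipschitz_image[OF n])
    fix z assume "z \<in> A"
    then obtain U C where U: "open U" "z \<in> U" "0 \<le> C"
      "\<And>x y. x \<in> SOF \<inter> U \<Longrightarrow> y \<in> SOF \<inter> U \<Longrightarrow> C1_curve SOF C (C * dist x y) y x"
      using C1_curve_local[of z] A by blast
    have "H_dist x y \<le> C * C * dist x y" if "x \<in> A \<inter> U" "y \<in> A \<inter> U" for x y
      using H_dist_le[OF U(4)[of y x]] that A by (auto simp: dist_commute mult.assoc)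
    then show "\<exists>U C. open U \<and> z \<in> U \<and> 0 \<le> C \<and>
        (\<forall>x\<in>A \<inter> U. \<forall>y\<in>A \<inter> U. H_dist x y \<le> C * dist x y)"
      using U by (intro exI[of _ U] exI[of _ "C * C"]) auto
  qed (use s in simp)
  then show "hausdorff_null H_dist s A" by simp
qed

section \<open>Local expansion of the orbit maps\<close>

lemma a_mat_eq: "a_mat t = mat3 (exp t) 0 0 0 (exp (- 2 * t)) 0 0 0 (exp t)"
  by (simp add: a_mat_def diag3_eq)

lemma a_mat_inverse: "a_mat t ** a_mat (- t) = mat 1"
  by (simp add: a_mat_eq matrix3_simps exp_add[symmetric])

lemma det_a_mat: "det (a_mat t) = 1"
  by (simp add: a_mat_eq det_3 exp_add[symmetric])

lemma a_mat_al3: "a_mat t ** al3 s = al3 s ** a_mat t"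
  by (simp add: a_mat_eq al3_def matrix3_simps mult.commute)

lemma transpose_a_mat: "transpose (a_mat t) = a_mat t"
  by (simp add: a_mat_eq matrix3_simps)

lemma exp_2_ne: "t \<noteq> 0 \<Longrightarrow> exp (2 * t) \<noteq> exp (- 4 * t :: real)" "t \<noteq> 0 \<Longrightarrow> exp t \<noteq> exp (- 2 * t)"
  by auto

lemma norm_pair_le: "norm (a, b) \<le> norm a + norm b"
  unfolding norm_Pair by (rule sqrt_sum_squares_le_sum) auto

lemma norm_fst_le': "norm a \<le> norm (a, b)" and norm_snd_le': "norm b \<le> norm (a, b)"
  unfolding norm_Pair by (auto simp: real_le_rsqrt)

text \<open>Putting \<open>x = 1 + \<xi>\<close> into \<open>x\<^sup>T J x = J\<close> gives exactly
  \<open>\<xi>\<^sup>T J + J \<xi> = - \<xi>\<^sup>T J \<xi>\<close>: the Lie algebra equation holds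
  up to a quadratic error.\<close>

lemma SOJ_linearisation:
  assumes "x \<in> SOJ"
  shows "norm (transpose (x - mat 1) ** J3 + J3 ** (x - mat 1)) \<le> norm (x - mat 1) * norm (x - mat 1)"
proof -
  define \<xi> where "\<xi> = x - mat 1"
  have "transpose (mat 1 + \<xi>) ** J3 ** (mat 1 + \<xi>) = J3"
    using assms by (simp add: SOJ_def \<xi>_def)
  moreover have "transpose (mat 1 + \<xi>) = mat 1 + transpose \<xi>"
    by (simp add: vec_eq_iff transpose_def mat_def)
  ultimately have "transpose \<xi> ** J3 + J3 ** \<xi> = - (transpose \<xi> ** J3 ** \<xi>)"
    by (simp add: bounded_bilinear.add_left[OF bounded_bilinear_matrix_mult]
        bounded_bilinear.add_right[OF bounded_bilinear_matrix_mult]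
        eq_neg_iff_add_eq_0 algebra_simps)
  then have "norm (transpose \<xi> ** J3 + J3 ** \<xi>) = norm (transpose \<xi> ** J3 ** \<xi>)"
    by simp
  also have "\<dots> \<le> norm (transpose \<xi> ** J3) * norm \<xi>" by (rule norm_matrix_mult_le)
  also have "\<dots> = norm \<xi> * norm \<xi>" by (simp add: norm_J3_mult norm_transpose)
  finally show ?thesis by (simp add: \<xi>_def)
qed

definition Nup :: "real^3^3" where "Nup = mat3 0 1 0 0 0 1 0 0 0"
definition Nlo :: "real^3^3" where "Nlo = mat3 0 0 0 1 0 0 0 1 0"

text \<open>The only nonlinear entry contributes \<open>(r\<^sup>2 - r'\<^sup>2)/2\<close>, whose
  factor \<open>(r + r')/2\<close> is at most \<open>\<epsilon>\<close>.\<close>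

lemma up3_increment:
  assumes "\<bar>r\<bar> \<le> \<epsilon>" "\<bar>r'\<bar> \<le> \<epsilon>"
  shows "norm (up3 r - up3 r' - (r - r') *\<^sub>R Nup) \<le> \<epsilon> * \<bar>r - r'\<bar>"
    and "norm (lo3 r - lo3 r' - (r - r') *\<^sub>R Nlo) \<le> \<epsilon> * \<bar>r - r'\<bar>"
proof -
  have "\<bar>(r\<^sup>2 - r'\<^sup>2) / 2\<bar> = \<bar>r + r'\<bar> / 2 * \<bar>r - r'\<bar>"
    by (simp add: power2_eq_square abs_mult[symmetric] algebra_simps)
  also have "\<dots> \<le> \<epsilon> * \<bar>r - r'\<bar>" using assms by (intro mult_right_mono) auto
  finally have *: "\<bar>(r\<^sup>2 - r'\<^sup>2) / 2\<bar> \<le> \<epsilon> * \<bar>r - r'\<bar>" .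
  have 1: "up3 r - up3 r' - (r - r') *\<^sub>R Nup = mat3 0 0 ((r\<^sup>2 - r'\<^sup>2) / 2) 0 0 0 0 0 0"
    by (simp add: up3_def Nup_def matrix3_simps diff_divide_distrib)
  have 2: "lo3 r - lo3 r' - (r - r') *\<^sub>R Nlo = mat3 0 0 0 0 0 0 ((r\<^sup>2 - r'\<^sup>2) / 2) 0 0"
    by (simp add: lo3_def Nlo_def matrix3_simps diff_divide_distrib)
  show "norm (up3 r - up3 r' - (r - r') *\<^sub>R Nup) \<le> \<epsilon> * \<bar>r - r'\<bar>"
    unfolding 1 by (rule order_trans[OF norm_le_9]) (use * in simp)
  show "norm (lo3 r - lo3 r' - (r - r') *\<^sub>R Nlo) \<le> \<epsilon> * \<bar>r - r'\<bar>"
    unfolding 2 by (rule order_trans[OF norm_le_9]) (use * in simp)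
qed

lemma norm_Nup_Nlo: "norm Nup \<le> 2" "norm Nlo \<le> 2"
  unfolding Nup_def Nlo_def by (rule order_trans[OF norm_le_9], simp)+

lemma up3_lo3_small:
  assumes "\<bar>r\<bar> \<le> 1"
  shows "norm (up3 r) \<le> 9" "norm (lo3 r) \<le> 9"
    "norm (up3 r - mat 1) \<le> 3 * \<bar>r\<bar>" "norm (lo3 r - mat 1) \<le> 3 * \<bar>r\<bar>"
proof -
  have e: "exp (1::real) \<le> 3" by (rule exp_le)
  show "norm (up3 r) \<le> 9" "norm (lo3 r) \<le> 9"
    using one_parameter_bounds(1,3)[OF assms] e by linarith+
  have 0: "up3 0 = mat 1" "lo3 0 = mat 1" by (simp_all add: up3_def lo3_def matrix3_simps)
  have "norm (r *\<^sub>R Nup) \<le> 2 * \<bar>r\<bar>" "norm (r *\<^sub>R Nlo) \<le> 2 * \<bar>r\<bar>"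
    using norm_Nup_Nlo by (auto simp: mult.commute intro!: mult_left_mono)
  then show "norm (up3 r - mat 1) \<le> 3 * \<bar>r\<bar>" "norm (lo3 r - mat 1) \<le> 3 * \<bar>r\<bar>"
    using up3_increment[OF assms, of 0] 0 norm_triangle_sub[of "up3 r - mat 1" "r *\<^sub>R Nup"]
      norm_triangle_sub[of "lo3 r - mat 1" "r *\<^sub>R Nlo"] by simp_all
qed

lemma norm_up3_diff:
  assumes "\<bar>r\<bar> \<le> 1" "\<bar>r'\<bar> \<le> 1" shows "norm (up3 r - up3 r') \<le> 3 * \<bar>r - r'\<bar>"
proof -
  have "norm ((r - r') *\<^sub>R Nup) \<le> \<bar>r - r'\<bar> * 2"
    unfolding norm_scaleR by (rule mult_left_mono[OF norm_Nup_Nlo(1)]) simp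
  then show ?thesis
    using up3_increment(1)[OF assms] norm_triangle_sub[of "up3 r - up3 r'" "(r - r') *\<^sub>R Nup"] by simp
qed

text \<open>The differential of \<open>(x, r, c) \<mapsto> x a n(r) m(c)\<close> at the identity, together with the equations
  cutting out the Lie algebra of \<open>SOJ\<close>, is injective because \<open>t \<noteq> 0\<close>.\<close>

lemma orbit_differential_injective:
  assumes "t \<noteq> 0"
  obtains B where "0 < B"
    "\<And>\<xi> \<rho> \<gamma>. B * norm (\<xi>, \<rho>, \<gamma>) \<le> norm (\<xi> ** a_mat t + a_mat t ** (\<rho> *\<^sub>R Nup + \<gamma> *\<^sub>R Nlo))
        + norm (transpose \<xi> ** J3 + J3 ** \<xi>)"
proof -
  define L :: "(real^3^3) \<times> real \<times> real \<Rightarrow> (real^3^3) \<times> (real^3^3)" where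
    "L p = (fst p ** a_mat t + a_mat t ** (fst (snd p) *\<^sub>R Nup + snd (snd p) *\<^sub>R Nlo),
            transpose (fst p) ** J3 + J3 ** fst p)" for p
  have lin: "linear L"
    by (rule linearI) (simp_all add: L_def matrix3_simps algebra_simps)
  have "inj L"
  proof (rule linear_injective_0[OF lin, THEN iffD2], intro allI impI)
    fix p assume "L p = 0"
    obtain \<xi> \<rho> \<gamma> where p: "p = (\<xi>, \<rho>, \<gamma>)" by (cases p)
    have L: "\<xi> ** a_mat t + a_mat t ** (\<rho> *\<^sub>R Nup + \<gamma> *\<^sub>R Nlo) = 0" "transpose \<xi> ** J3 + J3 ** \<xi> = 0"
      using \<open>L p = 0\<close> by (simp_all add: L_def p zero_prod_def)
    define u v where "u = exp t" and "v = exp (- 2 * t)"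
    have uv: "0 < u" "0 < v" "u \<noteq> v" using exp_2_ne(2)[OF assms] by (simp_all add: u_def v_def)
    have F: "(\<xi> ** a_mat t + a_mat t ** (\<rho> *\<^sub>R Nup + \<gamma> *\<^sub>R Nlo))$i$j = 0"
      "(transpose \<xi> ** J3 + J3 ** \<xi>)$i$j = 0" for i j
      unfolding L by simp_all
    note entry = matrix3_mult_nth a_mat_eq Nup_def Nlo_def J3_def transpose_nth
    \<comment> \<open>At these positions the unipotent directions contribute nothing and right
      multiplication by \<open>a_mat t\<close> only rescales \<open>\<xi>\<close>.\<close>
    have s: "\<xi>$1$1 = 0" "\<xi>$3$3 = 0" "\<xi>$2$2 = 0" "\<xi>$1$3 = 0" "\<xi>$3$1 = 0"
      using F(1)[of 1 1] F(1)[of 3 3] F(1)[of 2 2] F(1)[of 1 3] F(1)[of 3 1] by (simp_all add: entry)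
    have e23: "\<xi>$2$3 = \<xi>$1$2" "\<xi>$3$2 = \<xi>$2$1"
      using F(2)[of 2 3] F(2)[of 1 2] by (simp_all add: entry)
    have 1: "\<xi>$1$2 * v + u * \<rho> = 0" "\<xi>$1$2 * u + v * \<rho> = 0"
      using F(1)[of 1 2] F(1)[of 2 3] e23 by (simp_all add: entry u_def v_def)
    have 2: "\<xi>$2$1 * u + v * \<gamma> = 0" "\<xi>$2$1 * v + u * \<gamma> = 0"
      using F(1)[of 2 1] F(1)[of 3 2] e23 by (simp_all add: entry u_def v_def)
    \<comment> \<open>Up to sign the determinant of both systems: one in \<open>\<xi>$1$2\<close>
      and \<open>\<rho>\<close>, one in \<open>\<xi>$2$1\<close> and
      \<open>\<gamma>\<close>.\<close>
    have nz: "u * u - v * v \<noteq> 0" using uv by (simp add: square_eq_iff)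
    have "(u * u - v * v) * \<rho> = u * (\<xi>$1$2 * v + u * \<rho>) - v * (\<xi>$1$2 * u + v * \<rho>)"
      "(u * u - v * v) * \<xi>$1$2 = u * (\<xi>$1$2 * u + v * \<rho>) - v * (\<xi>$1$2 * v + u * \<rho>)"
      "(u * u - v * v) * \<gamma> = u * (\<xi>$2$1 * v + u * \<gamma>) - v * (\<xi>$2$1 * u + v * \<gamma>)"
      "(u * u - v * v) * \<xi>$2$1 = u * (\<xi>$2$1 * u + v * \<gamma>) - v * (\<xi>$2$1 * v + u * \<gamma>)"
      by (simp_all add: algebra_simps)
    then have "\<rho> = 0" "\<xi>$1$2 = 0" "\<gamma> = 0" "\<xi>$2$1 = 0"
      unfolding 1 2 using nz by simp_all
    then have "\<xi> = 0" using s e23 by (simp add: matrix3_eq_iff)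
    then show "p = 0" using \<open>\<rho> = 0\<close> \<open>\<gamma> = 0\<close> by (simp add: p zero_prod_def)
  qed
  then obtain B where B: "0 < B" "\<And>p. B * norm p \<le> norm (L p)"
    using linear_inj_bounded_below_pos[OF lin] by blast
  show ?thesis
  proof (rule that[OF B(1)])
    fix \<xi> \<rho> \<gamma>
    show "B * norm (\<xi>, \<rho>, \<gamma>) \<le> norm (\<xi> ** a_mat t + a_mat t ** (\<rho> *\<^sub>R Nup + \<gamma> *\<^sub>R Nlo))
        + norm (transpose \<xi> ** J3 + J3 ** \<xi>)"
      using B(2)[of "(\<xi>, \<rho>, \<gamma>)"] norm_pair_le[of "\<xi> ** a_mat t + a_mat t ** (\<rho> *\<^sub>R Nup + \<gamma> *\<^sub>R Nlo)"
          "transpose \<xi> ** J3 + J3 ** \<xi>"] by (simp add: L_def)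
  qed
qed

text \<open>Product rule with remainders. The constants come from the bounds 9, 2 and 3 for the
  factors: \<open>15 = 9 + 2 * 3\<close> and \<open>30 = 3 * 9 + 3\<close>.\<close>

lemma up3_lo3_increment:
  assumes \<epsilon>: "\<epsilon> \<le> 1" and r: "\<bar>r\<bar> \<le> \<epsilon>" "\<bar>r'\<bar> \<le> \<epsilon>" and c: "\<bar>c\<bar> \<le> \<epsilon>" "\<bar>c'\<bar> \<le> \<epsilon>"
  shows "norm (up3 r ** lo3 c - up3 r' ** lo3 c' - ((r - r') *\<^sub>R Nup + (c - c') *\<^sub>R Nlo))
      \<le> 15 * \<epsilon> * (\<bar>r - r'\<bar> + \<bar>c - c'\<bar>)"
    and "norm (up3 r ** lo3 c - mat 1) \<le> 30 * \<epsilon>"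
proof -
  define \<rho> \<gamma> where "\<rho> = r - r'" and "\<gamma> = c - c'"
  have \<epsilon>0: "0 \<le> \<epsilon>" using r by linarith
  have "up3 r ** lo3 c - up3 r' ** lo3 c' - (\<rho> *\<^sub>R Nup + \<gamma> *\<^sub>R Nlo) =
     ((up3 r - up3 r' - \<rho> *\<^sub>R Nup) ** lo3 c + (\<rho> *\<^sub>R Nup) ** (lo3 c - mat 1))
     + (up3 r' ** (lo3 c - lo3 c' - \<gamma> *\<^sub>R Nlo) + (up3 r' - mat 1) ** (\<gamma> *\<^sub>R Nlo))"
    by (simp add: matrix_diff_left matrix_diff_right)
  also have "norm \<dots> \<le> ((\<epsilon> * \<bar>\<rho>\<bar>) * 9 + (\<bar>\<rho>\<bar> * 2) * (3 * \<epsilon>)) + (9 * (\<epsilon> * \<bar>\<gamma>\<bar>) + (3 * \<epsilon>) * (\<bar>\<gamma>\<bar> * 2))"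
  proof (intro norm_triangle_mono order_trans[OF norm_matrix_mult_le] mult_mono norm_ge_zero)
    show "norm (up3 r - up3 r' - \<rho> *\<^sub>R Nup) \<le> \<epsilon> * \<bar>\<rho>\<bar>" "norm (lo3 c - lo3 c' - \<gamma> *\<^sub>R Nlo) \<le> \<epsilon> * \<bar>\<gamma>\<bar>"
      unfolding \<rho>_def \<gamma>_def using up3_increment r c by blast+
    show "norm (lo3 c) \<le> 9" "norm (up3 r') \<le> 9" using up3_lo3_small[of c] up3_lo3_small[of r'] r c \<epsilon> by auto
    show "norm (lo3 c - mat 1) \<le> 3 * \<epsilon>" "norm (up3 r' - mat 1) \<le> 3 * \<epsilon>"
      using up3_lo3_small[of c] up3_lo3_small[of r'] r c \<epsilon> by auto
    show "norm (\<rho> *\<^sub>R Nup) \<le> \<bar>\<rho>\<bar> * 2" "norm (\<gamma> *\<^sub>R Nlo) \<le> \<bar>\<gamma>\<bar> * 2"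
      using norm_Nup_Nlo by (auto intro!: mult_left_mono)
  qed (use \<epsilon>0 in auto)
  also have "\<dots> = 15 * \<epsilon> * (\<bar>\<rho>\<bar> + \<bar>\<gamma>\<bar>)" by (simp add: algebra_simps)
  finally show "norm (up3 r ** lo3 c - up3 r' ** lo3 c' - ((r - r') *\<^sub>R Nup + (c - c') *\<^sub>R Nlo))
      \<le> 15 * \<epsilon> * (\<bar>r - r'\<bar> + \<bar>c - c'\<bar>)" by (simp add: \<rho>_def \<gamma>_def)
  have "up3 r ** lo3 c - mat 1 = (up3 r - mat 1) ** lo3 c + (lo3 c - mat 1)"
    by (simp add: matrix_diff_left)
  also have "norm \<dots> \<le> (3 * \<epsilon>) * 9 + 3 * \<epsilon>"
    using up3_lo3_small[of c] up3_lo3_small[of r] r c \<epsilon> \<epsilon>0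
    by (intro norm_triangle_mono order_trans[OF norm_matrix_mult_le] mult_mono) auto
  finally show "norm (up3 r ** lo3 c - mat 1) \<le> 30 * \<epsilon>" by simp
qed

text \<open>The second point has group part 1, to which left translation reduces the general case.
  The remainder of the differential and the defect of the Lie algebra equation each take at most a
  quarter of the linear lower bound \<open>B\<close>; what is left gives
  \<open>C = 2 / B\<close>.\<close>

lemma orbit_map_expanding:
  assumes "t \<noteq> 0"
  obtains \<delta> \<epsilon> C where "0 < \<delta>" "0 < \<epsilon>" "\<epsilon> \<le> 1" "0 < C"
    "\<And>x r r' c c'. x \<in> SOJ \<Longrightarrow> norm (x - mat 1) \<le> \<delta> \<Longrightarrow> r \<in> {0..\<epsilon>} \<Longrightarrow> r' \<in> {0..\<epsilon>} \<Longrightarrow>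
       c \<in> {0..\<epsilon>} \<Longrightarrow> c' \<in> {0..\<epsilon>} \<Longrightarrow>
       norm (x - mat 1, r - r', c - c') \<le>
         C * norm (x ** a_mat t ** (up3 r ** lo3 c) - a_mat t ** (up3 r' ** lo3 c'))"
proof -
  obtain B where B: "0 < B"
    "\<And>\<xi> \<rho> \<gamma>. B * norm (\<xi>, \<rho>, \<gamma>) \<le> norm (\<xi> ** a_mat t + a_mat t ** (\<rho> *\<^sub>R Nup + \<gamma> *\<^sub>R Nlo))
        + norm (transpose \<xi> ** J3 + J3 ** \<xi>)"
    by (rule orbit_differential_injective[OF assms]) (rule that)
  define n where "n = norm (a_mat t)"
  define \<delta> where "\<delta> = B / 4"
  \<comment> \<open>The remainder of the differential is at most \<open>60 * \<epsilon> * n\<close>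
    times the norm, and this must not exceed \<open>B / 4\<close>.\<close>
  define \<epsilon> where "\<epsilon> = min 1 (B / (240 * (n + 1)))"
  have n0: "0 \<le> n" by (simp add: n_def)
  have \<epsilon>: "0 < \<epsilon>" "\<epsilon> \<le> 1" "60 * \<epsilon> * n \<le> B / 4"
  proof -
    show "0 < \<epsilon>" "\<epsilon> \<le> 1" using B(1) n0 by (auto simp: \<epsilon>_def)
    have "60 * \<epsilon> * n \<le> 60 * (B / (240 * (n + 1))) * (n + 1)"
      using B(1) n0 by (intro mult_mono) (auto simp: \<epsilon>_def)
    also have "\<dots> = B / 4" using n0 by (simp add: field_simps)
    finally show "60 * \<epsilon> * n \<le> B / 4" .
  qed
  show ?thesis
  proof (rule that[of \<delta> \<epsilon> "2 / B"])
    fix x r r' c c'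
    assume x: "x \<in> SOJ" "norm (x - mat 1) \<le> \<delta>" and r: "r \<in> {0..\<epsilon>}" "r' \<in> {0..\<epsilon>}" and c: "c \<in> {0..\<epsilon>}" "c' \<in> {0..\<epsilon>}"
    define \<xi> \<rho> \<gamma> where "\<xi> = x - mat 1" and "\<rho> = r - r'" and "\<gamma> = c - c'"
    define u u' where "u = up3 r ** lo3 c" and "u' = up3 r' ** lo3 c'"
    define E where "E = x ** a_mat t ** u - a_mat t ** u'"
    define p where "p = norm (\<xi>, \<rho>, \<gamma>)"
    have inc: "norm (u - u' - (\<rho> *\<^sub>R Nup + \<gamma> *\<^sub>R Nlo)) \<le> 15 * \<epsilon> * (\<bar>\<rho>\<bar> + \<bar>\<gamma>\<bar>)" "norm (u - mat 1) \<le> 30 * \<epsilon>"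
      unfolding u_def u'_def \<rho>_def \<gamma>_def using up3_lo3_increment[of \<epsilon> r r' c c'] r c \<epsilon> by auto
    have comp: "norm \<xi> \<le> p" "\<bar>\<rho>\<bar> \<le> p" "\<bar>\<gamma>\<bar> \<le> p"
    proof -
      show "norm \<xi> \<le> p" unfolding p_def by (rule norm_fst_le')
      have "norm (\<rho>, \<gamma>) \<le> p" unfolding p_def by (rule norm_snd_le')
      then show "\<bar>\<rho>\<bar> \<le> p" "\<bar>\<gamma>\<bar> \<le> p" using norm_fst_le'[of \<rho> \<gamma>] norm_snd_le'[of \<gamma> \<rho>] by auto
    qed
    have p0: "0 \<le> p" by (simp add: p_def)
    have "\<xi> ** a_mat t + a_mat t ** (\<rho> *\<^sub>R Nup + \<gamma> *\<^sub>R Nlo) =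
        E - (\<xi> ** a_mat t ** (u - mat 1) + a_mat t ** (u - u' - (\<rho> *\<^sub>R Nup + \<gamma> *\<^sub>R Nlo)))"
      unfolding E_def \<xi>_def
      by (simp add: matrix_diff_left matrix_diff_right)
    then have "norm (\<xi> ** a_mat t + a_mat t ** (\<rho> *\<^sub>R Nup + \<gamma> *\<^sub>R Nlo)) \<le> norm E +
        norm (\<xi> ** a_mat t ** (u - mat 1) + a_mat t ** (u - u' - (\<rho> *\<^sub>R Nup + \<gamma> *\<^sub>R Nlo)))"
      by (metis norm_triangle_ineq4)
    also have "norm (\<xi> ** a_mat t ** (u - mat 1) + a_mat t ** (u - u' - (\<rho> *\<^sub>R Nup + \<gamma> *\<^sub>R Nlo)))
        \<le> (p * n) * (30 * \<epsilon>) + n * (15 * \<epsilon> * (p + p))"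
    proof (intro norm_triangle_mono order_trans[OF norm_matrix_mult_le] mult_mono norm_ge_zero inc(2) comp(1))
      show "norm (u - u' - (\<rho> *\<^sub>R Nup + \<gamma> *\<^sub>R Nlo)) \<le> 15 * \<epsilon> * (p + p)"
        using comp \<epsilon> by (intro order_trans[OF inc(1)] mult_left_mono) auto
    qed (use n0 p0 \<epsilon> in \<open>auto simp: n_def\<close>)
    also have "(p * n) * (30 * \<epsilon>) + n * (15 * \<epsilon> * (p + p)) = (60 * \<epsilon> * n) * p" by (simp add: algebra_simps)
    also have "\<dots> \<le> B / 4 * p" by (intro mult_right_mono \<epsilon> p0)
    finally have 1: "norm (\<xi> ** a_mat t + a_mat t ** (\<rho> *\<^sub>R Nup + \<gamma> *\<^sub>R Nlo)) \<le> norm E + B / 4 * p" by simp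
    have "norm (transpose \<xi> ** J3 + J3 ** \<xi>) \<le> norm \<xi> * norm \<xi>"
      unfolding \<xi>_def by (rule SOJ_linearisation[OF x(1)])
    also have "\<dots> \<le> B / 4 * p" using x(2) comp(1) B(1) by (intro mult_mono) (auto simp: \<xi>_def \<delta>_def)
    finally have 2: "norm (transpose \<xi> ** J3 + J3 ** \<xi>) \<le> B / 4 * p" .
    have "B * p \<le> norm E + B / 4 * p + B / 4 * p" using B(2)[of \<xi> \<rho> \<gamma>] 1 2 by (simp add: p_def)
    then have "p \<le> 2 / B * norm E" using B(1) by (simp add: field_simps)
    then show "norm (x - mat 1, r - r', c - c') \<le>
         2 / B * norm (x ** a_mat t ** (up3 r ** lo3 c) - a_mat t ** (up3 r' ** lo3 c'))"
      by (simp add: p_def E_def \<xi>_def \<rho>_def \<gamma>_def u_def u'_def)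
  qed (use B \<epsilon> in \<open>auto simp: \<delta>_def\<close>)
qed

text \<open>\<open>plane_pt t r\<close> is the positive definite matrix representing the point \<open>a\<^sub>t n(r) o\<close>; the map
  \<open>x \<mapsto> x (plane_pt t r) x\<^sup>T\<close> is an immersion of \<open>SOJ\<close> at \<open>r = 0\<close>, since \<open>a\<^sub>t\<^sup>2 J\<close> has distinct eigenvalues.\<close>

definition plane_pt :: "real \<Rightarrow> real \<Rightarrow> real^3^3" where
  "plane_pt t r = a_mat t ** up3 r ** transpose (up3 r) ** a_mat t"

text \<open>For \<open>\<xi>\<close> in the Lie algebra, \<open>\<xi>\<^sup>T = - J \<xi> J\<close>.
  So the derivative \<open>\<xi> P + P \<xi>\<^sup>T\<close> of the action at \<open>P\<close>,
  multiplied by \<open>J\<close> on the right, is the commutator of \<open>\<xi>\<close> with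
  \<open>P J\<close>.\<close>

lemma commutator_injective:
  assumes "t \<noteq> 0"
  obtains B where "0 < B"
    "\<And>\<xi>. B * norm \<xi> \<le> norm (\<xi> ** (plane_pt t 0 ** J3) - plane_pt t 0 ** J3 ** \<xi>)
        + norm (transpose \<xi> ** J3 + J3 ** \<xi>)"
proof -
  define u v where "u = exp (2 * t)" and "v = exp (- 4 * t)"
  have uv: "0 < u" "0 < v" "u \<noteq> v" using exp_2_ne(1)[OF assms] by (simp_all add: u_def v_def)
  have M0: "plane_pt t 0 ** J3 = mat3 0 0 u 0 (- v) 0 u 0 0"
    by (simp add: plane_pt_def a_mat_eq up3_def J3_def matrix3_simps u_def v_def exp_add[symmetric])
  define L :: "(real^3^3) \<Rightarrow> (real^3^3) \<times> (real^3^3)" where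
    "L \<xi> = (\<xi> ** mat3 0 0 u 0 (- v) 0 u 0 0 - mat3 0 0 u 0 (- v) 0 u 0 0 ** \<xi>, transpose \<xi> ** J3 + J3 ** \<xi>)" for \<xi>
  have lin: "linear L"
    by (rule linearI) (simp_all add: L_def matrix3_simps algebra_simps)
  have "inj L"
  proof (rule linear_injective_0[OF lin, THEN iffD2], intro allI impI)
    fix \<xi> assume "L \<xi> = 0"
    then have L: "\<xi> ** mat3 0 0 u 0 (- v) 0 u 0 0 - mat3 0 0 u 0 (- v) 0 u 0 0 ** \<xi> = 0"
      "transpose \<xi> ** J3 + J3 ** \<xi> = 0" by (simp_all add: L_def zero_prod_def)
    have F: "(\<xi> ** mat3 0 0 u 0 (- v) 0 u 0 0 - mat3 0 0 u 0 (- v) 0 u 0 0 ** \<xi>)$i$j = 0"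
      "(transpose \<xi> ** J3 + J3 ** \<xi>)$i$j = 0" for i j
      unfolding L by simp_all
    note entry = matrix3_mult_nth J3_def transpose_nth
    have e: "\<xi>$2$2 = 0" "\<xi>$1$3 = 0" "\<xi>$3$1 = 0" "\<xi>$3$3 = - \<xi>$1$1" "\<xi>$2$3 = \<xi>$1$2" "\<xi>$3$2 = \<xi>$2$1"
      using F(2)[of 2 2] F(2)[of 3 3] F(2)[of 1 1] F(2)[of 1 3] F(2)[of 2 3] F(2)[of 1 2]
      by (simp_all add: entry)
    have "u * (2 * \<xi>$1$1) = 0" using F(1)[of 1 3] e by (simp add: entry algebra_simps)
    then have s: "\<xi>$1$1 = 0" using uv by simp
    have 1: "u * \<xi>$1$2 + v * \<xi>$2$1 = 0" "u * \<xi>$2$1 + v * \<xi>$1$2 = 0"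
      using F(1)[of 2 1] F(1)[of 2 3] e by (simp_all add: entry algebra_simps)
    have nz: "u * u - v * v \<noteq> 0" using uv by (simp add: square_eq_iff)
    have "(u * u - v * v) * \<xi>$1$2 = u * (u * \<xi>$1$2 + v * \<xi>$2$1) - v * (u * \<xi>$2$1 + v * \<xi>$1$2)"
      "(u * u - v * v) * \<xi>$2$1 = u * (u * \<xi>$2$1 + v * \<xi>$1$2) - v * (u * \<xi>$1$2 + v * \<xi>$2$1)"
      by (simp_all add: algebra_simps)
    then have "\<xi>$1$2 = 0" "\<xi>$2$1 = 0" unfolding 1 using nz by simp_all
    then show "\<xi> = 0" using e s by (simp add: matrix3_eq_iff)
  qed
  then obtain B where B: "0 < B" "\<And>p. B * norm p \<le> norm (L p)"
    using linear_inj_bounded_below_pos[OF lin] by blast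
  show ?thesis
  proof (rule that[OF B(1)])
    fix \<xi>
    show "B * norm \<xi> \<le> norm (\<xi> ** (plane_pt t 0 ** J3) - plane_pt t 0 ** J3 ** \<xi>)
        + norm (transpose \<xi> ** J3 + J3 ** \<xi>)"
      unfolding M0 using B(2)[of \<xi>] norm_pair_le by (fastforce simp: L_def intro: order_trans)
  qed
qed

lemma norm_plane_pt_diff:
  assumes "\<bar>r\<bar> \<le> 1" "\<bar>r'\<bar> \<le> 1"
  shows "norm (plane_pt t r - plane_pt t r') \<le> 54 * (norm (a_mat t))\<^sup>2 * \<bar>r - r'\<bar>"
proof -
  define a where "a = a_mat t"
  have "plane_pt t r - plane_pt t r' =
     a ** ((up3 r - up3 r') ** transpose (up3 r) + up3 r' ** transpose (up3 r - up3 r')) ** a"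
  proof -
    have "transpose (up3 r - up3 r') = transpose (up3 r) - transpose (up3 r')"
      by (simp add: vec_eq_iff transpose_def)
    then show ?thesis
      by (simp add: plane_pt_def a_def matrix_diff_left matrix_diff_right matrix_mul_assoc)
  qed
  also have "norm \<dots> \<le> (norm a * ((3 * \<bar>r - r'\<bar>) * 9 + 9 * (3 * \<bar>r - r'\<bar>))) * norm a"
    using norm_up3_diff[OF assms] up3_lo3_small(1)[OF assms(1)] up3_lo3_small(1)[OF assms(2)]
    by (intro order_trans[OF norm_matrix_mult_le] mult_mono norm_triangle_mono)
      (auto simp: norm_transpose intro!: add_nonneg_nonneg mult_nonneg_nonneg)
  also have "\<dots> = 54 * (norm a)\<^sup>2 * \<bar>r - r'\<bar>" by (simp add: power2_eq_square algebra_simps)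
  finally show ?thesis by (simp add: a_def)
qed

text \<open>An invariant of the action \<open>x Q x\<^sup>T\<close> of \<open>SOJ\<close>. On
  \<open>plane_pt t r\<close> it depends on \<open>r\<close> with nonzero coefficient when
  \<open>t \<noteq> 0\<close>, so it recovers \<open>r\<close> up to sign without knowing
  \<open>x\<close>.\<close>

definition Jtrace :: "real^3^3 \<Rightarrow> real" where "Jtrace Q = trace (J3 ** Q)"

lemma Jtrace_invariant: assumes "x \<in> SOJ" shows "Jtrace (x ** Q ** transpose x) = Jtrace Q"
proof -
  have "Jtrace (x ** Q ** transpose x) = trace ((J3 ** x ** Q) ** transpose x)"
    by (simp add: Jtrace_def matrix_mul_assoc)
  also have "\<dots> = trace (transpose x ** (J3 ** x ** Q))" by (rule trace_mul_sym)
  also have "\<dots> = trace ((transpose x ** J3 ** x) ** Q)" by (simp add: matrix_mul_assoc)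
  finally show ?thesis using assms by (simp add: SOJ_def Jtrace_def)
qed

lemma Jtrace_plane_pt:
  "Jtrace (plane_pt t r) = - exp (2 * t) + (exp (2 * t) - exp (- 4 * t)) * (1 + r\<^sup>2)"
proof -
  have e: "exp (2 * t) = exp t * exp t" "exp (- 4 * t) = exp (- 2 * t) * exp (- 2 * t)"
    by (simp_all add: exp_add[symmetric])
  show ?thesis unfolding e
    by (simp add: Jtrace_def trace_def sum_3 J3_def plane_pt_def a_mat_eq up3_def matrix3_mult_nth
        transpose_nth power2_eq_square algebra_simps)
qed

lemma abs_Jtrace_diff_le: "\<bar>Jtrace A - Jtrace B\<bar> \<le> 3 * norm (A - B)"
proof -
  have "Jtrace A - Jtrace B = (A - B)$3$1 - (A - B)$2$2 + (A - B)$1$3"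
    by (simp add: Jtrace_def trace_def sum_3 J3_def matrix3_mult_nth)
  then show ?thesis
    using abs_entry_le_norm[of "A - B" 3 1] abs_entry_le_norm[of "A - B" 2 2] abs_entry_le_norm[of "A - B" 1 3]
    by linarith
qed

text \<open>\<open>r\<close> is kept away from \<open>0\<close> because \<open>Jtrace\<close> only detects \<open>r\<^sup>2\<close>: the immersion degenerates on the axis.\<close>

lemma plane_map_expanding:
  assumes "t \<noteq> 0"
  obtains \<delta> r1 r2 C where "0 < \<delta>" "0 < r1" "r1 < r2" "r2 \<le> 1" "0 < C"
    "\<And>x r r'. x \<in> SOJ \<Longrightarrow> norm (x - mat 1) \<le> \<delta> \<Longrightarrow> r \<in> {r1..r2} \<Longrightarrow> r' \<in> {r1..r2} \<Longrightarrow>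
       norm (x - mat 1) + \<bar>r - r'\<bar> \<le>
         C * norm (x ** plane_pt t r ** transpose x - plane_pt t r')"
proof -
  obtain B where B: "0 < B"
    "\<And>\<xi>. B * norm \<xi> \<le> norm (\<xi> ** (plane_pt t 0 ** J3) - plane_pt t 0 ** J3 ** \<xi>)
        + norm (transpose \<xi> ** J3 + J3 ** \<xi>)"
    by (rule commutator_injective[OF assms]) (rule that)
  define n where "n = 54 * (norm (a_mat t))\<^sup>2"
  define \<kappa> where "\<kappa> = \<bar>exp (2 * t) - exp (- 4 * t)\<bar>"
  define \<delta> where "\<delta> = min 1 (B / 4)"
  \<comment> \<open>Replacing \<open>plane_pt t r\<close> by \<open>plane_pt t 0\<close> in the
    commutator costs \<open>2 * (n * r2)\<close> times the norm of \<open>\<xi>\<close>; this is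
    kept below \<open>B / 4\<close>.\<close>
  define r2 where "r2 = min 1 (B / (8 * (n + 1)))"
  define r1 where "r1 = r2 / 2"
  have n0: "0 \<le> n" by (simp add: n_def)
  have \<kappa>: "0 < \<kappa>" using exp_2_ne(1)[OF assms] by (simp add: \<kappa>_def)
  have r2: "0 < r2" "r2 \<le> 1" "2 * (n * r2) \<le> B / 4"
  proof -
    show "0 < r2" "r2 \<le> 1" using B(1) n0 by (auto simp: r2_def)
    have "2 * (n * r2) \<le> 2 * ((n + 1) * (B / (8 * (n + 1))))"
      using B(1) n0 by (intro mult_left_mono mult_mono) (auto simp: r2_def)
    also have "\<dots> = B / 4" using n0 by (simp add: field_simps)
    finally show "2 * (n * r2) \<le> B / 4" .
  qed
  define C1 where "C1 = 3 / (\<kappa> * (2 * r1))"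
  define C2 where "C2 = 1 + n * C1"
  define I where "I = norm (mat 1 :: real^3^3) + 1"
  have r1: "0 < r1" "r1 < r2" using r2 by (simp_all add: r1_def)
  have C1: "0 < C1" using \<kappa> r1 by (simp add: C1_def)
  have C2: "0 < C2" using C1 n0 by (simp add: C2_def add_pos_nonneg)
  have I: "0 < I" unfolding I_def by (rule add_nonneg_pos) simp_all
  show ?thesis
  proof (rule that[of \<delta> r1 r2 "2 * C2 * I / B + C1"])
    fix x r r'
    assume x: "x \<in> SOJ" "norm (x - mat 1) \<le> \<delta>" and r: "r \<in> {r1..r2}" "r' \<in> {r1..r2}"
    define \<Delta> where "\<Delta> = norm (x ** plane_pt t r ** transpose x - plane_pt t r')"
    define \<xi> where "\<xi> = x - mat 1"
    \<comment> \<open>The invariant does not see \<open>x\<close>, so \<open>r - r'\<close> is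
      bounded first; afterwards \<open>r'\<close> is replaced by \<open>r\<close>, and only the
      action of \<open>x\<close> remains.\<close>
    have "\<kappa> * \<bar>r\<^sup>2 - r'\<^sup>2\<bar> = \<bar>Jtrace (plane_pt t r) - Jtrace (plane_pt t r')\<bar>"
      unfolding Jtrace_plane_pt \<kappa>_def by (simp add: abs_mult[symmetric] algebra_simps)
    also have "\<dots> = \<bar>Jtrace (x ** plane_pt t r ** transpose x) - Jtrace (plane_pt t r')\<bar>"
      by (simp add: Jtrace_invariant[OF x(1)])
    also have "\<dots> \<le> 3 * \<Delta>" unfolding \<Delta>_def by (rule abs_Jtrace_diff_le)
    finally have "\<kappa> * \<bar>r\<^sup>2 - r'\<^sup>2\<bar> \<le> 3 * \<Delta>" .
    moreover have "(2 * r1) * \<bar>r - r'\<bar> \<le> \<bar>r\<^sup>2 - r'\<^sup>2\<bar>"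
    proof -
      have "\<bar>r\<^sup>2 - r'\<^sup>2\<bar> = (r + r') * \<bar>r - r'\<bar>"
        using r r1 by (simp add: power2_eq_square square_diff_square_factored abs_mult)
      then show ?thesis using r by (auto intro!: mult_right_mono)
    qed
    ultimately have "\<kappa> * ((2 * r1) * \<bar>r - r'\<bar>) \<le> 3 * \<Delta>"
      using \<kappa> mult_left_mono[of "(2 * r1) * \<bar>r - r'\<bar>" "\<bar>r\<^sup>2 - r'\<^sup>2\<bar>" \<kappa>] by linarith
    then have rr: "\<bar>r - r'\<bar> \<le> C1 * \<Delta>" using \<kappa> r1 by (simp add: C1_def field_simps)
    have abs: "\<bar>r\<bar> \<le> 1" "\<bar>r'\<bar> \<le> 1" "\<bar>r - 0\<bar> \<le> r2" using r r1 r2 by auto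
    have "norm (x ** plane_pt t r ** transpose x - plane_pt t r) \<le> \<Delta> + norm (plane_pt t r' - plane_pt t r)"
      unfolding \<Delta>_def by (rule order_trans[OF _ norm_triangle_ineq]) simp
    also have "\<dots> \<le> \<Delta> + n * (C1 * \<Delta>)"
    proof -
      have "norm (plane_pt t r' - plane_pt t r) \<le> n * \<bar>r' - r\<bar>"
        unfolding n_def by (rule norm_plane_pt_diff[OF abs(2,1)])
      also have "\<dots> \<le> n * (C1 * \<Delta>)" using rr by (intro mult_left_mono n0) (simp add: abs_minus_commute)
      finally show ?thesis by simp
    qed
    finally have d: "norm (x ** plane_pt t r ** transpose x - plane_pt t r) \<le> C2 * \<Delta>"
      by (simp add: C2_def algebra_simps)
    define M where "M = plane_pt t r ** J3"
    \<comment> \<open>Since \<open>x\<^sup>T J x = J\<close>, the displacement of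
      \<open>plane_pt t r\<close> becomes an exact commutator, without any remainder.\<close>
    have "(x ** plane_pt t r ** transpose x - plane_pt t r) ** J3 ** x = x ** M - M ** x"
    proof -
      have "x ** plane_pt t r ** transpose x ** J3 ** x = x ** plane_pt t r ** (transpose x ** J3 ** x)"
        by (simp add: matrix_mul_assoc)
      also have "\<dots> = x ** plane_pt t r ** J3" using x(1) by (simp only: SOJ_def mem_Collect_eq)
      finally show ?thesis by (simp only: matrix_diff_left M_def matrix_mul_assoc)
    qed
    also have "x ** M - M ** x = \<xi> ** M - M ** \<xi>"
      by (simp add: \<xi>_def matrix_diff_left matrix_diff_right)
    finally have "norm (\<xi> ** M - M ** \<xi>)
        \<le> norm ((x ** plane_pt t r ** transpose x - plane_pt t r) ** J3) * norm x"
      by (metis norm_matrix_mult_le)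
    also have "\<dots> \<le> (C2 * \<Delta>) * I"
    proof (intro mult_mono)
      have "norm x \<le> norm (mat 1 :: real^3^3) + norm \<xi>" unfolding \<xi>_def using norm_triangle_sub[of x "mat 1"] by simp
      also have "\<dots> \<le> I" using x(2) by (simp add: I_def \<xi>_def \<delta>_def)
      finally show "norm x \<le> I" .
    qed (use d C2 in \<open>auto simp: norm_J3_mult \<Delta>_def\<close>)
    finally have comm: "norm (\<xi> ** M - M ** \<xi>) \<le> C2 * \<Delta> * I" .
    define P where "P = (plane_pt t r - plane_pt t 0) ** J3"
    have P: "norm P \<le> n * r2"
    proof -
      have "norm P \<le> n * \<bar>r - 0\<bar>" unfolding P_def norm_J3_mult n_def
        by (rule norm_plane_pt_diff) (use abs in auto)
      also have "\<dots> \<le> n * r2" by (intro mult_left_mono abs n0)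
      finally show ?thesis .
    qed
    have "\<xi> ** (plane_pt t 0 ** J3) - plane_pt t 0 ** J3 ** \<xi> = (\<xi> ** M - M ** \<xi>) - (\<xi> ** P - P ** \<xi>)"
      by (simp add: M_def P_def matrix_diff_left matrix_diff_right)
    also have "norm \<dots> \<le> norm (\<xi> ** M - M ** \<xi>) + (norm (\<xi> ** P) + norm (P ** \<xi>))"
      by (intro order_trans[OF norm_triangle_ineq4] add_left_mono norm_triangle_ineq4)
    also have "\<dots> \<le> C2 * \<Delta> * I + (norm \<xi> * (n * r2) + (n * r2) * norm \<xi>)"
      using P by (intro add_mono comm order_trans[OF norm_matrix_mult_le] mult_left_mono mult_right_mono) auto
    also have "\<dots> = C2 * \<Delta> * I + (2 * (n * r2)) * norm \<xi>" by (simp add: algebra_simps)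
    also have "\<dots> \<le> C2 * \<Delta> * I + B / 4 * norm \<xi>"
      by (intro add_left_mono mult_right_mono r2) simp
    finally have 1: "norm (\<xi> ** (plane_pt t 0 ** J3) - plane_pt t 0 ** J3 ** \<xi>) \<le> C2 * \<Delta> * I + B / 4 * norm \<xi>" .
    have "norm (transpose \<xi> ** J3 + J3 ** \<xi>) \<le> norm \<xi> * norm \<xi>"
      unfolding \<xi>_def by (rule SOJ_linearisation[OF x(1)])
    also have "\<dots> \<le> B / 4 * norm \<xi>" using x(2) by (intro mult_right_mono) (auto simp: \<xi>_def \<delta>_def)
    finally have "B * norm \<xi> \<le> C2 * \<Delta> * I + B / 4 * norm \<xi> + B / 4 * norm \<xi>" using B(2)[of \<xi>] 1 by linarith
    then have "norm \<xi> \<le> 2 * C2 * I / B * \<Delta>" using B(1) by (simp add: field_simps)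
    then show "norm (x - mat 1) + \<bar>r - r'\<bar> \<le> (2 * C2 * I / B + C1) *
        norm (x ** plane_pt t r ** transpose x - plane_pt t r')"
      using rr by (simp add: \<xi>_def \<Delta>_def distrib_right)
  qed (use B r1 r2 C1 C2 I in \<open>auto simp: \<delta>_def intro!: add_pos_pos divide_pos_pos mult_pos_pos\<close>)
qed

section \<open>The orbit closure in \<open>G\<close>\<close>

lemma norm_sq_trace: "(norm (A :: real^'n^'n))\<^sup>2 = trace (A ** transpose A)"
  unfolding norm_matrix_sq
  by (simp add: trace_def matrix_matrix_mult_def transpose_def power2_eq_square)

lemma norm_orthogonal_left:
  fixes A B :: "real^'n^'n"
  assumes "transpose B ** B = mat 1" shows "norm (B ** A) = norm A"
proof -
  have "(norm (B ** A))\<^sup>2 = trace (B ** (A ** transpose A ** transpose B))"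
    by (simp add: norm_sq_trace matrix_transpose_mul matrix_mul_assoc)
  also have "\<dots> = trace ((A ** transpose A ** transpose B) ** B)" by (rule trace_mul_sym)
  also have "\<dots> = trace (A ** transpose A ** (transpose B ** B))" by (simp add: matrix_mul_assoc)
  finally show ?thesis using assms by (simp add: norm_sq_trace[symmetric])
qed

lemma SO3_D: assumes "k \<in> SO3" shows "transpose k ** k = mat 1" "k ** transpose k = mat 1" "det k = 1"
  using assms by (auto simp: SO3_def orthogonal_matrix_def)

lemma transpose_SO3: "k \<in> SO3 \<Longrightarrow> transpose k \<in> SO3"
  by (auto simp: SO3_def orthogonal_matrix_def det_transpose)

lemma SO3_mult: "k \<in> SO3 \<Longrightarrow> l \<in> SO3 \<Longrightarrow> k ** l \<in> SO3"
  by (auto simp: SO3_def orthogonal_matrix_mul det_mul)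

lemma one_SO3: "mat 1 \<in> SO3"
  by (simp add: SO3_def orthogonal_matrix_id)

lemma compact_SO3: "compact SO3"
proof -
  have "norm k = norm (mat 1 :: real^3^3)" if "k \<in> SO3" for k
    using norm_orthogonal_left[OF SO3_D(1)[OF that], of "mat 1"] by simp
  then have b: "bounded SO3" unfolding bounded_iff by (intro exI[of _ "norm (mat 1 :: real^3^3)"]) simp
  have eq: "SO3 = {k. transpose k ** k = mat 1} \<inter> {k. det k = 1}"
    by (auto simp: SO3_def orthogonal_matrix)
  have "closed {k :: real^3^3. det k = 1}"
    unfolding det_3 by (intro closed_Collect_eq continuous_intros)
  moreover have "closed {k :: real^3^3. transpose k ** k = mat 1}"
    by (intro closed_Collect_eq continuous_on_matrix_mult continuous_intros
        bounded_linear.continuous_on[OF bounded_linear_transpose])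
  ultimately have "closed SO3" unfolding eq by (intro closed_Int)
  with b show ?thesis by (simp add: compact_eq_bounded_closed)
qed

section \<open>Closedness of the orbit set\<close>

definition orbit_set :: "real \<Rightarrow> (real^3^3) set \<Rightarrow> (real^3^3) set" where
  "orbit_set t Z = {z ** a_mat t ** g | z g. z \<in> Z \<and> g \<in> SOF}"

text \<open>Invariant on the right under \<open>H\<close>, because \<open>g J g\<^sup>T = J\<close>,
  and on the left under \<open>K\<close>, because of the trace. On \<open>k n(r) a\<^sub>t g\<close>
  it is a function of \<open>r\<close> alone.\<close>

definition Jform :: "real^3^3 \<Rightarrow> real" where "Jform w = trace (w ** J3 ** transpose w)"

text \<open>Modulo \<open>A0\<close>, every \<open>z\<close> can be chosen in \<open>K N\<close>, where its size is controlled by \<open>w J w\<^sup>T\<close>.\<close>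

lemma orbit_set_bounded_rep:
  assumes Z: "Z \<subseteq> SOF" "\<And>z s. z \<in> Z \<Longrightarrow> z ** al3 s \<in> Z" and w: "w \<in> orbit_set t Z"
  shows "\<exists>y g r. w = y ** a_mat t ** g \<and> y \<in> Z \<and> g \<in> SOF \<and> norm y = norm (up3 r) \<and>
     Jform w = - exp (2 * t) + (exp (2 * t) - exp (- 4 * t)) * (1 + r\<^sup>2)"
proof -
  obtain z g where zg: "w = z ** a_mat t ** g" "z \<in> Z" "g \<in> SOF" using w by (auto simp: orbit_set_def)
  have zS: "z \<in> SOF" using zg(2) Z(1) by blast
  then have zJ: "z \<in> SOJ" using SOF_subset_SOJ by blast
  \<comment> \<open>Decomposing the inverse of \<open>z\<close> leaves
    \<open>z ** al3 s = transpose k ** up3 (- r)\<close>, with the diagonal factor on the side on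
    which it commutes with \<open>a_mat t\<close>.\<close>
  obtain s r k where h: "hinv z = al3 s ** up3 r ** k" "k \<in> SO3"
    using SOF_Iwasawa[OF hinv_SOF[OF zS]] by metis
  define y where "y = z ** al3 s"
  have y1: "y ** (up3 r ** k) = mat 1"
    using hinv_right[OF zJ] by (simp add: y_def h matrix_mul_assoc)
  have "(up3 r ** k) ** (transpose k ** up3 (- r)) = up3 r ** (k ** transpose k) ** up3 (- r)"
    by (simp add: matrix_mul_assoc)
  also have "\<dots> = mat 1" using SO3_D[OF h(2)] one_parameter_inverse(1)[of r] by simp
  finally have inv: "(up3 r ** k) ** (transpose k ** up3 (- r)) = mat 1" .
  have "y = y ** ((up3 r ** k) ** (transpose k ** up3 (- r)))" by (simp only: inv matrix_mul_rid)
  also have "\<dots> = (y ** (up3 r ** k)) ** (transpose k ** up3 (- r))" by (simp only: matrix_mul_assoc)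
  finally have y: "y = transpose k ** up3 (- r)" by (simp only: y1 matrix_mul_lid)
  have wy: "w = y ** a_mat t ** (al3 (- s) ** g)"
  proof -
    have "y ** a_mat t ** (al3 (- s) ** g) = z ** al3 s ** (a_mat t ** al3 (- s)) ** g"
      by (simp add: y_def matrix_mul_assoc)
    also have "\<dots> = z ** (al3 s ** al3 (- s)) ** a_mat t ** g" by (simp add: a_mat_al3 matrix_mul_assoc)
    finally show ?thesis using zg(1) by (simp add: one_parameter_inverse)
  qed
  define g' where "g' = al3 (- s) ** g"
  have g': "g' \<in> SOF" unfolding g'_def by (intro SOF_mult al3_SOF zg)
  then have g'J: "g' ** J3 ** transpose g' = J3" using SOF_subset_SOJ SOJ_transpose_form by blast
  define P where "P = up3 (- r) ** (a_mat t ** J3 ** a_mat t) ** transpose (up3 (- r))"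
  have "w ** J3 ** transpose w = transpose k ** up3 (- r) ** a_mat t ** (g' ** J3 ** transpose g') **
      a_mat t ** transpose (up3 (- r)) ** k"
    unfolding wy g'_def[symmetric] y by (simp add: matrix_transpose_mul transpose_a_mat matrix_mul_assoc)
  also have "\<dots> = transpose k ** (P ** k)" unfolding g'J P_def by (simp add: matrix_mul_assoc)
  finally have "Jform w = trace (transpose k ** (P ** k))" by (simp add: Jform_def)
  also have "\<dots> = trace ((P ** k) ** transpose k)" by (rule trace_mul_sym)
  also have "\<dots> = trace P" using SO3_D[OF h(2)] by (simp add: matrix_mul_assoc[symmetric])
  also have "\<dots> = - exp (2 * t) + (exp (2 * t) - exp (- 4 * t)) * (1 + (- r)\<^sup>2)"
  proof -
    have e: "exp (2 * t) = exp t * exp t" "exp (- 4 * t) = exp (- 2 * t) * exp (- 2 * t)"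
      by (simp_all add: exp_add[symmetric])
    show ?thesis unfolding e P_def
      by (simp add: trace_def sum_3 J3_def a_mat_eq up3_def matrix3_mult_nth
          transpose_nth power2_eq_square algebra_simps)
  qed
  finally have J: "Jform w = - exp (2 * t) + (exp (2 * t) - exp (- 4 * t)) * (1 + (- r)\<^sup>2)" .
  have "norm y = norm (up3 (- r))" unfolding y
    by (rule norm_orthogonal_left) (use SO3_D[OF h(2)] in simp)
  moreover have "y \<in> Z" unfolding y_def by (rule Z(2)[OF zg(2)])
  ultimately show ?thesis using wy g' J unfolding g'_def by blast
qed

lemma continuous_on_Jform: "continuous_on UNIV Jform"
  unfolding Jform_def trace_def
  by (intro continuous_intros continuous_on_matrix_mult bounded_linear.continuous_on[OF bounded_linear_transpose])

text \<open>The factors of a convergent sequence may escape along \<open>A0\<close>. For the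
  representatives of \<open>orbit_set_bounded_rep\<close> the convergent values of
  \<open>Jform\<close> bound the unipotent parameter. Hence the first factors subconverge, and the
  second factors follow because they are continuous in the remaining data.\<close>

lemma closed_orbit_set:
  assumes Z: "Z \<subseteq> SOF" "\<And>z s. z \<in> Z \<Longrightarrow> z ** al3 s \<in> Z" "closed Z" and t: "t \<noteq> 0"
  shows "closed (orbit_set t Z)"
  unfolding closed_sequential_limits
proof (intro allI impI, elim conjE)
  fix f w assume f: "\<forall>n. f n \<in> orbit_set t Z" and lim: "f \<longlonglongrightarrow> w"
  define \<kappa> where "\<kappa> = exp (2 * t) - exp (- 4 * t)"
  have \<kappa>: "0 < \<bar>\<kappa>\<bar>" using exp_2_ne(1)[OF t] by (simp add: \<kappa>_def)
  have "\<forall>n. \<exists>y g r. f n = y ** a_mat t ** g \<and> y \<in> Z \<and> g \<in> SOF \<and> norm y = norm (up3 r) \<and>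
     Jform (f n) = - exp (2 * t) + \<kappa> * (1 + r\<^sup>2)"
    unfolding \<kappa>_def using f orbit_set_bounded_rep[OF Z(1,2)] by blast
  then obtain y g r where yg: "\<And>n. f n = y n ** a_mat t ** g n" "\<And>n. y n \<in> Z" "\<And>n. g n \<in> SOF"
    "\<And>n. norm (y n) = norm (up3 (r n))" "\<And>n. Jform (f n) = - exp (2 * t) + \<kappa> * (1 + (r n)\<^sup>2)"
    by metis
  have "(\<lambda>n. Jform (f n)) \<longlonglongrightarrow> Jform w"
    using continuous_on_tendsto_compose[OF continuous_on_Jform lim] by simp
  then have "Bseq (\<lambda>n. Jform (f n))" by (simp add: convergent_imp_Bseq convergentI)
  then obtain b where b: "\<And>n. \<bar>Jform (f n)\<bar> \<le> b" unfolding Bseq_def by auto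
  \<comment> \<open>\<open>\<rho>\<close> bounds \<open>1 + (r n)\<^sup>2\<close>, and
    \<open>2 * \<bar>r n\<bar> \<le> 1 + (r n)\<^sup>2\<close>.\<close>
  define \<rho> where "\<rho> = (b + exp (2 * t)) / \<bar>\<kappa>\<bar>"
  have r: "\<bar>r n\<bar> \<le> \<rho>" for n
  proof -
    have "\<bar>\<kappa>\<bar> * (1 + (r n)\<^sup>2) = \<bar>\<kappa> * (1 + (r n)\<^sup>2)\<bar>" by (simp add: abs_mult add_nonneg_nonneg)
    also have "\<dots> = \<bar>Jform (f n) + exp (2 * t)\<bar>" using yg(5)[of n] by simp
    also have "\<dots> \<le> \<bar>Jform (f n)\<bar> + \<bar>exp (2 * t)\<bar>" by (rule abs_triangle_ineq)
    also have "\<dots> \<le> b + exp (2 * t)" using b[of n] by simp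
    finally have 1: "1 + (r n)\<^sup>2 \<le> \<rho>" using \<kappa> by (simp add: \<rho>_def field_simps)
    have "0 \<le> (\<bar>r n\<bar> - 1)\<^sup>2" "0 \<le> (r n)\<^sup>2" by simp_all
    then have "2 * \<bar>r n\<bar> \<le> 1 + (r n)\<^sup>2" by (simp add: power2_diff)
    then show ?thesis using 1 abs_ge_zero[of "r n"] by linarith
  qed
  define R where "R = 3 * exp \<rho>"
  have yR: "y n \<in> Z \<inter> cball 0 R" for n
    using yg(2)[of n] yg(4)[of n] one_parameter_bounds(1)[OF r[of n]] by (simp add: R_def)
  have "compact (Z \<inter> cball 0 R)" by (intro closed_Int_compact Z(3) compact_cball)
  then obtain l \<sigma> where l: "l \<in> Z \<inter> cball 0 R" and \<sigma>: "strict_mono \<sigma>" "(y \<circ> \<sigma>) \<longlonglongrightarrow> l"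
    using yR unfolding compact_def by metis
  have lZ: "l \<in> Z" and lJ: "l \<in> SOJ" using l Z(1) SOF_subset_SOJ by auto
  have yJ: "y n \<in> SOJ" for n using yg(2) Z(1) SOF_subset_SOJ by blast
  have a: "a_mat (- t) ** a_mat t = mat 1" using a_mat_inverse[of "- t"] by simp
  have gn: "g n = a_mat (- t) ** hinv (y n) ** f n" for n
  proof -
    have "a_mat (- t) ** hinv (y n) ** f n = a_mat (- t) ** (hinv (y n) ** y n) ** a_mat t ** g n"
      unfolding yg(1) by (simp add: matrix_mul_assoc)
    then show ?thesis using a hinv_left[OF yJ] by simp
  qed
  have "(\<lambda>n. hinv (y (\<sigma> n))) \<longlonglongrightarrow> hinv l"
    unfolding hinv_def using \<sigma>(2)
    by (intro tendsto_matrix_mult tendsto_const bounded_linear.tendsto[OF bounded_linear_transpose])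
      (simp add: o_def)
  moreover have "(\<lambda>n. f (\<sigma> n)) \<longlonglongrightarrow> w" using LIMSEQ_subseq_LIMSEQ[OF lim \<sigma>(1)] by (simp add: o_def)
  ultimately have gl: "(\<lambda>n. g (\<sigma> n)) \<longlonglongrightarrow> a_mat (- t) ** hinv l ** w"
    unfolding gn by (intro tendsto_matrix_mult tendsto_const)
  have "a_mat (- t) ** hinv l ** w \<in> SOF"
    by (rule closed_sequentially[OF closed_SOF _ gl]) (rule yg(3))
  moreover have "l ** a_mat t ** (a_mat (- t) ** hinv l ** w) = w"
  proof -
    have "l ** a_mat t ** (a_mat (- t) ** hinv l ** w) = l ** (a_mat t ** a_mat (- t)) ** hinv l ** w"
      by (simp add: matrix_mul_assoc)
    then show ?thesis using hinv_right[OF lJ] by (simp add: a_mat_inverse)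
  qed
  ultimately show "w \<in> orbit_set t Z"
    unfolding orbit_set_def using lZ by (metis (mono_tags, lifting) mem_Collect_eq)
qed

text \<open>Inverting \<open>SOF_decomp\<close> brings the diagonal factor to the front, where it
  commutes with \<open>a_mat t\<close> and is absorbed by \<open>Z\<close>.\<close>

lemma SOF_decomp_left:
  assumes "g \<in> SOF"
  obtains e s r c where "e \<in> {0, 1}" "g = al3 s ** (up3 r ** lo3 c ** up3 e)"
proof -
  have hS: "hinv g \<in> SOF" and gJ: "g \<in> SOJ" using hinv_SOF[OF assms] assms SOF_subset_SOJ by auto
  obtain e b a s where h: "e \<in> {0, -1}" "hinv g = up3 e ** (lo3 b ** up3 a ** al3 s)"
    using hS SOF_decomp unfolding SOF_iff by metis
  define g' where "g' = al3 (- s) ** (up3 (- a) ** lo3 (- b) ** up3 (- e))"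
  have "hinv g ** g' = up3 e ** (lo3 b ** (up3 a ** (al3 s ** al3 (- s)) ** up3 (- a)) ** lo3 (- b)) ** up3 (- e)"
    by (simp add: h g'_def matrix_mul_assoc)
  also have "\<dots> = mat 1"
    by (simp add: one_parameter_inverse)
  finally have "g ** (hinv g ** g') = g" by simp
  then have "g = g'" using hinv_right[OF gJ] by (simp add: matrix_mul_assoc)
  then show ?thesis using that[of "- e" "- s" "- a" "- b"] h(1) by (auto simp: g'_def)
qed

text \<open>The nested pairs match two successive products with a line. The values 0 and 1 of
  \<open>e\<close> stand for the two translates that cover the orbit set.\<close>

definition orbit_map :: "real \<Rightarrow> real \<Rightarrow> ((real^3^3) \<times> real) \<times> real \<Rightarrow> real^3^3" where
  "orbit_map t e p = fst (fst p) ** a_mat t ** (up3 (snd (fst p)) ** lo3 (snd p) ** up3 e)"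

lemma orbit_set_eq:
  assumes Z: "Z \<subseteq> SOF" "\<And>z s. z \<in> Z \<Longrightarrow> z ** al3 s \<in> Z"
  shows "orbit_set t Z = orbit_map t 0 ` ((Z \<times> UNIV) \<times> UNIV) \<union> orbit_map t 1 ` ((Z \<times> UNIV) \<times> UNIV)"
proof (intro equalityI subsetI)
  fix w assume "w \<in> orbit_set t Z"
  then obtain z g where zg: "w = z ** a_mat t ** g" "z \<in> Z" "g \<in> SOF" by (auto simp: orbit_set_def)
  obtain e s r c where g: "e \<in> {0, 1}" "g = al3 s ** (up3 r ** lo3 c ** up3 e)"
    using SOF_decomp_left[OF zg(3)] by metis
  have "w = z ** (a_mat t ** al3 s) ** (up3 r ** lo3 c ** up3 e)" by (simp add: zg g matrix_mul_assoc)
  also have "\<dots> = orbit_map t e ((z ** al3 s, r), c)"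
    unfolding a_mat_al3 by (simp add: orbit_map_def matrix_mul_assoc)
  finally have "w \<in> orbit_map t e ` ((Z \<times> UNIV) \<times> UNIV)" using Z(2)[OF zg(2), of s] by blast
  then show "w \<in> orbit_map t 0 ` ((Z \<times> UNIV) \<times> UNIV) \<union> orbit_map t 1 ` ((Z \<times> UNIV) \<times> UNIV)"
    using g(1) by auto
next
  fix w assume "w \<in> orbit_map t 0 ` ((Z \<times> UNIV) \<times> UNIV) \<union> orbit_map t 1 ` ((Z \<times> UNIV) \<times> UNIV)"
  then obtain e z r c where "w = z ** a_mat t ** (up3 r ** lo3 c ** up3 e)" "z \<in> Z"
    by (auto simp: orbit_map_def)
  then show "w \<in> orbit_set t Z" unfolding orbit_set_def by (auto intro!: SOF_mult up3_SOF lo3_SOF)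
qed

text \<open>The two images are joined by the product of curves joining corresponding factors; the
  constant factors \<open>a_mat t\<close> and \<open>up3 e\<close> have velocity 0.\<close>

lemma G_dist_orbit_map_le:
  assumes "z0 \<in> SOF" "1 \<le> R"
  obtains U C where "open U" "z0 \<in> U" "0 \<le> C"
    "\<And>z z' r r' c c' e. z \<in> SOF \<inter> U \<Longrightarrow> z' \<in> SOF \<inter> U \<Longrightarrow> \<bar>r\<bar> \<le> R \<Longrightarrow> \<bar>r'\<bar> \<le> R \<Longrightarrow>
      \<bar>c\<bar> \<le> R \<Longrightarrow> \<bar>c'\<bar> \<le> R \<Longrightarrow> \<bar>e\<bar> \<le> 1 \<Longrightarrow>
      G_dist (orbit_map t e ((z', r'), c')) (orbit_map t e ((z, r), c)) \<le> C * (dist z z' + \<bar>r - r'\<bar> + \<bar>c - c'\<bar>)"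
proof -
  obtain U C where U: "open U" "z0 \<in> U" "0 \<le> C"
    "\<And>z z'. z \<in> SOF \<inter> U \<Longrightarrow> z' \<in> SOF \<inter> U \<Longrightarrow> C1_curve SOF C (C * dist z z') z' z"
    using C1_curve_local[OF assms(1)] by blast
  define A where "A = max (norm (a_mat t)) (norm (a_mat (- t)))"
  define M where "M = 3 * exp R"
  let ?S = "{A :: real^3^3. det A = 1}"
  have sub: "SOF \<subseteq> ?S" using SOF_det by auto
  have mult: "\<And>a b. a \<in> ?S \<Longrightarrow> b \<in> ?S \<Longrightarrow> a ** b \<in> ?S" by (simp add: det_mul)
  have a: "C1_curve ?S A 0 (a_mat t) (a_mat t)"
    by (rule C1_curve_const[OF _ a_mat_inverse]) (auto simp: A_def det_a_mat)
  show ?thesis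
  proof (rule that[of U "(C * A * M ^ 3) * (C * A * M ^ 3)"])
    fix z z' :: "real^3^3" and r r' c c' e :: real
    assume z: "z \<in> SOF \<inter> U" "z' \<in> SOF \<inter> U" and r: "\<bar>r\<bar> \<le> R" "\<bar>r'\<bar> \<le> R" and c: "\<bar>c\<bar> \<le> R" "\<bar>c'\<bar> \<le> R"
      and e: "\<bar>e\<bar> \<le> 1"
    have eR: "\<bar>e\<bar> \<le> R" using e assms(2) by simp
    note curves = C1_curve_mono[OF U(4)[OF z] order_refl order_refl sub] a
      C1_curve_mono[OF one_parameter_curves(1)[OF r] order_refl order_refl sub, folded M_def]
      C1_curve_mono[OF one_parameter_curves(2)[OF c] order_refl order_refl sub, folded M_def]
      C1_curve_mono[OF one_parameter_curves(1)[OF eR eR] order_refl order_refl sub, folded M_def]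
    have "C1_curve ?S ((C * A) * (M * M * M))
       ((C * A) * ((M * M) * (M * \<bar>e - e\<bar>) + (M * (M * \<bar>c - c'\<bar>) + (M * \<bar>r - r'\<bar>) * M) * M)
          + (C * 0 + (C * dist z z') * A) * (M * M * M))
       ((z' ** a_mat t) ** ((up3 r' ** lo3 c') ** up3 e)) ((z ** a_mat t) ** ((up3 r ** lo3 c) ** up3 e))"
      by (intro C1_curve_mult curves mult)
    from G_dist_le[OF this]
    show "G_dist (orbit_map t e ((z', r'), c')) (orbit_map t e ((z, r), c))
       \<le> (C * A * M ^ 3) * (C * A * M ^ 3) * (dist z z' + \<bar>r - r'\<bar> + \<bar>c - c'\<bar>)"
      by (simp add: orbit_map_def power3_eq_cube algebra_simps)
  qed (use U in \<open>auto simp: A_def M_def\<close>)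
qed

text \<open>Each of the two real parameters raises the exponent by 1, and locally Lipschitz maps
  preserve nullness at the new exponent.\<close>

lemma hausdorff_null_orbit_set:
  assumes Z: "Z \<subseteq> SOF" "\<And>z s. z \<in> Z \<Longrightarrow> z ** al3 s \<in> Z" and n: "hausdorff_null dist s Z" and s: "0 < s"
  shows "hausdorff_null G_dist (s + 2) (orbit_set t Z)"
proof -
  have n2: "hausdorff_null dist (s + 2) ((Z \<times> (UNIV :: real set)) \<times> (UNIV :: real set))"
    using hausdorff_null_Times_UNIV[OF hausdorff_null_Times_UNIV[OF n s]] s by (simp add: add.assoc)
  have *: "hausdorff_null G_dist (s + 2) (orbit_map t e ` ((Z \<times> UNIV) \<times> UNIV))" if e: "\<bar>e\<bar> \<le> 1" for e
  proof (rule hausdorff_null_locally_lipschitz_image[OF n2])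
    fix p :: "((real^3^3) \<times> real) \<times> real" assume p: "p \<in> (Z \<times> UNIV) \<times> UNIV"
    obtain z0 r0 c0 where p0: "p = ((z0, r0), c0)" by (metis surj_pair)
    define R where "R = \<bar>r0\<bar> + \<bar>c0\<bar> + 1"
    have R1: "1 \<le> R" by (simp add: R_def)
    have z0: "z0 \<in> SOF" using p Z(1) by (auto simp: p0)
    obtain U C where U: "open U" "z0 \<in> U" "0 \<le> C"
      "\<And>z z' r r' c c' e. z \<in> SOF \<inter> U \<Longrightarrow> z' \<in> SOF \<inter> U \<Longrightarrow> \<bar>r\<bar> \<le> R \<Longrightarrow> \<bar>r'\<bar> \<le> R \<Longrightarrow>
      \<bar>c\<bar> \<le> R \<Longrightarrow> \<bar>c'\<bar> \<le> R \<Longrightarrow> \<bar>e\<bar> \<le> 1 \<Longrightarrow>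
      G_dist (orbit_map t e ((z', r'), c')) (orbit_map t e ((z, r), c)) \<le> C * (dist z z' + \<bar>r - r'\<bar> + \<bar>c - c'\<bar>)"
      by (rule G_dist_orbit_map_le[OF z0 R1, of t]) (rule that)
    let ?V = "(U \<times> {-R<..<R}) \<times> {-R<..<R}"
    have "G_dist (orbit_map t e x) (orbit_map t e y) \<le> (3 * C) * dist x y"
      if x: "x \<in> (Z \<times> UNIV) \<times> UNIV \<inter> ?V" and y: "y \<in> (Z \<times> UNIV) \<times> UNIV \<inter> ?V" for x y
    proof -
      obtain z r c z' r' c' where xy: "y = ((z, r), c)" "x = ((z', r'), c')" by (metis surj_pair)
      have "G_dist (orbit_map t e x) (orbit_map t e y) \<le> C * (dist z z' + \<bar>r - r'\<bar> + \<bar>c - c'\<bar>)"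
        unfolding xy by (rule U(4)) (use x y Z(1) e in \<open>auto simp: xy\<close>)
      also have "\<dots> \<le> C * (dist y x + dist y x + dist y x)"
      proof (intro mult_left_mono add_mono U(3))
        show "dist z z' \<le> dist y x" "\<bar>r - r'\<bar> \<le> dist y x" "\<bar>c - c'\<bar> \<le> dist y x"
          using dist_le_dist_prod[of "(z, r)" "(z', r')" c c'] dist_le_dist_prod[of z z' r r'] dist_le_dist_prod(2)[of c c' "(z, r)" "(z', r')"] dist_le_dist_prod(2)[of r r' z z']
          unfolding xy by (auto simp: dist_real_def intro: order_trans)
      qed
      finally show ?thesis by (simp add: dist_commute algebra_simps)
    qed
    moreover have "open ?V" by (intro open_Times U(1) open_greaterThanLessThan)
    moreover have "p \<in> ?V" using U(2) by (auto simp: p0 R_def)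
    ultimately show "\<exists>U C. open U \<and> p \<in> U \<and> 0 \<le> C \<and> (\<forall>x\<in>(Z \<times> UNIV) \<times> UNIV \<inter> U. \<forall>y\<in>(Z \<times> UNIV) \<times> UNIV \<inter> U.
        G_dist (orbit_map t e x) (orbit_map t e y) \<le> C * dist x y)"
      using U(3) by (intro exI[of _ ?V] exI[of _ "3 * C"]) auto
  qed (use s in simp)
  have "hausdorff_null G_dist (s + 2) (\<Union>e\<in>{0, 1}. orbit_map t e ` ((Z \<times> UNIV) \<times> UNIV))"
    by (rule hausdorff_null_countable_UN) (auto intro: *)
  then show ?thesis by (simp add: orbit_set_eq[OF Z])
qed

lemma small_quotient:
  assumes "z0 \<in> SOF" "0 < \<delta>"
  shows "\<exists>\<eta>>0. \<eta> \<le> 1 \<and> (\<forall>z\<in>SOF \<inter> ball z0 \<eta>. \<forall>z'\<in>SOF \<inter> ball z0 \<eta>. norm (hinv z' ** z - mat 1) \<le> \<delta>)"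
proof -
  define R where "R = norm z0 + 1"
  define \<eta> where "\<eta> = min 1 (\<delta> / (2 * R))"
  have R: "1 \<le> R" by (simp add: R_def)
  have \<eta>: "0 < \<eta>" "\<eta> \<le> 1" using R assms by (auto simp: \<eta>_def)
  have R\<eta>: "R * (2 * \<eta>) \<le> \<delta>"
  proof -
    have "R * (2 * \<eta>) \<le> R * (2 * (\<delta> / (2 * R)))" using R by (intro mult_left_mono) (auto simp: \<eta>_def)
    then show ?thesis using R by simp
  qed
  have "norm (hinv z' ** z - mat 1) \<le> \<delta>" if z: "z \<in> SOF" "dist z0 z < \<eta>" and z': "z' \<in> SOF" "dist z0 z' < \<eta>" for z z'
  proof -
    have "norm (hinv z' ** z - mat 1) \<le> norm z' * norm (z - z')"
      by (rule norm_hinv_mult_diff) (use z' SOF_subset_SOJ in blast)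
    also have "\<dots> \<le> R * (2 * \<eta>)"
    proof (intro mult_mono)
      show "norm z' \<le> R" using z' \<eta> norm_triangle_ineq2[of z' z0]
        by (simp add: R_def dist_norm norm_minus_commute)
      show "norm (z - z') \<le> 2 * \<eta>" using z z' dist_triangle3[of z z' z0] by (simp add: dist_norm norm_minus_commute)
    qed (use R in auto)
    finally show ?thesis using R\<eta> by simp
  qed
  then show ?thesis using \<eta> by (intro exI[of _ \<eta>]) auto
qed

lemma norm_le_translate:
  assumes "z' \<in> SOJ" shows "norm A \<le> norm z' * norm (z' ** A)" "norm (z' ** A) \<le> norm z' * norm A"
proof -
  have "A = hinv z' ** (z' ** A)" using hinv_left[OF assms] by (simp add: matrix_mul_assoc)
  then show "norm A \<le> norm z' * norm (z' ** A)" by (metis norm_matrix_mult_le norm_hinv)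
qed (rule norm_matrix_mult_le)

text \<open>Near a point of \<open>Z\<close>, left translation by \<open>z'\<close> turns a pair
  \<open>z\<close>, \<open>z'\<close> into \<open>hinv z' ** z\<close> and 1, where
  \<open>orbit_map_expanding\<close> applies. A null orbit set thus makes a small product of
  \<open>Z\<close> with two intervals null.\<close>

lemma hausdorff_null_orbit_set_D:
  assumes Z: "Z \<subseteq> SOF" "Z \<noteq> {}" "\<And>z s. z \<in> Z \<Longrightarrow> z ** al3 s \<in> Z" and t: "t \<noteq> 0"
    and n: "hausdorff_null G_dist s (orbit_set t Z)" and s: "0 < s"
  shows "2 < s" "hausdorff_null dist (s - 2) Z"
proof -
  obtain \<delta> \<epsilon> C where E: "0 < \<delta>" "0 < \<epsilon>" "\<epsilon> \<le> 1" "0 < C"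
    "\<And>x r r' c c'. x \<in> SOJ \<Longrightarrow> norm (x - mat 1) \<le> \<delta> \<Longrightarrow> r \<in> {0..\<epsilon>} \<Longrightarrow> r' \<in> {0..\<epsilon>} \<Longrightarrow>
       c \<in> {0..\<epsilon>} \<Longrightarrow> c' \<in> {0..\<epsilon>} \<Longrightarrow>
       norm (x - mat 1, r - r', c - c') \<le>
         C * norm (x ** a_mat t ** (up3 r ** lo3 c) - a_mat t ** (up3 r' ** lo3 c'))"
    by (rule orbit_map_expanding[OF t]) (rule that)
  have up0: "up3 0 = mat 1" by (simp add: up3_def matrix3_simps)
  have loc: "\<exists>U. open U \<and> z0 \<in> U \<and> 2 < s \<and> hausdorff_null dist (s - 2) (Z \<inter> U)" if z0: "z0 \<in> Z" for z0
  proof -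
    obtain \<eta> where \<eta>: "0 < \<eta>" "\<eta> \<le> 1"
      "\<And>z z'. z \<in> SOF \<inter> ball z0 \<eta> \<Longrightarrow> z' \<in> SOF \<inter> ball z0 \<eta> \<Longrightarrow> norm (hinv z' ** z - mat 1) \<le> \<delta>"
      using small_quotient[of z0 \<delta>] z0 Z(1) E(1) by blast
    define R where "R = norm z0 + 1"
    have R: "1 \<le> R" by (simp add: R_def)
    \<comment> \<open>Bounds the images, as \<open>dist_le_G_dist\<close> demands;
      \<open>81 = 9 * 9\<close> accounts for the two unipotent factors.\<close>
    define R' where "R' = R * norm (a_mat t) * 81 + 1"
    have R': "0 < R'" using R by (simp add: R'_def add_nonneg_pos)
    let ?B = "((Z \<inter> ball z0 \<eta>) \<times> {0..\<epsilon>}) \<times> {0..\<epsilon>}"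
    have "hausdorff_null dist s ?B"
    proof (rule hausdorff_null_expanding[OF n, where f = "orbit_map t 0" and C = "(R + 2) * (C * (R * (4 * R')))"])
      show "orbit_map t 0 ` ?B \<subseteq> orbit_set t Z"
      proof -
        have "orbit_map t 0 ` ?B \<subseteq> orbit_map t 0 ` ((Z \<times> UNIV) \<times> UNIV)" by (intro image_mono) auto
        also have "\<dots> \<subseteq> orbit_set t Z" by (subst orbit_set_eq[OF Z(1)]) (auto intro: Z(3))
        finally show ?thesis .
      qed
      fix p q assume p: "p \<in> ?B" and q: "q \<in> ?B"
      obtain z r c z' r' c' where pq: "p = ((z, r), c)" "q = ((z', r'), c')" by (metis surj_pair)
      have zS: "z \<in> SOF \<inter> ball z0 \<eta>" "z' \<in> SOF \<inter> ball z0 \<eta>" and r: "r \<in> {0..\<epsilon>}" "r' \<in> {0..\<epsilon>}"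
        and c: "c \<in> {0..\<epsilon>}" "c' \<in> {0..\<epsilon>}" using p q Z(1) by (auto simp: pq)
      have zJ: "z \<in> SOJ" "z' \<in> SOJ" using zS SOF_subset_SOJ by auto
      have nz: "norm y \<le> R" if "y \<in> SOF \<inter> ball z0 \<eta>" for y
        using that \<eta>(2) norm_triangle_ineq2[of y z0] by (simp add: R_def dist_norm norm_minus_commute)
      define x where "x = hinv z' ** z"
      have xJ: "x \<in> SOJ" unfolding x_def by (intro SOJ_mult hinv_SOJ zJ)
      have z: "z = z' ** x" using hinv_right[OF zJ(2)] by (simp add: x_def matrix_mul_assoc)
      define D where "D = x ** a_mat t ** (up3 r ** lo3 c) - a_mat t ** (up3 r' ** lo3 c')"
      define N where "N = norm (x - mat 1, r - r', c - c')"
      have N: "N \<le> C * norm D" unfolding N_def D_def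
        by (rule E(5)[OF xJ _ r c]) (use \<eta>(3)[OF zS] in \<open>simp add: x_def\<close>)
      have fp: "orbit_map t 0 p - orbit_map t 0 q = z' ** D"
        unfolding pq orbit_map_def D_def
        by (simp add: up0 z matrix_diff_right matrix_mul_assoc)
      have nN: "norm (x - mat 1) \<le> N" "\<bar>r - r'\<bar> \<le> N" "\<bar>c - c'\<bar> \<le> N"
      proof -
        show "norm (x - mat 1) \<le> N" unfolding N_def by (rule norm_fst_le')
        have "norm (r - r', c - c') \<le> N" unfolding N_def by (rule norm_snd_le')
        then show "\<bar>r - r'\<bar> \<le> N" "\<bar>c - c'\<bar> \<le> N"
          using norm_fst_le'[of "r - r'" "c - c'"] norm_snd_le'[of "c - c'" "r - r'"] by auto
      qed
      have "dist p q \<le> (dist z z' + dist r r') + dist c c'"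
        unfolding pq by (intro order_trans[OF dist_prod_le] add_mono dist_prod_le order_refl)
      also have "\<dots> \<le> (R * N + N) + N"
      proof (intro add_mono)
        have "dist z z' = norm (z' ** (x - mat 1))"
          by (simp add: dist_norm z matrix_diff_right)
        also have "\<dots> \<le> R * N"
          by (rule order_trans[OF norm_matrix_mult_le mult_mono]) (use nz[OF zS(2)] nN R in auto)
        finally show "dist z z' \<le> R * N" .
      qed (use nN in \<open>auto simp: dist_real_def\<close>)
      also have "\<dots> = (R + 2) * N" by (simp add: algebra_simps)
      also have "\<dots> \<le> (R + 2) * (C * (R * (4 * R' * G_dist (orbit_map t 0 p) (orbit_map t 0 q))))"
      proof (intro mult_left_mono order_trans[OF N])
        have nf: "norm (orbit_map t 0 y) \<le> R'" "det (orbit_map t 0 y) = 1" if "y \<in> ?B" for y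
        proof -
          obtain z r c where y: "y = ((z, r), c)" by (metis surj_pair)
          have zS: "z \<in> SOF \<inter> ball z0 \<eta>" and rc: "\<bar>r\<bar> \<le> 1" "\<bar>c\<bar> \<le> 1" using that Z(1) E(3) by (auto simp: y)
          have "norm (z ** a_mat t ** (up3 r ** lo3 c)) \<le> (R * norm (a_mat t)) * (9 * 9)"
            using nz[OF zS] up3_lo3_small[OF rc(1)] up3_lo3_small[OF rc(2)] R
            by (intro order_trans[OF norm_matrix_mult_le] mult_mono) auto
          then show "norm (orbit_map t 0 y) \<le> R'" by (simp add: y orbit_map_def up0 R'_def)
          show "det (orbit_map t 0 y) = 1" using zS
            by (simp add: y orbit_map_def det_mul det_a_mat SOF_det up3_SOF lo3_SOF)
        qed
        have "norm D \<le> norm z' * norm (z' ** D)" by (rule norm_le_translate[OF zJ(2)])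
        also have "\<dots> \<le> R * dist (orbit_map t 0 p) (orbit_map t 0 q)"
          unfolding dist_norm fp by (intro mult_right_mono nz zS) simp
        also have "\<dots> \<le> R * (4 * R' * G_dist (orbit_map t 0 p) (orbit_map t 0 q))"
          using R R' by (intro mult_left_mono dist_le_G_dist nf p q) auto
        finally show "norm D \<le> R * (4 * R' * G_dist (orbit_map t 0 p) (orbit_map t 0 q))" .
      qed (use R E(4) in auto)
      finally show "dist p q \<le> (R + 2) * (C * (R * (4 * R'))) * G_dist (orbit_map t 0 p) (orbit_map t 0 q)"
        by (simp add: mult.assoc)
    qed (use s R R' E(4) in auto)
    \<comment> \<open>The two intervals are split off in turn. Nonemptiness yields
      \<open>1 < s\<close> and then \<open>1 < s - 1\<close>.\<close>
    note 1 = hausdorff_null_Times_Icc_D[OF this s E(2)]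
    have ne: "Z \<inter> ball z0 \<eta> \<noteq> {}" using z0 \<eta>(1) by auto
    have "1 < s" "hausdorff_null dist (s - 1) ((Z \<inter> ball z0 \<eta>) \<times> {0..\<epsilon>})" using 1 ne E(2) by auto
    note 2 = hausdorff_null_Times_Icc_D[OF this(2) _ E(2) ne]
    have "1 < s - 1" "hausdorff_null dist (s - 1 - 1) (Z \<inter> ball z0 \<eta>)" using 2 \<open>1 < s\<close> by auto
    then show ?thesis using \<eta>(1) by (intro exI[of _ "ball z0 \<eta>"]) auto
  qed
  show "2 < s" using loc Z(2) by blast
  have "hausdorff_null dist (s - 2) ((\<lambda>x. x) ` Z)"
    by (rule hausdorff_null_local_image) (use loc in \<open>force\<close>)
  then show "hausdorff_null dist (s - 2) Z" by simp
qed

section \<open>The orbit closure in \<open>G/K\<close>\<close>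

lemma X_proj_eq: "X_proj g = (\<lambda>k. g ** k) ` SO3"
  by (auto simp: X_proj_def l_coset_def SL3_def)

lemma X_proj_mult: assumes "k \<in> SO3" shows "X_proj (g ** k) = X_proj g"
proof -
  have "(\<lambda>l. g ** k ** l) ` SO3 = (\<lambda>l. g ** l) ` SO3"
  proof (intro equalityI subsetI)
    fix x assume "x \<in> (\<lambda>l. g ** l) ` SO3"
    then obtain l where l: "l \<in> SO3" "x = g ** l" by blast
    have "x = g ** k ** (transpose k ** l)"
    proof -
      have "g ** k ** (transpose k ** l) = g ** (k ** transpose k) ** l" by (simp add: matrix_mul_assoc)
      then show ?thesis using SO3_D[OF assms] l by simp
    qed
    then show "x \<in> (\<lambda>l. g ** k ** l) ` SO3" using SO3_mult[OF transpose_SO3[OF assms] l(1)] by blast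
  qed (use SO3_mult[OF assms] in \<open>auto simp: matrix_mul_assoc[symmetric]\<close>)
  then show ?thesis by (simp add: X_proj_eq)
qed

lemma X_proj_self: "g \<in> X_proj g"
  unfolding X_proj_eq using one_SO3 by (metis imageI matrix_mul_rid)

text \<open>An orthogonal factor cancels in \<open>g g\<^sup>T\<close>. This is the concrete model
  of \<open>G/K\<close> in which distances of cosets can be bounded below.\<close>

lemma X_proj_member:
  assumes "x \<in> X_proj g"
  shows "x ** transpose x = g ** transpose g" "norm x = norm g" "det x = det g"
proof -
  obtain k where k: "k \<in> SO3" "x = g ** k" using assms by (auto simp: X_proj_eq)
  have "x ** transpose x = g ** (k ** transpose k) ** transpose g"
    unfolding k by (simp add: matrix_transpose_mul matrix_mul_assoc)
  then show eq: "x ** transpose x = g ** transpose g" using SO3_D[OF k(1)] by simp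
  have "(norm x)\<^sup>2 = (norm g)\<^sup>2" by (simp only: norm_sq_trace eq)
  then show "norm x = norm g" by simp
  show "det x = det g" using SO3_D[OF k(1)] by (simp add: k det_mul)
qed

lemma quot_dist_le:
  assumes "x \<in> P" "y \<in> Q" "\<And>x y. x \<in> P \<Longrightarrow> y \<in> Q \<Longrightarrow> 0 \<le> d x y"
  shows "quot_dist d P Q \<le> d x y"
  unfolding quot_dist_def by (rule cInf_lower) (use assms in \<open>auto intro!: bdd_belowI[of _ 0]\<close>)

lemma quot_dist_ge:
  assumes "P \<noteq> {}" "Q \<noteq> {}" "\<And>x y. x \<in> P \<Longrightarrow> y \<in> Q \<Longrightarrow> b \<le> d x y"
  shows "b \<le> quot_dist d P Q"
  unfolding quot_dist_def by (rule cInf_greatest) (use assms in auto)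

lemma X_dist_le:
  assumes "det g = 1" "det g' = 1"
  shows "quot_dist G_dist (X_proj g) (X_proj g') \<le> G_dist g g'"
  by (rule quot_dist_le[OF X_proj_self X_proj_self]) (use assms X_proj_member(3) in \<open>auto intro!: G_dist_nonneg\<close>)

text \<open>All representatives of a coset have the same norm, so one constant serves for the whole
  infimum over the fibres: \<open>2 * R\<close> from the product rule times \<open>4 * R\<close>
  from \<open>dist_le_G_dist\<close>.\<close>

lemma dist_le_X_dist:
  assumes "det g = 1" "det g' = 1" "norm g \<le> R" "norm g' \<le> R" "0 < R"
  shows "norm (g ** transpose g - g' ** transpose g') \<le> 8 * R\<^sup>2 * quot_dist G_dist (X_proj g) (X_proj g')"
proof -
  have "norm (g ** transpose g - g' ** transpose g') / (8 * R\<^sup>2) \<le> quot_dist G_dist (X_proj g) (X_proj g')"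
  proof (rule quot_dist_ge)
    fix x y assume x: "x \<in> X_proj g" and y: "y \<in> X_proj g'"
    note X = X_proj_member[OF x] and Y = X_proj_member[OF y]
    have "x ** transpose x - y ** transpose y = (x - y) ** transpose x + y ** transpose (x - y)"
    proof -
      have "transpose (x - y) = transpose x - transpose y" by (simp add: vec_eq_iff transpose_def)
      then show ?thesis by (simp add: matrix_diff_left matrix_diff_right)
    qed
    also have "norm \<dots> \<le> norm (x - y) * R + R * norm (x - y)"
      using X Y assms
      by (intro order_trans[OF norm_triangle_ineq] add_mono order_trans[OF norm_matrix_mult_le] mult_mono)
        (auto simp: norm_transpose)
    also have "\<dots> = 2 * R * dist x y" by (simp add: dist_norm)
    also have "\<dots> \<le> 2 * R * (4 * R * G_dist x y)"
      using X Y assms by (intro mult_left_mono dist_le_G_dist) auto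
    finally have "norm (g ** transpose g - g' ** transpose g') \<le> 8 * R\<^sup>2 * G_dist x y"
      using X(1) Y(1) by (simp add: power2_eq_square)
    then show "norm (g ** transpose g - g' ** transpose g') / (8 * R\<^sup>2) \<le> G_dist x y"
      using assms(5) by (simp add: divide_le_eq mult.commute)
  qed (use X_proj_self in blast)+
  then show ?thesis using assms(5) by (simp add: divide_le_eq mult.commute)
qed

definition plane_map :: "real \<Rightarrow> (real^3^3) \<times> real \<Rightarrow> (real^3^3) set" where
  "plane_map t p = X_proj (fst p ** a_mat t ** up3 (snd p))"

text \<open>In an Iwasawa decomposition of \<open>g\<close> the diagonal factor is absorbed by
  \<open>Z\<close> and the orthogonal one by the coset. A single parameter survives, hence the shift
  by 1 instead of 2.\<close>

lemma X_proj_orbit_set: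
  assumes Z: "Z \<subseteq> SOF" "\<And>z s. z \<in> Z \<Longrightarrow> z ** al3 s \<in> Z"
  shows "X_proj ` orbit_set t Z = plane_map t ` (Z \<times> UNIV)"
proof (intro equalityI subsetI)
  fix P assume "P \<in> X_proj ` orbit_set t Z"
  then obtain z g where zg: "P = X_proj (z ** a_mat t ** g)" "z \<in> Z" "g \<in> SOF" by (auto simp: orbit_set_def)
  obtain s r k where g: "g = al3 s ** up3 r ** k" "k \<in> SO3" using SOF_Iwasawa[OF zg(3)] by metis
  have "z ** a_mat t ** g = z ** (a_mat t ** al3 s) ** up3 r ** k" by (simp add: g matrix_mul_assoc)
  also have "\<dots> = (z ** al3 s) ** a_mat t ** up3 r ** k" unfolding a_mat_al3 by (simp add: matrix_mul_assoc)
  finally have "P = plane_map t (z ** al3 s, r)" using zg(1) X_proj_mult[OF g(2)] by (simp add: plane_map_def)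
  then show "P \<in> plane_map t ` (Z \<times> UNIV)" using Z(2)[OF zg(2), of s] by blast
next
  fix P assume "P \<in> plane_map t ` (Z \<times> UNIV)"
  then obtain z r where "P = X_proj (z ** a_mat t ** up3 r)" "z \<in> Z" by (auto simp: plane_map_def)
  then show "P \<in> X_proj ` orbit_set t Z" using up3_SOF by (auto simp: orbit_set_def)
qed

lemma hausdorff_null_plane:
  assumes Z: "Z \<subseteq> SOF" "\<And>z s. z \<in> Z \<Longrightarrow> z ** al3 s \<in> Z" and n: "hausdorff_null dist s Z" and s: "0 < s"
  shows "hausdorff_null (quot_dist G_dist) (s + 1) (X_proj ` orbit_set t Z)"
proof -
  have "hausdorff_null (quot_dist G_dist) (s + 1) (plane_map t ` (Z \<times> UNIV))"
  proof (rule hausdorff_null_locally_lipschitz_image[OF hausdorff_null_Times_UNIV[OF n s]])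
    fix p :: "(real^3^3) \<times> real" assume p: "p \<in> Z \<times> UNIV"
    obtain z0 r0 where p0: "p = (z0, r0)" by (metis surj_pair)
    define R where "R = \<bar>r0\<bar> + 1"
    have R1: "1 \<le> R" by (simp add: R_def)
    have z0: "z0 \<in> SOF" using p Z(1) by (auto simp: p0)
    obtain U C where U: "open U" "z0 \<in> U" "0 \<le> C"
      "\<And>z z' r r' c c' e. z \<in> SOF \<inter> U \<Longrightarrow> z' \<in> SOF \<inter> U \<Longrightarrow> \<bar>r\<bar> \<le> R \<Longrightarrow> \<bar>r'\<bar> \<le> R \<Longrightarrow>
      \<bar>c\<bar> \<le> R \<Longrightarrow> \<bar>c'\<bar> \<le> R \<Longrightarrow> \<bar>e\<bar> \<le> 1 \<Longrightarrow>
      G_dist (orbit_map t e ((z', r'), c')) (orbit_map t e ((z, r), c)) \<le> C * (dist z z' + \<bar>r - r'\<bar> + \<bar>c - c'\<bar>)"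
      by (rule G_dist_orbit_map_le[OF z0 R1, of t]) (rule that)
    let ?V = "U \<times> {-R<..<R}"
    have 0: "up3 0 = mat 1" "lo3 0 = mat 1" by (simp_all add: up3_def lo3_def matrix3_simps)
    have "quot_dist G_dist (plane_map t x) (plane_map t y) \<le> (2 * C) * dist x y"
      if x: "x \<in> Z \<times> UNIV \<inter> ?V" and y: "y \<in> Z \<times> UNIV \<inter> ?V" for x y
    proof -
      obtain z r z' r' where xy: "y = (z, r)" "x = (z', r')" by (metis surj_pair)
      have "quot_dist G_dist (plane_map t x) (plane_map t y)
          \<le> G_dist (z' ** a_mat t ** up3 r') (z ** a_mat t ** up3 r)"
        unfolding xy plane_map_def fst_conv snd_conv
        by (rule X_dist_le) (use x y Z(1) in \<open>auto simp: xy det_mul det_a_mat SOF_det up3_SOF\<close>)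
      also have "\<dots> = G_dist (orbit_map t 0 ((z', r'), 0)) (orbit_map t 0 ((z, r), 0))"
        by (simp add: orbit_map_def 0)
      also have "\<dots> \<le> C * (dist z z' + \<bar>r - r'\<bar> + \<bar>0 - 0\<bar>)"
        by (rule U(4)) (use x y Z(1) R1 in \<open>auto simp: xy\<close>)
      also have "\<dots> \<le> C * (dist y x + dist y x)"
        using dist_le_dist_prod[of z z' r r'] dist_le_dist_prod(2)[of r r' z z'] U(3)
        unfolding xy by (intro mult_left_mono) (auto simp: dist_real_def)
      finally show ?thesis by (simp add: dist_commute algebra_simps)
    qed
    moreover have "open ?V" by (intro open_Times U(1) open_greaterThanLessThan)
    moreover have "p \<in> ?V" using U(2) by (auto simp: p0 R_def)
    ultimately show "\<exists>U C. open U \<and> p \<in> U \<and> 0 \<le> C \<and> (\<forall>x\<in>Z \<times> UNIV \<inter> U. \<forall>y\<in>Z \<times> UNIV \<inter> U.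
        quot_dist G_dist (plane_map t x) (plane_map t y) \<le> C * dist x y)"
      using U(3) by (intro exI[of _ ?V] exI[of _ "2 * C"]) auto
  qed (use s in simp)
  moreover have "X_proj ` orbit_set t Z = plane_map t ` (Z \<times> UNIV)"
    by (rule X_proj_orbit_set[OF Z(1)]) (rule Z(2))
  ultimately show ?thesis by (simp only:)
qed

lemma hausdorff_null_plane_D:
  assumes Z: "Z \<subseteq> SOF" "Z \<noteq> {}" "\<And>z s. z \<in> Z \<Longrightarrow> z ** al3 s \<in> Z" and t: "t \<noteq> 0"
    and n: "hausdorff_null (quot_dist G_dist) s (X_proj ` orbit_set t Z)" and s: "0 < s"
  shows "1 < s" "hausdorff_null dist (s - 1) Z"
proof -
  obtain \<delta> r1 r2 C where E: "0 < \<delta>" "0 < r1" "r1 < r2" "r2 \<le> 1" "0 < C"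
    "\<And>x r r'. x \<in> SOJ \<Longrightarrow> norm (x - mat 1) \<le> \<delta> \<Longrightarrow> r \<in> {r1..r2} \<Longrightarrow> r' \<in> {r1..r2} \<Longrightarrow>
       norm (x - mat 1) + \<bar>r - r'\<bar> \<le>
         C * norm (x ** plane_pt t r ** transpose x - plane_pt t r')"
    by (rule plane_map_expanding[OF t]) (rule that)
  have V: "X_proj ` orbit_set t Z = plane_map t ` (Z \<times> UNIV)"
    by (rule X_proj_orbit_set[OF Z(1)]) (rule Z(3))
  have loc: "\<exists>U. open U \<and> z0 \<in> U \<and> 1 < s \<and> hausdorff_null dist (s - 1) (Z \<inter> U)" if z0: "z0 \<in> Z" for z0
  proof -
    obtain \<eta> where \<eta>: "0 < \<eta>" "\<eta> \<le> 1"
      "\<And>z z'. z \<in> SOF \<inter> ball z0 \<eta> \<Longrightarrow> z' \<in> SOF \<inter> ball z0 \<eta> \<Longrightarrow> norm (hinv z' ** z - mat 1) \<le> \<delta>"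
      using small_quotient[of z0 \<delta>] z0 Z(1) E(1) by blast
    define R where "R = norm z0 + 1"
    have R: "1 \<le> R" by (simp add: R_def)
    define R' where "R' = R * norm (a_mat t) * 9 + 1"
    have R': "0 < R'" using R by (simp add: R'_def add_nonneg_pos)
    let ?B = "(Z \<inter> ball z0 \<eta>) \<times> {r1..r2}"
    have "hausdorff_null dist s ?B"
    proof (rule hausdorff_null_expanding[OF n, where f = "plane_map t" and C = "(R + 1) * (C * (R * (R * (8 * R'\<^sup>2))))"])
      show "plane_map t ` ?B \<subseteq> X_proj ` orbit_set t Z"
        unfolding V by (intro image_mono) auto
      fix p q assume p: "p \<in> ?B" and q: "q \<in> ?B"
      obtain z r z' r' where pq: "p = (z, r)" "q = (z', r')" by (metis surj_pair)
      have zS: "z \<in> SOF \<inter> ball z0 \<eta>" "z' \<in> SOF \<inter> ball z0 \<eta>" and r: "r \<in> {r1..r2}" "r' \<in> {r1..r2}"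
        using p q Z(1) by (auto simp: pq)
      have zJ: "z \<in> SOJ" "z' \<in> SOJ" using zS SOF_subset_SOJ by auto
      have nz: "norm y \<le> R" if "y \<in> SOF \<inter> ball z0 \<eta>" for y
        using that \<eta>(2) norm_triangle_ineq2[of y z0] by (simp add: R_def dist_norm norm_minus_commute)
      define x where "x = hinv z' ** z"
      have xJ: "x \<in> SOJ" unfolding x_def by (intro SOJ_mult hinv_SOJ zJ)
      have z: "z = z' ** x" using hinv_right[OF zJ(2)] by (simp add: x_def matrix_mul_assoc)
      define D where "D = x ** plane_pt t r ** transpose x - plane_pt t r'"
      define N where "N = norm (x - mat 1) + \<bar>r - r'\<bar>"
      have N: "N \<le> C * norm D" unfolding N_def D_def
        by (rule E(6)[OF xJ _ r]) (use \<eta>(3)[OF zS] in \<open>simp add: x_def\<close>)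
      define g g' where "g = z ** a_mat t ** up3 r" and "g' = z' ** a_mat t ** up3 r'"
      \<comment> \<open>Congruence by \<open>z'\<close> carries \<open>D\<close> to the difference
        of the positive matrices, so undoing it costs two factors \<open>norm z'\<close>.\<close>
      have gg: "g ** transpose g - g' ** transpose g' = z' ** (D ** transpose z')"
      proof -
        have "g ** transpose g = z' ** (x ** plane_pt t r ** transpose x) ** transpose z'"
          "g' ** transpose g' = z' ** plane_pt t r' ** transpose z'"
          unfolding g_def g'_def z plane_pt_def
          by (simp_all add: matrix_transpose_mul transpose_a_mat matrix_mul_assoc)
        then show ?thesis by (simp add: D_def matrix_diff_left matrix_diff_right matrix_mul_assoc)
      qed
      have "dist p q \<le> dist z z' + dist r r'" unfolding pq by (rule dist_prod_le)
      also have "\<dots> \<le> R * norm (x - mat 1) + R * \<bar>r - r'\<bar>"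
      proof (intro add_mono)
        have "dist z z' = norm (z' ** (x - mat 1))"
          by (simp add: dist_norm z matrix_diff_right)
        also have "\<dots> \<le> R * norm (x - mat 1)"
          by (rule order_trans[OF norm_matrix_mult_le mult_right_mono]) (use nz[OF zS(2)] in auto)
        finally show "dist z z' \<le> R * norm (x - mat 1)" .
        show "dist r r' \<le> R * \<bar>r - r'\<bar>" using mult_right_mono[OF R, of "\<bar>r - r'\<bar>"] by (simp add: dist_real_def)
      qed
      also have "\<dots> = R * N" by (simp add: N_def algebra_simps)
      also have "\<dots> \<le> (R + 1) * N" by (intro mult_right_mono) (auto simp: N_def)
      also have "\<dots> \<le> (R + 1) * (C * (R * (R * (8 * R'\<^sup>2 * quot_dist G_dist (plane_map t p) (plane_map t q)))))"
      proof (intro mult_left_mono order_trans[OF N])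
        have "norm D \<le> norm z' * norm (z' ** transpose D)"
          using norm_le_translate(1)[OF zJ(2), of "transpose D"] by (simp add: norm_transpose)
        also have "norm (z' ** transpose D) = norm (D ** transpose z')"
          using norm_transpose[of "z' ** transpose D"] by (simp add: matrix_transpose_mul)
        also have "norm z' * norm (D ** transpose z') \<le> R * (R * norm (z' ** (D ** transpose z')))"
          using norm_le_translate(1)[OF zJ(2), of "D ** transpose z'"] nz[OF zS(2)] R
            mult_right_mono[OF nz[OF zS(2)] norm_ge_zero[of "z' ** (D ** transpose z')"]]
          by (intro mult_mono) auto
        also have "\<dots> \<le> R * (R * (8 * R'\<^sup>2 * quot_dist G_dist (plane_map t p) (plane_map t q)))"
        proof (intro mult_left_mono)
          have nf: "norm (y ** a_mat t ** up3 \<rho>) \<le> R'" "det (y ** a_mat t ** up3 \<rho>) = 1"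
            if "y \<in> SOF \<inter> ball z0 \<eta>" "\<rho> \<in> {r1..r2}" for y \<rho>
          proof -
            have "\<bar>\<rho>\<bar> \<le> 1" using that(2) E by auto
            then have "norm (y ** a_mat t ** up3 \<rho>) \<le> (R * norm (a_mat t)) * 9"
              using nz[OF that(1)] up3_lo3_small[of \<rho>] R
              by (intro order_trans[OF norm_matrix_mult_le] mult_mono) auto
            then show "norm (y ** a_mat t ** up3 \<rho>) \<le> R'" by (simp add: R'_def)
            show "det (y ** a_mat t ** up3 \<rho>) = 1" using that(1)
              by (simp add: det_mul det_a_mat SOF_det up3_SOF)
          qed
          show "norm (z' ** (D ** transpose z')) \<le> 8 * R'\<^sup>2 * quot_dist G_dist (plane_map t p) (plane_map t q)"
            unfolding gg[symmetric] pq plane_map_def fst_conv snd_conv g_def[symmetric] g'_def[symmetric]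
            by (rule dist_le_X_dist[OF _ _ _ _ R']) (use nf[OF zS(1) r(1)] nf[OF zS(2) r(2)] in \<open>auto simp: g_def g'_def\<close>)
        qed (use R in auto)
        finally show "norm D \<le> R * (R * (8 * R'\<^sup>2 * quot_dist G_dist (plane_map t p) (plane_map t q)))" .
      qed (use R E(5) in auto)
      finally show "dist p q \<le> (R + 1) * (C * (R * (R * (8 * R'\<^sup>2)))) * quot_dist G_dist (plane_map t p) (plane_map t q)"
        by (simp add: mult.assoc)
    qed (use s R R' E(5) in auto)
    note 1 = hausdorff_null_Times_Icc_D[OF this s E(3)]
    have ne: "Z \<inter> ball z0 \<eta> \<noteq> {}" using z0 \<eta>(1) by auto
    show ?thesis using 1[OF ne] \<eta>(1) by (intro exI[of _ "ball z0 \<eta>"]) auto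
  qed
  show "1 < s" using loc Z(2) by blast
  have "hausdorff_null dist (s - 1) ((\<lambda>x. x) ` Z)"
    by (rule hausdorff_null_local_image) (use loc in \<open>force\<close>)
  then show "hausdorff_null dist (s - 1) Z" by simp
qed

text \<open>Continuity gives one inclusion. The other one requires the image of \<open>C\<close> to
  be closed, which in a quotient means that its saturation is closed.\<close>

lemma closure_of_quotient_image:
  assumes q: "quotient_map X Y f" and S: "S \<subseteq> topspace X" and C: "X closure_of S = C"
    and cl: "closedin X {x \<in> topspace X. f x \<in> f ` C}"
  shows "Y closure_of (f ` S) = f ` C"
proof
  have top: "f ` topspace X = topspace Y" using q by (simp add: quotient_map_def)
  have CX: "C \<subseteq> topspace X" using closure_of_subset_topspace[of X S] C by simp
  have SC: "S \<subseteq> C" using closure_of_subset[OF S] C by simp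
  have "f ` C \<subseteq> topspace Y" unfolding top[symmetric] by (rule image_mono[OF CX])
  moreover have "\<forall>U. U \<subseteq> topspace Y \<longrightarrow> closedin X {x \<in> topspace X. f x \<in> U} = closedin Y U"
    using q by (simp add: quotient_map_closedin)
  ultimately have "closedin Y (f ` C)" using cl by simp
  then show "Y closure_of (f ` S) \<subseteq> f ` C" using SC by (intro closure_of_minimal image_mono)
  show "f ` C \<subseteq> Y closure_of (f ` S)"
    using continuous_map_image_closure_subset[OF quotient_imp_continuous_map[OF q], of S] C by simp
qed

lemma closed_mult_SO3:
  assumes "closed W" shows "closed {w ** k | w k. w \<in> W \<and> k \<in> SO3}"
  unfolding closed_sequential_limits
proof (intro allI impI, elim conjE)
  fix f x assume f: "\<forall>n. f n \<in> {w ** k | w k. w \<in> W \<and> k \<in> SO3}" and lim: "f \<longlonglongrightarrow> x"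
  then have "\<forall>n. \<exists>w k. f n = w ** k \<and> w \<in> W \<and> k \<in> SO3" by blast
  then obtain w k where wk: "\<And>n. f n = w n ** k n" "\<And>n. w n \<in> W" "\<And>n. k n \<in> SO3" by metis
  obtain l \<sigma> where l: "l \<in> SO3" and \<sigma>: "strict_mono \<sigma>" "(k \<circ> \<sigma>) \<longlonglongrightarrow> l"
    using compact_SO3 wk(3) unfolding compact_def by metis
  have wn: "w n = f n ** transpose (k n)" for n
    using SO3_D(2)[OF wk(3)[of n]] unfolding wk(1) by (simp add: matrix_mul_assoc[symmetric])
  have "(\<lambda>n. f (\<sigma> n)) \<longlonglongrightarrow> x" using LIMSEQ_subseq_LIMSEQ[OF lim \<sigma>(1)] by (simp add: o_def)
  moreover have "(\<lambda>n. transpose (k (\<sigma> n))) \<longlonglongrightarrow> transpose l"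
    using bounded_linear.tendsto[OF bounded_linear_transpose \<sigma>(2)] by (simp add: o_def)
  ultimately have lim': "(\<lambda>n. w (\<sigma> n)) \<longlonglongrightarrow> x ** transpose l"
    unfolding wn by (intro tendsto_matrix_mult)
  have "x ** transpose l \<in> W" by (rule closed_sequentially[OF assms _ lim']) (rule wk(2))
  moreover have "x = x ** transpose l ** l"
    using SO3_D(1)[OF l] by (simp add: matrix_mul_assoc[symmetric])
  ultimately show "x \<in> {w ** k | w k. w \<in> W \<and> k \<in> SO3}" using l by blast
qed

text \<open>The saturation of \<open>W\<close> is \<open>W K\<close>, closed because
  \<open>K\<close> is compact.\<close>

lemma X_closure_of:
  assumes S: "S \<subseteq> carrier SL3" and W: "G_topology closure_of S = W" "closed W"
  shows "X_topology closure_of (X_proj ` S) = X_proj ` W"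
  unfolding X_topology_def
proof (rule closure_of_quotient_image[OF quotient_map_quot_topology _ W(1)])
  show "S \<subseteq> topspace G_topology" using S by simp
  have WS: "W \<subseteq> carrier SL3" using closure_of_subset_topspace[of G_topology S] W(1) by simp
  have "{x \<in> topspace G_topology. X_proj x \<in> X_proj ` W} = {w ** k | w k. w \<in> W \<and> k \<in> SO3}"
  proof (intro equalityI subsetI)
    fix x assume "x \<in> {x \<in> topspace G_topology. X_proj x \<in> X_proj ` W}"
    then obtain w where "w \<in> W" "X_proj x = X_proj w" by blast
    then show "x \<in> {w ** k | w k. w \<in> W \<and> k \<in> SO3}" using X_proj_self[of x] by (auto simp: X_proj_eq)
  next
    fix x assume "x \<in> {w ** k | w k. w \<in> W \<and> k \<in> SO3}"
    then obtain w k where "x = w ** k" "w \<in> W" "k \<in> SO3" by blast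
    then show "x \<in> {x \<in> topspace G_topology. X_proj x \<in> X_proj ` W}"
      using X_proj_mult WS SO3_D(3) by (auto simp: det_mul)
  qed
  then show "closedin G_topology {x \<in> topspace G_topology. X_proj x \<in> X_proj ` W}"
    using closed_mult_SO3[OF W(2)] by (metis (no_types, lifting) closed_subset mem_Collect_eq subsetI topspace_euclidean_subtopology)
qed

section \<open>The quotient by \<open>\<Gamma>\<close>\<close>

lemma Gamma_inverse:
  assumes "subgroup \<Gamma> SL3" "\<Gamma> \<subseteq> SOF" "\<gamma> \<in> \<Gamma>"
  shows "hinv \<gamma> \<in> \<Gamma>"
proof -
  have g: "\<gamma> \<in> SOF" using assms by blast
  then have gJ: "\<gamma> \<in> SOJ" using SOF_subset_SOJ by blast
  have "inv\<^bsub>SL3\<^esub> \<gamma> = hinv \<gamma>"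
    by (rule group.inv_equality[OF group_SL3])
      (use g gJ hinv_left hinv_SOF SOF_det in \<open>auto simp: SL3_def\<close>)
  then show ?thesis using subgroup.m_inv_closed[OF assms(1,3)] by simp
qed

lemma Gamma_mult: "subgroup \<Gamma> SL3 \<Longrightarrow> x \<in> \<Gamma> \<Longrightarrow> y \<in> \<Gamma> \<Longrightarrow> x ** y \<in> \<Gamma>"
  using subgroup.m_closed[of \<Gamma> SL3 x y] by (simp add: SL3_def)

lemma Gamma_one: "subgroup \<Gamma> SL3 \<Longrightarrow> mat 1 \<in> \<Gamma>"
  using subgroup.one_closed[of \<Gamma> SL3] by (simp add: SL3_def)

lemma r_coset_SL3: "\<Gamma> #>\<^bsub>SL3\<^esub> x = (\<lambda>\<gamma>. \<gamma> ** x) ` \<Gamma>"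
  by (auto simp: r_coset_def SL3_def)

lemma H_dist_translate: "g \<in> SOF \<Longrightarrow> H_dist (g ** x) (g ** y) = H_dist x y"
  unfolding H_dist_def
  by (rule riem_dist_translate[where k = "hinv g"])
    (use hinv_SOF hinv_left SOF_subset_SOJ SOF_mult SOF_det in auto)

text \<open>Discreteness of \<open>\<Gamma>\<close>: a point of \<open>\<Gamma> y\<close> close to \<open>x\<close>, for \<open>x\<close> and \<open>y\<close> close together, is \<open>y\<close> itself.\<close>

lemma dist_le_Gamma_dist:
  assumes G: "subgroup \<Gamma> SL3" "\<Gamma> \<subseteq> SOF" "discrete \<Gamma>" and z0: "z0 \<in> SOF"
  obtains \<eta> K where "0 < \<eta>" "0 \<le> K" "\<And>x y. x \<in> SOF \<inter> ball z0 \<eta> \<Longrightarrow> y \<in> SOF \<inter> ball z0 \<eta> \<Longrightarrow>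
     dist x y \<le> K * quot_dist H_dist (\<Gamma> #>\<^bsub>SL3\<^esub> x) (\<Gamma> #>\<^bsub>SL3\<^esub> y)"
proof -
  have one: "mat 1 \<in> \<Gamma>" by (rule Gamma_one[OF G(1)])
  then obtain \<epsilon> where \<epsilon>: "0 < \<epsilon>" "\<And>\<gamma>. \<gamma> \<in> \<Gamma> \<Longrightarrow> dist (mat 1) \<gamma> < \<epsilon> \<Longrightarrow> \<gamma> = mat 1"
    using discreteD[OF G(3) one] unfolding isolated_in_dist_Ex_iff by blast
  define R where "R = norm z0 + 1"
  \<comment> \<open>If \<open>\<gamma> ** y\<close> is at distance less than \<open>d\<close> from
    \<open>x\<close>, then \<open>norm (\<gamma> - mat 1) \<le> (2 * R * d + 2 * \<eta>) * R \<le>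
    \<epsilon> / 2\<close>, so \<open>\<gamma>\<close> is 1. The bound \<open>d \<le> 1/2\<close> is
    the range of \<open>riem_len_lower\<close>.\<close>
  define \<eta> where "\<eta> = min 1 (\<epsilon> / (8 * R))"
  define d where "d = min (1/2) (\<epsilon> / (8 * R * R))"
  define K where "K = max (4 * R) (2 / d)"
  have R: "1 \<le> R" by (simp add: R_def)
  have \<eta>: "0 < \<eta>" "\<eta> \<le> 1" using R \<epsilon>(1) by (auto simp: \<eta>_def)
  have R\<eta>: "R * (2 * \<eta>) \<le> \<epsilon> / 4"
  proof -
    have "R * (2 * \<eta>) \<le> R * (2 * (\<epsilon> / (8 * R)))" using R by (intro mult_left_mono) (auto simp: \<eta>_def)
    then show ?thesis using R by simp
  qed
  have d: "0 < d" "d \<le> 1/2" using R \<epsilon>(1) by (auto simp: d_def)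
  have Rd: "R * (2 * R * d) \<le> \<epsilon> / 4"
  proof -
    have "R * (2 * R * d) \<le> R * (2 * R * (\<epsilon> / (8 * R * R)))" using R by (intro mult_left_mono) (auto simp: d_def)
    then show ?thesis using R by simp
  qed
  have K: "4 * R \<le> K" "2 / d \<le> K" "0 \<le> K" using R by (auto simp: K_def)
  have ny: "norm y \<le> R" if "y \<in> SOF \<inter> ball z0 \<eta>" for y
    using that \<eta>(2) norm_triangle_ineq2[of y z0] by (simp add: R_def dist_norm norm_minus_commute)
  have main: "dist x y \<le> K * H_dist x (\<gamma> ** y)"
    if x: "x \<in> SOF \<inter> ball z0 \<eta>" and y: "y \<in> SOF \<inter> ball z0 \<eta>" and \<gamma>: "\<gamma> \<in> \<Gamma>" for x y \<gamma>
  proof -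
    have S: "x \<in> SOF" "y \<in> SOF" "\<gamma> ** y \<in> SOF" using x y \<gamma> G(2) SOF_mult by auto
    have xy: "dist x y \<le> 2 * \<eta>" using x y dist_triangle3[of x y z0] by simp
    show ?thesis
    proof (cases "H_dist x (\<gamma> ** y) < d")
      case False
      \<comment> \<open>For distant translates it is enough that
        \<open>dist x y \<le> 2 * \<eta> \<le> 2\<close>.\<close>
      then have "2 / d * d \<le> K * H_dist x (\<gamma> ** y)" using K d by (intro mult_mono) auto
      then show ?thesis using xy \<eta> d by simp
    next
      case True
      then obtain l where l: "riem_len SOF x (\<gamma> ** y) l" "l < d"
        using H_riem_len_exists[OF S(1,3)] unfolding H_dist_def riem_dist_eq
        by (metis (mono_tags, lifting) cInf_lessD empty_iff mem_Collect_eq)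
      have "norm (\<gamma> ** y - x) \<le> 2 * norm x * l"
        using l d by (intro riem_len_lower[OF l(1)]) (auto simp: SOF_det)
      also have "\<dots> \<le> 2 * R * d"
        using ny[OF x] l riem_len_nonneg[OF l(1)] R by (intro mult_mono) auto
      finally have 1: "norm (\<gamma> ** y - x) \<le> 2 * R * d" .
      have yJ: "y \<in> SOJ" using S SOF_subset_SOJ by blast
      have "\<gamma> - mat 1 = (\<gamma> ** y - y) ** hinv y"
        using hinv_right[OF yJ] by (simp add: matrix_diff_left matrix_mul_assoc[symmetric])
      then have "norm (\<gamma> - mat 1) \<le> norm (\<gamma> ** y - y) * norm y"
        by (metis norm_matrix_mult_le norm_hinv)
      also have "\<dots> \<le> (2 * R * d + 2 * \<eta>) * R"
      proof (intro mult_mono ny y)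
        have "norm (\<gamma> ** y - y) \<le> norm (\<gamma> ** y - x) + norm (x - y)"
          by (rule order_trans[OF _ norm_triangle_ineq]) simp
        then show "norm (\<gamma> ** y - y) \<le> 2 * R * d + 2 * \<eta>" using 1 xy by (simp add: dist_norm)
      qed (use R d \<eta> in auto)
      also have "\<dots> \<le> \<epsilon> / 2" using R\<eta> Rd by (simp add: algebra_simps)
      also have "\<dots> < \<epsilon>" using \<epsilon>(1) by simp
      finally have "\<gamma> = mat 1" by (intro \<epsilon>(2) \<gamma>) (simp add: dist_norm norm_minus_commute)
      then have "dist x y \<le> 4 * R * H_dist x (\<gamma> ** y)"
        using R by simp (intro dist_le_H_dist S ny x y, auto)
      also have "\<dots> \<le> K * H_dist x (\<gamma> ** y)" by (intro mult_right_mono K H_dist_nonneg S)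
      finally show ?thesis .
    qed
  qed
  show ?thesis
  proof (rule that[OF \<eta>(1), of "K + 1"])
    fix x y assume x: "x \<in> SOF \<inter> ball z0 \<eta>" and y: "y \<in> SOF \<inter> ball z0 \<eta>"
    have S: "x \<in> SOF" "y \<in> SOF" using x y by auto
    have "dist x y / (K + 1) \<le> quot_dist H_dist (\<Gamma> #>\<^bsub>SL3\<^esub> x) (\<Gamma> #>\<^bsub>SL3\<^esub> y)"
    proof (rule quot_dist_ge)
      fix P Q assume "P \<in> \<Gamma> #>\<^bsub>SL3\<^esub> x" "Q \<in> \<Gamma> #>\<^bsub>SL3\<^esub> y"
      then obtain \<gamma> \<gamma>' where \<gamma>: "\<gamma> \<in> \<Gamma>" "\<gamma>' \<in> \<Gamma>" "P = \<gamma> ** x" "Q = \<gamma>' ** y" by (auto simp: r_coset_SL3)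
      have gS: "\<gamma> \<in> SOF" "\<gamma> \<in> SOJ" "\<gamma>' \<in> SOF" using \<gamma> G(2) SOF_subset_SOJ by auto
      \<comment> \<open>By left invariance one of the two fibre points can be taken to be
        \<open>x\<close> itself.\<close>
      have "H_dist P Q = H_dist (hinv \<gamma> ** (\<gamma> ** x)) (hinv \<gamma> ** (\<gamma>' ** y))"
        unfolding \<gamma> by (rule H_dist_translate[symmetric, OF hinv_SOF[OF gS(1)]])
      also have "\<dots> = H_dist x ((hinv \<gamma> ** \<gamma>') ** y)"
        using hinv_left[OF gS(2)] by (simp add: matrix_mul_assoc)
      finally have eq: "H_dist P Q = H_dist x ((hinv \<gamma> ** \<gamma>') ** y)" .
      have g: "hinv \<gamma> ** \<gamma>' \<in> \<Gamma>" by (intro Gamma_mult[OF G(1)] Gamma_inverse[OF G(1,2)] \<gamma>)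
      have "dist x y \<le> K * H_dist P Q" unfolding eq by (rule main[OF x y g])
      also have "\<dots> \<le> (K + 1) * H_dist P Q" unfolding eq
        by (intro mult_right_mono H_dist_nonneg S SOF_mult) (use gS hinv_SOF in auto)
      finally show "dist x y / (K + 1) \<le> H_dist P Q" using K(3) by (simp add: divide_le_eq mult.commute)
    qed (use one in \<open>auto simp: r_coset_SL3\<close>)
    then show "dist x y \<le> (K + 1) * quot_dist H_dist (\<Gamma> #>\<^bsub>SL3\<^esub> x) (\<Gamma> #>\<^bsub>SL3\<^esub> y)"
      using K(3) by (simp add: divide_le_eq mult.commute)
  qed (use K in simp)
qed

text \<open>The projection does not increase distances, and by discreteness it is locally expanding
  up to a constant.\<close>

lemma hausdorff_null_Gamma_iff:
  assumes G: "subgroup \<Gamma> SL3" "\<Gamma> \<subseteq> SOF" "discrete \<Gamma>" and Z: "Z \<subseteq> SOF" and s: "0 < s"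
  shows "hausdorff_null (quot_dist H_dist) s ((\<lambda>x. \<Gamma> #>\<^bsub>SL3\<^esub> x) ` Z) \<longleftrightarrow> hausdorff_null dist s Z"
proof
  assume n: "hausdorff_null (quot_dist H_dist) s ((\<lambda>x. \<Gamma> #>\<^bsub>SL3\<^esub> x) ` Z)"
  have "hausdorff_null dist s ((\<lambda>x. x) ` Z)"
  proof (rule hausdorff_null_local_image)
    fix z assume "z \<in> Z"
    then have "z \<in> SOF" using Z by blast
    then obtain \<eta> K where \<eta>: "0 < \<eta>" "0 \<le> K" "\<And>x y. x \<in> SOF \<inter> ball z \<eta> \<Longrightarrow> y \<in> SOF \<inter> ball z \<eta> \<Longrightarrow>
       dist x y \<le> K * quot_dist H_dist (\<Gamma> #>\<^bsub>SL3\<^esub> x) (\<Gamma> #>\<^bsub>SL3\<^esub> y)"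
      by (rule dist_le_Gamma_dist[OF G]) (rule that)
    have "hausdorff_null dist s (Z \<inter> ball z \<eta>)"
      by (rule hausdorff_null_expanding[OF n _ \<eta>(2), where f = "\<lambda>x. \<Gamma> #>\<^bsub>SL3\<^esub> x"])
        (use s Z in \<open>auto intro!: \<eta>(3)\<close>)
    then show "\<exists>U. open U \<and> z \<in> U \<and> hausdorff_null dist s ((\<lambda>x. x) ` (Z \<inter> U))"
      using \<eta>(1) by (intro exI[of _ "ball z \<eta>"]) simp
  qed
  then show "hausdorff_null dist s Z" by simp
next
  assume "hausdorff_null dist s Z"
  then have n: "hausdorff_null H_dist s Z" using hausdorff_null_H_dist_iff[OF Z s] by simp
  show "hausdorff_null (quot_dist H_dist) s ((\<lambda>x. \<Gamma> #>\<^bsub>SL3\<^esub> x) ` Z)"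
  proof (rule hausdorff_null_lipschitz_image[OF n zero_le_one])
    fix x y assume xy: "x \<in> Z" "y \<in> Z"
    have self: "x \<in> \<Gamma> #>\<^bsub>SL3\<^esub> x" for x
      unfolding r_coset_SL3 using Gamma_one[OF G(1)] by (metis imageI matrix_mul_lid)
    have "quot_dist H_dist (\<Gamma> #>\<^bsub>SL3\<^esub> x) (\<Gamma> #>\<^bsub>SL3\<^esub> y) \<le> H_dist x y"
      by (rule quot_dist_le[OF self self])
        (use xy Z G(2) in \<open>auto simp: r_coset_SL3 intro!: H_dist_nonneg SOF_mult\<close>)
    then show "quot_dist H_dist (\<Gamma> #>\<^bsub>SL3\<^esub> x) (\<Gamma> #>\<^bsub>SL3\<^esub> y) \<le> 1 * H_dist x y" by simp
  qed (use s in simp)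
qed

text \<open>The translates of \<open>S\<close> by \<open>\<Gamma>\<close> have the same image as
  \<open>S\<close>. Their union is invariant, invariance passes to its closure \<open>Z\<close>, and
  so \<open>Z\<close> is its own saturation.\<close>

lemma GammaH_closure_of:
  assumes G: "subgroup \<Gamma> SL3" "\<Gamma> \<subseteq> SOF" and S: "S \<subseteq> SOF"
    and Z: "Z = closure ((\<lambda>(\<gamma>, x). \<gamma> ** x) ` (\<Gamma> \<times> S))"
  shows "GammaH_topology \<Gamma> closure_of ((\<lambda>x. \<Gamma> #>\<^bsub>SL3\<^esub> x) ` S) = (\<lambda>x. \<Gamma> #>\<^bsub>SL3\<^esub> x) ` Z"
    and "Z \<subseteq> SOF" and "\<And>\<gamma> z. \<gamma> \<in> \<Gamma> \<Longrightarrow> z \<in> Z \<Longrightarrow> \<gamma> ** z \<in> Z"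
proof -
  let ?p = "\<lambda>x. \<Gamma> #>\<^bsub>SL3\<^esub> x"
  define T where "T = (\<lambda>(\<gamma>, x). \<gamma> ** x) ` (\<Gamma> \<times> S)"
  have TS: "T \<subseteq> SOF" using G(2) S SOF_mult by (auto simp: T_def)
  show ZS: "Z \<subseteq> SOF" unfolding Z T_def[symmetric] by (rule closure_minimal[OF TS closed_SOF])
  show inv: "\<gamma> ** z \<in> Z" if "\<gamma> \<in> \<Gamma>" "z \<in> Z" for \<gamma> z
  proof -
    have "(\<lambda>z. \<gamma> ** z) ` closure T \<subseteq> closure T"
    proof (rule image_closure_subset)
      show "continuous_on (closure T) (\<lambda>z. \<gamma> ** z)"
        by (intro continuous_on_matrix_mult continuous_on_const continuous_on_id)
      have "(\<lambda>z. \<gamma> ** z) ` T \<subseteq> T"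
      proof clarify
        fix z assume "z \<in> T"
        then obtain g x where gx: "z = g ** x" "g \<in> \<Gamma>" "x \<in> S" by (auto simp: T_def)
        have "\<gamma> ** z = (\<gamma> ** g) ** x" by (simp add: gx matrix_mul_assoc)
        then show "\<gamma> ** z \<in> T" using Gamma_mult[OF G(1) that(1) gx(2)] gx(3) by (auto simp: T_def)
      qed
      then show "(\<lambda>z. \<gamma> ** z) ` T \<subseteq> closure T" using closure_subset by blast
    qed simp
    then show ?thesis using that(2) unfolding Z T_def[symmetric] by blast
  qed
  have pT: "?p ` T = ?p ` S"
  proof -
    have eq: "?p (\<gamma> ** x) = ?p x" if "\<gamma> \<in> \<Gamma>" for \<gamma> x
    proof -
      have gJ: "\<gamma> \<in> SOJ" using that G(2) SOF_subset_SOJ by blast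
      show ?thesis unfolding r_coset_SL3
      proof (intro equalityI subsetI)
        fix y assume "y \<in> (\<lambda>g. g ** x) ` \<Gamma>"
        then obtain g where g: "g \<in> \<Gamma>" "y = g ** x" by blast
        have "y = (g ** hinv \<gamma>) ** (\<gamma> ** x)"
        proof -
          have "(g ** hinv \<gamma>) ** (\<gamma> ** x) = g ** (hinv \<gamma> ** \<gamma>) ** x" by (simp add: matrix_mul_assoc)
          then show ?thesis using hinv_left[OF gJ] g by simp
        qed
        then show "y \<in> (\<lambda>g. g ** (\<gamma> ** x)) ` \<Gamma>"
          using Gamma_mult[OF G(1) g(1) Gamma_inverse[OF G that]] by blast
      next
        fix y assume "y \<in> (\<lambda>g. g ** (\<gamma> ** x)) ` \<Gamma>"
        then obtain g where g: "g \<in> \<Gamma>" "y = (g ** \<gamma>) ** x" by (auto simp: matrix_mul_assoc)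
        then show "y \<in> (\<lambda>g. g ** x) ` \<Gamma>" using Gamma_mult[OF G(1) g(1) that] by blast
      qed
    qed
    show ?thesis
    proof (intro equalityI subsetI)
      fix P assume "P \<in> ?p ` S"
      then obtain x where x: "x \<in> S" "P = ?p x" by blast
      have "(\<lambda>(\<gamma>, x). \<gamma> ** x) (mat 1, x) \<in> T"
        unfolding T_def by (rule imageI) (use x Gamma_one[OF G(1)] in auto)
      then have "mat 1 ** x \<in> T" by simp
      then show "P \<in> ?p ` T" using x by simp
    qed (auto simp: T_def eq)
  qed
  have cl: "H_topology closure_of T = Z"
    using ZS TS unfolding Z T_def[symmetric]
    by (simp add: closure_of_subtopology inf.absorb2)
  have "GammaH_topology \<Gamma> closure_of (?p ` T) = ?p ` Z"
    unfolding GammaH_topology_def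
  proof (rule closure_of_quotient_image[OF quotient_map_quot_topology _ cl])
    show "T \<subseteq> topspace H_topology" using TS by simp
    have "{x \<in> topspace H_topology. ?p x \<in> ?p ` Z} = Z"
    proof (intro equalityI subsetI)
      fix x assume "x \<in> {x \<in> topspace H_topology. ?p x \<in> ?p ` Z}"
      then obtain z where z: "z \<in> Z" "?p x = ?p z" by blast
      have "x \<in> ?p x" unfolding r_coset_SL3 using Gamma_one[OF G(1)] by (metis imageI matrix_mul_lid)
      then obtain \<gamma> where "\<gamma> \<in> \<Gamma>" "x = \<gamma> ** z" using z(2) by (auto simp: r_coset_SL3)
      then show "x \<in> Z" using inv z(1) by blast
    qed (use ZS in auto)
    then show "closedin H_topology {x \<in> topspace H_topology. ?p x \<in> ?p ` Z}"
      using closedin_closure_of[of H_topology T] cl by simp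
  qed
  then show "GammaH_topology \<Gamma> closure_of (?p ` S) = ?p ` Z" by (simp only: pT)
qed

section \<open>The dimensions\<close>

text \<open>The conclusion \<open>c < s\<close> in \<open>low\<close> ensures that
  \<open>s - c\<close> is again one of the positive exponents whose infimum is the
  dimension.\<close>

lemma hausdorff_dim_shift:
  assumes "0 \<le> c" and up: "\<And>s. 0 < s \<Longrightarrow> hausdorff_null d s A \<Longrightarrow> hausdorff_null d' (s + c) B"
    and low: "\<And>s. 0 < s \<Longrightarrow> hausdorff_null d' s B \<Longrightarrow> c < s \<and> hausdorff_null d (s - c) A"
  shows "hausdorff_dim d' B = ennreal c + hausdorff_dim d A"
proof (rule antisym)
  have "hausdorff_dim d' B - ennreal c \<le> hausdorff_dim d A"
    unfolding hausdorff_dim_eq_INF[of d A]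
  proof (rule INF_greatest)
    fix s assume s: "s \<in> {s. 0 < s \<and> hausdorff_null d s A}"
    then have "hausdorff_dim d' B \<le> ennreal (s + c)"
      unfolding hausdorff_dim_eq_INF using assms(1) by (intro INF_lower) (simp add: up)
    also have "ennreal (s + c) = ennreal s + ennreal c" using s assms(1) by (intro ennreal_plus) auto
    finally show "hausdorff_dim d' B - ennreal c \<le> ennreal s" by (simp add: ennreal_minus_le_iff add.commute)
  qed
  then show "hausdorff_dim d' B \<le> ennreal c + hausdorff_dim d A"
    by (simp add: ennreal_minus_le_iff add.commute)
  show "ennreal c + hausdorff_dim d A \<le> hausdorff_dim d' B"
    unfolding hausdorff_dim_eq_INF[of d' B]
  proof (rule INF_greatest)
    fix s assume "s \<in> {s. 0 < s \<and> hausdorff_null d' s B}"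
    then have s: "0 < s" "c < s" "hausdorff_null d (s - c) A" using low by auto
    have "hausdorff_dim d A \<le> ennreal (s - c)"
      unfolding hausdorff_dim_eq_INF by (rule INF_lower) (use s in simp)
    then have "ennreal c + hausdorff_dim d A \<le> ennreal c + ennreal (s - c)" by (rule add_left_mono)
    also have "\<dots> = ennreal s" using assms(1) s by (simp add: ennreal_plus[symmetric])
    finally show "ennreal c + hausdorff_dim d A \<le> ennreal s" .
  qed
qed

lemma dist_le_exp_dist:
  assumes "0 \<le> s" "0 \<le> s'" shows "\<bar>s - s'\<bar> \<le> \<bar>exp s - exp s' :: real\<bar>"
proof -
  have *: "s - s' \<le> exp s - exp s'" if "s' \<le> s" "0 \<le> s'" for s s' :: real
  proof -
    have "s - s' \<le> exp (s - s') - 1" using exp_ge_add_one_self[of "s - s'"] by linarith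
    also have "\<dots> \<le> exp s' * (exp (s - s') - 1)"
      using that mult_right_mono[of 1 "exp s'" "exp (s - s') - 1"] by simp
    also have "\<dots> = exp s - exp s'" by (simp add: right_diff_distrib exp_add[symmetric])
    finally show ?thesis .
  qed
  show ?thesis
  proof (cases "s' \<le> s")
    case True
    then show ?thesis using *[OF True assms(2)] by simp
  next
    case False
    then show ?thesis using *[of s s'] assms by simp
  qed
qed

text \<open>\<open>Z\<close> contains a curve \<open>h A0\<close>, along which the parameter is a
  Lipschitz function on \<open>{0..1}\<close> because the corner entry of \<open>al3 s\<close> is
  \<open>exp s\<close>.\<close>

lemma one_less_exponent:
  assumes Z: "Z \<subseteq> SOF" "Z \<noteq> {}" "\<And>z s. z \<in> Z \<Longrightarrow> z ** al3 s \<in> Z"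
    and n: "hausdorff_null dist s Z" and s: "0 < s"
  shows "1 < s"
proof -
  obtain h where h: "h \<in> Z" using Z(2) by blast
  have hJ: "h \<in> SOJ" using h Z(1) SOF_subset_SOJ by blast
  \<comment> \<open>The segment is written as the product of a point with an interval, so that
    \<open>hausdorff_null_Times_Icc_D\<close> supplies \<open>1 < s\<close>.\<close>
  have "hausdorff_null dist s ({0 :: real} \<times> {0..1 :: real})"
  proof (rule hausdorff_null_expanding[OF n, where f = "\<lambda>p. h ** al3 (snd p)" and C = "norm h"])
    show "(\<lambda>p. h ** al3 (snd p)) ` ({0} \<times> {0..1}) \<subseteq> Z" using Z(3)[OF h] by auto
    fix p q :: "real \<times> real" assume p: "p \<in> {0} \<times> {0..1}" and q: "q \<in> {0} \<times> {0..1}"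
    obtain x y where xy: "p = (0, x)" "q = (0, y)" "0 \<le> x" "0 \<le> y" using p q by auto
    have "dist p q = \<bar>x - y\<bar>" unfolding xy dist_Pair_Pair by (simp add: dist_real_def)
    also have "\<dots> \<le> \<bar>exp x - exp y\<bar>" by (rule dist_le_exp_dist[OF xy(3,4)])
    also have "\<dots> = \<bar>(al3 x - al3 y)$1$1\<bar>" by (simp add: al3_def diag3_eq)
    also have "\<dots> \<le> norm (al3 x - al3 y)" by (rule abs_entry_le_norm)
    also have "\<dots> \<le> norm h * norm (h ** (al3 x - al3 y))" by (rule norm_le_translate[OF hJ])
    also have "\<dots> = norm h * dist (h ** al3 (snd p)) (h ** al3 (snd q))"
      by (simp add: xy dist_norm matrix_diff_right)
    finally show "dist p q \<le> norm h * dist (h ** al3 (snd p)) (h ** al3 (snd q))" .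
  qed (use s in auto)
  from hausdorff_null_Times_Icc_D(1)[OF this s] show ?thesis by simp
qed

text \<open>For finite \<open>D\<close> this rearranges to \<open>1 \<le> D\<close>; the infinite
  value is immediate.\<close>

lemma ennreal_half_bound:
  fixes D :: ennreal
  assumes "1 \<le> D" shows "1 / 2 * (3 + D) \<le> 1 + D"
proof (cases D)
  case (real x)
  then have x: "1 \<le> x" using assms by simp
  have "inverse (ennreal 2) = ennreal (inverse 2)" by (rule inverse_ennreal) simp
  then have "1 / 2 = ennreal (1 / 2)" by (simp add: divide_ennreal_def inverse_eq_divide)
  then have "1 / 2 * (3 + D) = ennreal (1 / 2) * (ennreal 3 + ennreal x)" by (simp only: real ennreal_numeral)
  also have "\<dots> = ennreal (1 / 2 * (3 + x))"
    using x by (subst ennreal_plus[symmetric], simp, simp, subst ennreal_mult[symmetric]) simp_all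
  also have "\<dots> \<le> ennreal (1 + x)" using x by (intro ennreal_leI) simp
  also have "\<dots> = 1 + D" using real by (simp add: ennreal_plus)
  finally show ?thesis .
qed simp

lemma mult_SL3: "x \<otimes>\<^bsub>SL3\<^esub> y = x ** y"
  by (simp add: SL3_def)

theorem theorem7p2:
  fixes \<Gamma> :: "(real^3^3) set" and h :: "real^3^3" and t :: real
  assumes "subgroup \<Gamma> SL3" and "\<Gamma> \<subseteq> SOF" and "discrete \<Gamma>"
    and "h \<in> SOF" and "t \<noteq> 0"
  shows "dim_G (G_topology closure_of (\<Gamma> <#>\<^bsub>SL3\<^esub> ((h ** a_mat t) <#\<^bsub>SL3\<^esub> SOF)))
           = 2 + dim_H (H_topology closure_of (Gamma_h_A0 \<Gamma> h))
       \<and> (geodesic_admissible \<Gamma> h \<longrightarrow>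
           1 / 2 * (3 + dim_H (H_topology closure_of (Gamma_h_A0 \<Gamma> h)))
             \<le> dim_X (X_topology closure_of (Gamma_orbit \<Gamma> (Y_plane h t)))
         \<and> dim_X (X_topology closure_of (Gamma_orbit \<Gamma> (Y_plane h t)))
             \<le> 1 + dim_H (H_topology closure_of (Gamma_h_A0 \<Gamma> h)))
       \<and> (geodesic_admissible \<Gamma> h
           \<and> 1 < dim_GammaH (GammaH_topology \<Gamma> closure_of
                    ((\<lambda>x. \<Gamma> #>\<^bsub>SL3\<^esub> x) ` (h <#\<^bsub>SL3\<^esub> A0)))
           \<and> dim_GammaH (GammaH_topology \<Gamma> closure_of
                    ((\<lambda>x. \<Gamma> #>\<^bsub>SL3\<^esub> x) ` (h <#\<^bsub>SL3\<^esub> A0))) < 2 \<longrightarrow>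
           2 < dim_X (X_topology closure_of (Gamma_orbit \<Gamma> (Y_plane h t)))
         \<and> dim_X (X_topology closure_of (Gamma_orbit \<Gamma> (Y_plane h t))) < 3)"
proof -
  note G = assms(1-3)
  define S where "S = h <#\<^bsub>SL3\<^esub> A0"
  have S: "S = range (\<lambda>s. h ** al3 s)" by (auto simp: S_def l_coset_def SL3_def A0_eq)
  have SS: "S \<subseteq> SOF" using assms(4) by (auto simp: S intro!: SOF_mult al3_SOF)
  define T where "T = Gamma_h_A0 \<Gamma> h"
  have T: "T = (\<lambda>(\<gamma>, x). \<gamma> ** x) ` (\<Gamma> \<times> S)"
    unfolding T_def Gamma_h_A0_def S_def[symmetric] set_mult_def by (force simp: mult_SL3)
  define Z where "Z = closure T"
  note GH = GammaH_closure_of[OF G(1,2) SS Z_def[unfolded T]]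
  note ZS = GH(2)
  have TZ: "T \<subseteq> Z" unfolding Z_def by (rule closure_subset)
  have clZ: "closed Z" by (simp add: Z_def)
  have HZ: "H_topology closure_of Gamma_h_A0 \<Gamma> h = Z"
    using ZS TZ by (simp add: T_def[symmetric] closure_of_subtopology inf.absorb2 Z_def)
  have hal: "\<gamma> ** h ** al3 s \<in> T" if "\<gamma> \<in> \<Gamma>" for \<gamma> s
  proof -
    have "(\<lambda>(\<gamma>, x). \<gamma> ** x) (\<gamma>, h ** al3 s) \<in> T" unfolding T by (rule imageI) (use that in \<open>auto simp: S\<close>)
    then show ?thesis by (simp add: matrix_mul_assoc)
  qed
  have Zne: "Z \<noteq> {}" using hal[OF Gamma_one[OF G(1)]] TZ by blast
  have Zal: "z ** al3 s \<in> Z" if "z \<in> Z" for z s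
  proof -
    have "(\<lambda>z. z ** al3 s) ` closure T \<subseteq> Z"
    proof (rule image_closure_subset[OF _ clZ])
      show "continuous_on (closure T) (\<lambda>z. z ** al3 s)"
        by (intro continuous_on_matrix_mult continuous_on_const continuous_on_id)
      have "al3 a ** al3 b = al3 (a + b)" for a b
        by (simp add: al3_def matrix3_simps exp_add[symmetric])
      then have eq: "\<gamma> ** (h ** al3 a) ** al3 s = \<gamma> ** h ** al3 (a + s)" for \<gamma> a
        by (simp add: matrix_mul_assoc[symmetric])
      show "(\<lambda>z. z ** al3 s) ` T \<subseteq> Z"
      proof clarify
        fix z assume "z \<in> T"
        then obtain \<gamma> a where "z = \<gamma> ** (h ** al3 a)" "\<gamma> \<in> \<Gamma>" by (auto simp: T S)
        then show "z ** al3 s \<in> Z" using hal[of \<gamma> "a + s"] TZ by (simp only: eq subset_iff)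
      qed
    qed
    then show ?thesis using that by (auto simp: Z_def)
  qed
  \<comment> \<open>Since \<open>W\<close> is closed, it equals the closure of \<open>O1\<close>
    once \<open>O1\<close> lies in \<open>W\<close> and right multiplication by
    \<open>a_mat t ** g\<close> carries the closure of \<open>T\<close> into that of
    \<open>O1\<close>.\<close>
  define W where "W = orbit_set t Z"
  have clW: "closed W" unfolding W_def by (rule closed_orbit_set[OF ZS Zal clZ assms(5)])
  define O1 where "O1 = \<Gamma> <#>\<^bsub>SL3\<^esub> ((h ** a_mat t) <#\<^bsub>SL3\<^esub> SOF)"
  have O1: "O1 = {\<gamma> ** (h ** a_mat t ** g) | \<gamma> g. \<gamma> \<in> \<Gamma> \<and> g \<in> SOF}"
    by (auto simp: O1_def set_mult_def l_coset_def SL3_def)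
  have al0: "al3 0 = mat 1" by (simp add: al3_def matrix3_simps)
  have O1W: "O1 \<subseteq> W"
  proof
    fix w assume "w \<in> O1"
    then obtain \<gamma> g where w: "w = \<gamma> ** (h ** a_mat t ** g)" "\<gamma> \<in> \<Gamma>" "g \<in> SOF" by (auto simp: O1)
    have "\<gamma> ** h \<in> Z" using hal[OF w(2), of 0] TZ by (auto simp: al0 matrix_mul_rid)
    moreover have "w = (\<gamma> ** h) ** a_mat t ** g" by (simp add: w matrix_mul_assoc)
    ultimately show "w \<in> W" using w(3) by (auto simp: W_def orbit_set_def)
  qed
  have W1: "W \<subseteq> carrier SL3" using ZS by (auto simp: W_def orbit_set_def det_mul det_a_mat SOF_det)
  have "W \<subseteq> closure O1"
  proof
    fix w assume "w \<in> W"
    then obtain z g where w: "w = z ** a_mat t ** g" "z \<in> Z" "g \<in> SOF" by (auto simp: W_def orbit_set_def)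
    have "(\<lambda>z. z ** a_mat t ** g) ` closure T \<subseteq> closure O1"
    proof (rule image_closure_subset[OF _ closed_closure])
      show "continuous_on (closure T) (\<lambda>z. z ** a_mat t ** g)"
        by (intro continuous_on_matrix_mult continuous_on_const continuous_on_id)
      have "(\<lambda>z. z ** a_mat t ** g) ` T \<subseteq> O1"
      proof clarify
        fix z assume "z \<in> T"
        then obtain \<gamma> s where z: "z = \<gamma> ** (h ** al3 s)" "\<gamma> \<in> \<Gamma>" by (auto simp: T S)
        \<comment> \<open>The diagonal factor is moved across \<open>a_mat t\<close> and merged into
          \<open>g\<close>.\<close>
        have "z ** a_mat t ** g = \<gamma> ** h ** (al3 s ** a_mat t) ** g" by (simp add: z matrix_mul_assoc)
        also have "\<dots> = \<gamma> ** (h ** a_mat t ** (al3 s ** g))"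
          unfolding a_mat_al3[symmetric] by (simp add: matrix_mul_assoc)
        finally show "z ** a_mat t ** g \<in> O1" unfolding O1 using z(2) SOF_mult[OF al3_SOF w(3)] by blast
      qed
      then show "(\<lambda>z. z ** a_mat t ** g) ` T \<subseteq> closure O1" using closure_subset by blast
    qed
    then show "w \<in> closure O1" using w by (auto simp: Z_def)
  qed
  moreover have "closure O1 \<subseteq> W" by (rule closure_minimal[OF O1W clW])
  ultimately have "closure O1 = W" by blast
  moreover have O1S: "O1 \<subseteq> carrier SL3" using O1W W1 by blast
  ultimately have GW: "G_topology closure_of O1 = W"
    using W1 by (simp add: closure_of_subtopology inf.absorb2)
  have orb: "Gamma_orbit \<Gamma> (Y_plane h t) = X_proj ` O1"
  proof -
    have m: "\<gamma> <#\<^bsub>SL3\<^esub> X_proj x = X_proj (\<gamma> ** x)" for \<gamma> x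
      by (auto simp: X_proj_eq l_coset_def SL3_def matrix_mul_assoc)
    have "Gamma_orbit \<Gamma> (Y_plane h t) = (\<Union>\<gamma>\<in>\<Gamma>. (\<lambda>g. X_proj (\<gamma> ** (h ** a_mat t ** g))) ` SOF)"
      unfolding Gamma_orbit_def Y_plane_def image_image m ..
    also have "\<dots> = X_proj ` O1" unfolding O1 by blast
    finally show ?thesis .
  qed
  have XW: "X_topology closure_of (Gamma_orbit \<Gamma> (Y_plane h t)) = X_proj ` W"
    unfolding orb by (rule X_closure_of[OF O1S GW clW])
  \<comment> \<open>All dimensions in the theorem are now expressed through the Euclidean dimension
    of the one set \<open>Z\<close>.\<close>
  have dH: "dim_H Z = hausdorff_dim dist Z"
    unfolding dim_H_def hausdorff_dim_eq_INF
    by (intro arg_cong[where f=Inf] image_cong refl) (auto simp: hausdorff_null_H_dist_iff[OF ZS])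
  have dG: "dim_G W = ennreal 2 + hausdorff_dim dist Z"
    unfolding dim_G_def W_def
    by (rule hausdorff_dim_shift)
      (use hausdorff_null_orbit_set[OF ZS Zal] hausdorff_null_orbit_set_D[OF ZS Zne Zal assms(5)] in auto)
  have dX: "dim_X (X_proj ` W) = ennreal 1 + hausdorff_dim dist Z"
    unfolding dim_X_def W_def
    by (rule hausdorff_dim_shift)
      (use hausdorff_null_plane[OF ZS Zal] hausdorff_null_plane_D[OF ZS Zne Zal assms(5)] in auto)
  have d\<Gamma>: "dim_GammaH (GammaH_topology \<Gamma> closure_of ((\<lambda>x. \<Gamma> #>\<^bsub>SL3\<^esub> x) ` (h <#\<^bsub>SL3\<^esub> A0)))
      = hausdorff_dim dist Z"
    unfolding S_def[symmetric] GH(1) dim_GammaH_def hausdorff_dim_eq_INF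
    by (intro arg_cong[where f=Inf] image_cong refl) (auto simp: hausdorff_null_Gamma_iff[OF G ZS])
  have D1: "1 \<le> hausdorff_dim dist Z"
    unfolding hausdorff_dim_eq_INF
  proof (rule INF_greatest)
    fix s assume "s \<in> {s. 0 < s \<and> hausdorff_null dist s Z}"
    then have "1 < s" using one_less_exponent[OF ZS Zne Zal] by blast
    then show "1 \<le> ennreal s" by (simp add: ennreal_1[symmetric] ennreal_leI del: ennreal_1)
  qed
  have three: "2 < 1 + D \<and> 1 + D < 3" if "1 < D" "D < 2" for D :: ennreal
  proof (cases D)
    case (real x)
    then have "1 < x" "x < 2" using that by (simp_all add: ennreal_less_iff ennreal_1[symmetric] ennreal_numeral[symmetric] del: ennreal_1 ennreal_numeral)
    then have "ennreal 2 < ennreal (1 + x)" "ennreal (1 + x) < ennreal 3" by (simp_all add: ennreal_less_iff del: ennreal_plus ennreal_numeral)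
    then show ?thesis using real by (simp add: ennreal_plus)
  qed (use that in simp)
  show ?thesis
    unfolding HZ XW O1_def[symmetric] GW dH dG dX d\<Gamma>
    using ennreal_half_bound[OF D1] three[of "hausdorff_dim dist Z"] by auto
qed

end
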